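(* Let $d\ge1$, $\varepsilon>0$, $\Xi=\mathbb{R}^d_x\times\mathbb{R}^d_\xi$ and $f,g\in\mathcal{S}(\Xi)$. Then the distribution $f\star g$ on $\Xi$ which satisfies $\mathrm{Op}(f\star g)=\mathrm{Op}(f)\,\mathrm{Op}(g)$ is a Schwartz function, given by $$(f\star g)(X)=\frac{1}{(2\pi)^{2d}}\int_\Xi dY\int_\Xi dZ\,e^{i\sigma(X,Y+Z)}\,e^{i\frac{\varepsilon}{2}\sigma(Y,Z)}\,(\mathcal{F}_\sigma f)(Y)\,(\mathcal{F}_\sigma g)(Z)$$ $$=\frac{1}{(\pi\varepsilon)^{2d}}\int_\Xi dY\int_\Xi dZ\,e^{-i\frac{2}{\varepsilon}\sigma(X-Y,X-Z)}\,f(Y)\,g(Z).$$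
   Context: For $X=(x,\xi),Y=(y,\eta)\in\Xi$ put $\sigma(X,Y)=\xi\cdot y-x\cdot\eta$. The symplectic Fourier transform of $f\in\mathcal{S}(\Xi)$ is $(\mathcal{F}_\sigma f)(X)=(2\pi)^{-d}\int_\Xi dY\,e^{i\sigma(X,Y)}f(Y)$. Let $\mathsf{Q}$ be multiplication by $x$ and $\mathsf{P}=-i\varepsilon\nabla_x$ on $L^2(\mathbb{R}^d)$. The Weyl system is the family of unitaries $W(X)=e^{-i(\xi\cdot\mathsf{Q}-x\cdot\mathsf{P})}$, and the Weyl quantization of $f\in\mathcal{S}(\Xi)$ is the bounded operator $\mathrm{Op}(f)=(2\pi)^{-d}\int_\Xi dX\,(\mathcal{F}_\sigma f)(X)\,W(X)$ on $L^2(\mathbb{R}^d)$. *)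

theory Defs
  imports "HOL-Analysis.Analysis"
begin

section \<open>Schwartz functions and tempered distributions\<close>

fun iter_partial :: "'a list \<Rightarrow> ('a::euclidean_space \<Rightarrow> complex) \<Rightarrow> 'a \<Rightarrow> complex" where
  "iter_partial [] f = f"
| "iter_partial (b # bs) f = (\<lambda>x. frechet_derivative (iter_partial bs f) (at x) b)"

text \<open>Requiring every iterated partial derivative to be (totally) differentiable everywhere
  is smoothness; it also excludes arbitrary values of \<^const>\<open>frechet_derivative\<close>.\<close>

definition smooth :: "('a::euclidean_space \<Rightarrow> complex) \<Rightarrow> bool" where
  "smooth f \<longleftrightarrow> (\<forall>bs x. set bs \<subseteq> Basis \<longrightarrow> iter_partial bs f differentiable (at x))"

definition schwartz :: "('a::euclidean_space \<Rightarrow> complex) \<Rightarrow> bool" where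
  "schwartz f \<longleftrightarrow> smooth f \<and>
     (\<forall>bs k. set bs \<subseteq> Basis \<longrightarrow>
        (\<exists>C. \<forall>x. (1 + norm x) ^ k * norm (iter_partial bs f x) \<le> C))"

definition schwartz_norm :: "nat \<Rightarrow> ('a::euclidean_space \<Rightarrow> complex) \<Rightarrow> real" where
  "schwartz_norm N f =
     (\<Sum>bs | set bs \<subseteq> Basis \<and> length bs \<le> N.
        SUP x. (1 + norm x) ^ N * norm (iter_partial bs f x))"

text \<open>A tempered distribution is a continuous complex-linear functional on the Schwartz space;
  its values outside that space are irrelevant.\<close>

definition tempered_distribution :: "(('a::euclidean_space \<Rightarrow> complex) \<Rightarrow> complex) \<Rightarrow> bool" where
  "tempered_distribution T \<longleftrightarrow>
     (\<forall>\<phi> \<psi>. schwartz \<phi> \<longrightarrow> schwartz \<psi> \<longrightarrow> T (\<lambda>x. \<phi> x + \<psi> x) = T \<phi> + T \<psi>) \<and>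
     (\<forall>c \<phi>. schwartz \<phi> \<longrightarrow> T (\<lambda>x. c * \<phi> x) = c * T \<phi>) \<and>
     (\<exists>N C. \<forall>\<phi>. schwartz \<phi> \<longrightarrow> norm (T \<phi>) \<le> C * schwartz_norm N \<phi>)"

definition dist_of_fun :: "('a::euclidean_space \<Rightarrow> complex) \<Rightarrow> ('a \<Rightarrow> complex) \<Rightarrow> complex" where
  "dist_of_fun h \<phi> = (LINT x|lborel. h x * \<phi> x)"

section \<open>The Hilbert space of square-integrable functions\<close>

definition square_integrable :: "('a::euclidean_space \<Rightarrow> complex) \<Rightarrow> bool" where
  "square_integrable f \<longleftrightarrow>
     f \<in> borel_measurable lborel \<and> integrable lborel (\<lambda>x. (norm (f x))\<^sup>2)"

definition L2_rel :: "('a::euclidean_space \<Rightarrow> complex) \<Rightarrow> ('a \<Rightarrow> complex) \<Rightarrow> bool" where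
  "L2_rel f g \<longleftrightarrow>
     square_integrable f \<and> square_integrable g \<and> (AE x in lborel. f x = g x)"

lemma square_integrable_zero: "square_integrable (\<lambda>_. 0)"
  by (simp add: square_integrable_def)

lemma square_integrable_add:
  assumes "square_integrable f" "square_integrable g"
  shows "square_integrable (\<lambda>x. f x + g x)"
proof -
  have [measurable]: "f \<in> borel_measurable lborel" "g \<in> borel_measurable lborel"
    using assms by (auto simp: square_integrable_def)
  have *: "(norm (a + b))\<^sup>2 \<le> 2 * (norm a)\<^sup>2 + 2 * (norm b)\<^sup>2" for a b :: complex
  proof -
    have "(norm (a + b))\<^sup>2 \<le> (norm a + norm b)\<^sup>2"
      by (simp add: norm_triangle_ineq power_mono)
    also have "\<dots> \<le> 2 * (norm a)\<^sup>2 + 2 * (norm b)\<^sup>2"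
      using zero_le_power2[of "norm a - norm b"]
      by (simp add: power2_eq_square algebra_simps)
    finally show ?thesis .
  qed
  have "integrable lborel (\<lambda>x. (norm (f x + g x))\<^sup>2)"
  proof (rule Bochner_Integration.integrable_bound)
    show "integrable lborel (\<lambda>x. 2 * (norm (f x))\<^sup>2 + 2 * (norm (g x))\<^sup>2)"
      using assms by (auto simp: square_integrable_def)
    show "(\<lambda>x. (norm (f x + g x))\<^sup>2) \<in> borel_measurable lborel" by measurable
    show "AE x in lborel. norm ((norm (f x + g x))\<^sup>2)
        \<le> norm (2 * (norm (f x))\<^sup>2 + 2 * (norm (g x))\<^sup>2)"
      using * by (intro AE_I2) (simp add: abs_of_nonneg)
  qed
  then show ?thesis by (simp add: square_integrable_def)
qed

lemma square_integrable_mult: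
  assumes "square_integrable f"
  shows "square_integrable (\<lambda>x. c * f x)"
  using assms by (auto simp: square_integrable_def norm_mult power_mult_distrib)

lemma borel_measurable_cnj [measurable]: "cnj \<in> borel_measurable borel"
  by (intro borel_measurable_continuous_onI continuous_intros)

lemma square_integrable_cnj_mult:
  assumes "square_integrable f" "square_integrable g"
  shows "integrable lborel (\<lambda>x. cnj (f x) * g x)"
proof (rule Bochner_Integration.integrable_bound)
  have [measurable]: "f \<in> borel_measurable lborel" "g \<in> borel_measurable lborel"
    using assms by (auto simp: square_integrable_def)
  show "integrable lborel (\<lambda>x. (norm (f x))\<^sup>2 + (norm (g x))\<^sup>2)"
    using assms by (auto simp: square_integrable_def)
  show "(\<lambda>x. cnj (f x) * g x) \<in> borel_measurable lborel"
    by measurable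
  have "norm (cnj a * b) \<le> (norm a)\<^sup>2 + (norm b)\<^sup>2" for a b :: complex
    using sum_squares_bound[of "norm a" "norm b"] mult_nonneg_nonneg[of "norm a" "norm b"]
    by (simp add: norm_mult del: mult_nonneg_nonneg zero_le_mult_iff)
  then show "AE x in lborel. norm (cnj (f x) * g x) \<le> norm ((norm (f x))\<^sup>2 + (norm (g x))\<^sup>2)"
    by (simp add: abs_of_nonneg)
qed

quotient_type (overloaded) 'a L2 = "'a::euclidean_space \<Rightarrow> complex" / partial: L2_rel
proof (rule part_equivpI)
  show "\<exists>f::'a \<Rightarrow> complex. L2_rel f f"
    using square_integrable_zero by (auto simp: L2_rel_def)
  show "symp (L2_rel :: ('a \<Rightarrow> complex) \<Rightarrow> _)"
    by (auto simp: symp_def L2_rel_def)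
  show "transp (L2_rel :: ('a \<Rightarrow> complex) \<Rightarrow> _)"
    by (auto simp: transp_def L2_rel_def)
qed

lift_definition scaleC :: "complex \<Rightarrow> 'a::euclidean_space L2 \<Rightarrow> 'a L2"
  is "\<lambda>c f x. c * f x"
  by (auto simp: L2_rel_def square_integrable_mult)

lift_definition cinner :: "'a::euclidean_space L2 \<Rightarrow> 'a L2 \<Rightarrow> complex"
  is "\<lambda>f g. LINT x|lborel. cnj (f x) * g x"
proof -
  fix f f' g g' :: "'a \<Rightarrow> complex"
  assume "L2_rel f f'" "L2_rel g g'"
  then have [measurable]: "f \<in> borel_measurable lborel" "f' \<in> borel_measurable lborel"
      "g \<in> borel_measurable lborel" "g' \<in> borel_measurable lborel"
    and ae: "AE x in lborel. f x = f' x" "AE x in lborel. g x = g' x"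
    by (auto simp: L2_rel_def square_integrable_def)
  show "(LINT x|lborel. cnj (f x) * g x) = (LINT x|lborel. cnj (f' x) * g' x)"
  proof (rule integral_cong_AE)
    show "(\<lambda>x. cnj (f x) * g x) \<in> borel_measurable lborel"
      "(\<lambda>x. cnj (f' x) * g' x) \<in> borel_measurable lborel" by measurable
    show "AE x in lborel. cnj (f x) * g x = cnj (f' x) * g' x"
      using ae by eventually_elim simp
  qed
qed

instantiation L2 :: (euclidean_space) real_inner
begin

lift_definition zero_L2 :: "'a L2" is "\<lambda>_. 0"
  by (simp add: L2_rel_def square_integrable_zero)

lift_definition plus_L2 :: "'a L2 \<Rightarrow> 'a L2 \<Rightarrow> 'a L2" is "\<lambda>f g x. f x + g x"
  by (auto simp: L2_rel_def square_integrable_add elim: eventually_elim2)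

definition uminus_L2 :: "'a L2 \<Rightarrow> 'a L2" where
  "- \<phi> = scaleC (- 1) \<phi>"

definition minus_L2 :: "'a L2 \<Rightarrow> 'a L2 \<Rightarrow> 'a L2" where
  "\<phi> - \<psi> = \<phi> + (- \<psi> :: 'a L2)"

definition scaleR_L2 :: "real \<Rightarrow> 'a L2 \<Rightarrow> 'a L2" where
  "scaleR r \<phi> = scaleC (complex_of_real r) \<phi>"

definition inner_L2 :: "'a L2 \<Rightarrow> 'a L2 \<Rightarrow> real" where
  "inner \<phi> \<psi> = Re (cinner \<phi> \<psi>)"

definition norm_L2 :: "'a L2 \<Rightarrow> real" where
  "norm \<phi> = sqrt (inner \<phi> \<phi>)" for \<phi> :: "'a L2"

definition sgn_L2 :: "'a L2 \<Rightarrow> 'a L2" where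
  "sgn \<phi> = inverse (norm \<phi>) *\<^sub>R \<phi>" for \<phi> :: "'a L2"

definition dist_L2 :: "'a L2 \<Rightarrow> 'a L2 \<Rightarrow> real" where
  "dist \<phi> \<psi> = norm (\<phi> - \<psi>)" for \<phi> \<psi> :: "'a L2"

definition uniformity_L2 :: "('a L2 \<times> 'a L2) filter" where
  "uniformity_L2 = (INF e\<in>{0<..}. principal {(x, y). dist x y < e})"

definition open_L2 :: "'a L2 set \<Rightarrow> bool" where
  "open_L2 U = (\<forall>x\<in>U. eventually (\<lambda>(x', y). x' = x \<longrightarrow> y \<in> U) uniformity)"

instance
proof
  fix \<phi> \<psi> \<theta> :: "'a L2" and r s :: real
  show "dist \<phi> \<psi> = norm (\<phi> - \<psi>)" by (fact dist_L2_def)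
  show "sgn \<phi> = inverse (norm \<phi>) *\<^sub>R \<phi>" by (fact sgn_L2_def)
  show "norm \<phi> = sqrt (inner \<phi> \<phi>)" by (fact norm_L2_def)
  show "uniformity = (INF e\<in>{0<..}. principal {(x :: 'a L2, y). dist x y < e})"
    by (fact uniformity_L2_def)
  show "open U = (\<forall>x\<in>U. \<forall>\<^sub>F (x', y) in uniformity. x' = x \<longrightarrow> y \<in> U)" for U :: "'a L2 set"
    by (fact open_L2_def)
  show "\<phi> + \<psi> + \<theta> = \<phi> + (\<psi> + \<theta>)"
    by transfer (auto simp: L2_rel_def square_integrable_add add.assoc)
  show "\<phi> + \<psi> = \<psi> + \<phi>"
    by transfer (auto simp: L2_rel_def square_integrable_add add.commute)
  show "0 + \<phi> = \<phi>"
    by transfer (auto simp: L2_rel_def)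
  show "- \<phi> + \<phi> = 0"
    unfolding uminus_L2_def
    by transfer (auto simp: L2_rel_def square_integrable_zero)
  show "\<phi> - \<psi> = \<phi> + - \<psi>" by (fact minus_L2_def)
  show "r *\<^sub>R (\<phi> + \<psi>) = r *\<^sub>R \<phi> + r *\<^sub>R \<psi>"
    unfolding scaleR_L2_def
    by transfer (auto simp: L2_rel_def distrib_left
        intro!: square_integrable_add square_integrable_mult)
  show "(r + s) *\<^sub>R \<phi> = r *\<^sub>R \<phi> + s *\<^sub>R \<phi>"
    unfolding scaleR_L2_def
    by transfer (auto simp: L2_rel_def distrib_right
        intro!: square_integrable_add square_integrable_mult)
  show "r *\<^sub>R s *\<^sub>R \<phi> = (r * s) *\<^sub>R \<phi>"
    unfolding scaleR_L2_def
    by transfer (auto simp: L2_rel_def mult.assoc intro!: square_integrable_mult)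
  show "1 *\<^sub>R \<phi> = \<phi>"
    unfolding scaleR_L2_def by transfer (auto simp: L2_rel_def)
  show "inner \<phi> \<psi> = inner \<psi> \<phi>"
  proof -
    have "cinner \<phi> \<psi> = cnj (cinner \<psi> \<phi>)"
      by transfer (simp add: mult.commute flip: Bochner_Integration.integral_cnj)
    then show ?thesis by (simp add: inner_L2_def)
  qed
  show "inner (\<phi> + \<psi>) \<theta> = inner \<phi> \<theta> + inner \<psi> \<theta>"
  proof -
    have "cinner (\<phi> + \<psi>) \<theta> = cinner \<phi> \<theta> + cinner \<psi> \<theta>"
      by transfer
        (simp add: L2_rel_def distrib_right Bochner_Integration.integral_add
          square_integrable_cnj_mult)
    then show ?thesis by (simp add: inner_L2_def)
  qed
  show "inner (r *\<^sub>R \<phi>) \<psi> = r * inner \<phi> \<psi>"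
  proof -
    have "cinner (scaleC (complex_of_real r) \<phi>) \<psi> = complex_of_real r * cinner \<phi> \<psi>"
      by transfer (simp add: mult.assoc)
    then show ?thesis by (simp add: inner_L2_def scaleR_L2_def)
  qed
  have self: "inner \<phi> \<phi> = (LINT x|lborel. (norm (rep_L2 \<phi> x))\<^sup>2)"
  proof -
    have "cinner \<phi> \<phi> = (LINT x|lborel. cnj (rep_L2 \<phi> x) * rep_L2 \<phi> x)"
      by (simp add: cinner.rep_eq)
    also have "\<dots> = (LINT x|lborel. complex_of_real ((norm (rep_L2 \<phi> x))\<^sup>2))"
      by (rule Bochner_Integration.integral_cong)
        (auto simp: complex_norm_square mult.commute simp del: of_real_power)
    finally show ?thesis by (simp add: inner_L2_def del: of_real_power)
  qed
  show "0 \<le> inner \<phi> \<phi>"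
    unfolding self by (rule Bochner_Integration.integral_nonneg) simp
  have rep: "L2_rel (rep_L2 \<phi>) (rep_L2 \<phi>)"
    using Quotient_rep_reflp[OF Quotient_L2] .
  show "(inner \<phi> \<phi> = 0) = (\<phi> = 0)"
  proof -
    have "inner \<phi> \<phi> = 0 \<longleftrightarrow> (AE x in lborel. (norm (rep_L2 \<phi> x))\<^sup>2 = 0)"
      unfolding self using rep
      by (intro integral_nonneg_eq_0_iff_AE) (auto simp: L2_rel_def square_integrable_def)
    also have "\<dots> \<longleftrightarrow> L2_rel (rep_L2 \<phi>) (\<lambda>_. 0)"
      using rep by (auto simp: L2_rel_def square_integrable_zero)
    also have "\<dots> \<longleftrightarrow> \<phi> = 0"
    proof -
      have "L2_rel (\<lambda>_. 0) (\<lambda>_::'a. 0)"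
        by (simp add: L2_rel_def square_integrable_zero)
      with rep have "L2_rel (rep_L2 \<phi>) (\<lambda>_. 0) \<longleftrightarrow> abs_L2 (rep_L2 \<phi>) = abs_L2 (\<lambda>_. 0)"
        using Quotient_rel[OF Quotient_L2] by blast
      then show ?thesis
        by (simp add: Quotient_abs_rep[OF Quotient_L2] zero_L2_def)
    qed
    finally show ?thesis .
  qed
qed

end

section \<open>The Weyl system\<close>

definition unitary :: "('a::euclidean_space L2 \<Rightarrow> 'a L2) \<Rightarrow> bool" where
  "unitary V \<longleftrightarrow>
     (\<forall>\<phi> \<psi>. V (\<phi> + \<psi>) = V \<phi> + V \<psi>) \<and> (\<forall>c \<phi>. V (scaleC c \<phi>) = scaleC c (V \<phi>)) \<and>
     surj V \<and> (\<forall>\<phi> \<psi>. cinner (V \<phi>) (V \<psi>) = cinner \<phi> \<psi>)"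

definition unitary_group :: "(real \<Rightarrow> 'a::euclidean_space L2 \<Rightarrow> 'a L2) \<Rightarrow> bool" where
  "unitary_group U \<longleftrightarrow>
     (\<forall>t. unitary (U t)) \<and> U 0 = id \<and> (\<forall>s t. U (s + t) = U s \<circ> U t) \<and>
     (\<forall>\<phi>. continuous_on UNIV (\<lambda>t. U t \<phi>))"

text \<open>The unitary exp(-iA) of an essentially self-adjoint operator A with core the Schwartz
  space, in the sense of Stone's theorem: the value at time 1 of the strongly continuous unitary
  group whose infinitesimal generator extends -iA.  Essential self-adjointness makes this
  group unique.\<close>

definition exp_minus_i ::
    "(('a::euclidean_space \<Rightarrow> complex) \<Rightarrow> 'a \<Rightarrow> complex) \<Rightarrow> 'a L2 \<Rightarrow> 'a L2" where
  "exp_minus_i A = (THE V. \<exists>U. unitary_group U \<and>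
     (\<forall>\<psi>. schwartz \<psi> \<longrightarrow>
        ((\<lambda>t. U t (abs_L2 \<psi>)) has_vector_derivative scaleC (- \<i>) (abs_L2 (A \<psi>))) (at 0)) \<and>
     V = U 1)"

type_synonym 'd phase_space = "(real^'d) \<times> (real^'d)"

definition symp_form :: "'d::finite phase_space \<Rightarrow> 'd phase_space \<Rightarrow> real" where
  "symp_form X Y = snd X \<bullet> fst Y - fst X \<bullet> snd Y"

definition Q_op :: "'d::finite \<Rightarrow> (real^'d \<Rightarrow> complex) \<Rightarrow> real^'d \<Rightarrow> complex" where
  "Q_op j \<psi> = (\<lambda>y. complex_of_real (y $ j) * \<psi> y)"

definition P_op :: "real \<Rightarrow> 'd::finite \<Rightarrow> (real^'d \<Rightarrow> complex) \<Rightarrow> real^'d \<Rightarrow> complex" where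
  "P_op eps j \<psi> = (\<lambda>y. - \<i> * complex_of_real eps * frechet_derivative \<psi> (at y) (axis j 1))"

definition weyl_system :: "real \<Rightarrow> 'd::finite phase_space \<Rightarrow> (real^'d) L2 \<Rightarrow> (real^'d) L2" where
  "weyl_system eps X = exp_minus_i (\<lambda>\<psi> y. \<Sum>j\<in>UNIV.
     complex_of_real (snd X $ j) * Q_op j \<psi> y - complex_of_real (fst X $ j) * P_op eps j \<psi> y)"

section \<open>Weyl quantization\<close>

definition symp_fourier ::
    "('d::finite phase_space \<Rightarrow> complex) \<Rightarrow> 'd phase_space \<Rightarrow> complex" where
  "symp_fourier f X = complex_of_real (1 / (2 * pi) ^ CARD('d)) *
     (LINT Y|lborel. exp (\<i> * complex_of_real (symp_form X Y)) * f Y)"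

text \<open>The operator-valued integral defining the Weyl quantization is understood weakly.\<close>

definition weyl_op ::
    "real \<Rightarrow> ('d::finite phase_space \<Rightarrow> complex) \<Rightarrow> (real^'d) L2 \<Rightarrow>\<^sub>L (real^'d) L2" where
  "weyl_op eps f = (THE A. \<forall>\<phi> \<psi>. cinner \<phi> (blinfun_apply A \<psi>) =
     complex_of_real (1 / (2 * pi) ^ CARD('d)) *
       (LINT X|lborel. symp_fourier f X * cinner \<phi> (weyl_system eps X \<psi>)))"

text \<open>By duality, (F T)(h) = T(h') with h'(Y) = (F h)(-Y), where F is the symplectic Fourier
  transform; the reflection comes from the antisymmetry of \<^const>\<open>symp_form\<close>.\<close>

definition symp_fourier_dist ::
    "(('d::finite phase_space \<Rightarrow> complex) \<Rightarrow> complex) \<Rightarrow> ('d phase_space \<Rightarrow> complex) \<Rightarrow> complex"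
  where
  "symp_fourier_dist T h = T (\<lambda>Y. symp_fourier h (- Y))"

text \<open>The Weyl quantization of a tempered distribution maps the Schwartz space into its
  (anti)dual: it is the sesquilinear form on Schwartz functions obtained by pairing the symplectic
  Fourier transform of T with the matrix elements of the Weyl system.\<close>

definition weyl_form ::
    "real \<Rightarrow> (('d::finite phase_space \<Rightarrow> complex) \<Rightarrow> complex) \<Rightarrow>
     (real^'d \<Rightarrow> complex) \<Rightarrow> (real^'d \<Rightarrow> complex) \<Rightarrow> complex" where
  "weyl_form eps T \<phi> \<psi> = complex_of_real (1 / (2 * pi) ^ CARD('d)) *
     symp_fourier_dist T (\<lambda>X. cinner (abs_L2 \<phi>) (weyl_system eps X (abs_L2 \<psi>)))"

definition is_moyal_product ::
    "real \<Rightarrow> ('d::finite phase_space \<Rightarrow> complex) \<Rightarrow> ('d phase_space \<Rightarrow> complex) \<Rightarrow>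
     (('d phase_space \<Rightarrow> complex) \<Rightarrow> complex) \<Rightarrow> bool" where
  "is_moyal_product eps f g T \<longleftrightarrow> tempered_distribution T \<and>
     (\<forall>\<phi> \<psi>. schwartz \<phi> \<longrightarrow> schwartz \<psi> \<longrightarrow>
        weyl_form eps T \<phi> \<psi> =
        cinner (abs_L2 \<phi>) (blinfun_apply (weyl_op eps f o\<^sub>L weyl_op eps g) (abs_L2 \<psi>)))"

end

theory Submission
  imports Defs "HOL-Probability.Characteristic_Functions" "HOL-Probability.Sinc_Integral"
begin

text \<open>The group with generator \<open>-i(\<xi>.Q - x.P)\<close> is
  \<open>(W(X) \<psi>)(y) = exp(-i(\<xi>.y + \<epsilon>/2 \<xi>.x)) \<psi>(y + \<epsilon> x)\<close>; the Schwartz functions are dense and invariant,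
  which makes it the Weyl system.  From \<open>W(Y) W(Z) = exp(i\<epsilon>/2 \<sigma>(Y,Z)) W(Y + Z)\<close> the product
  of two quantizations is the integrated form of the twisted convolution \<open>H\<close> of the symplectic Fourier
  transforms, \<open>H\<close> is a partial integral of a Schwartz kernel, and \<open>f \<star> g\<close> is its
  symplectic Fourier transform; the second formula follows from the first by Fourier inversion in \<open>Z\<close>.

  For the uniqueness of the symbol, the matrix elements of \<open>W\<close> between translates of a Gaussian
  transform into all translated and modulated Gaussians on phase space, so the difference of two symbols
  annihilates these.  Every Schwartz function is a superposition of such Gaussians that converges in the
  Schwartz topology.\<close>

subsection \<open>Calculus of smooth functions with growth conditions\<close>

text \<open>Both \<open>exp_minus_i\<close> and \<open>weyl_op\<close> are definite descriptions, so
  nothing can be computed before existence and uniqueness are known. For the Weyl system this is the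
  argument that an invariant dense domain is a core: a competing group V has a known derivative only
  on Schwartz vectors, so V(-t)U(t) can be differentiated only if U keeps such vectors Schwartz. For
  the quantization the vector is written down as a pointwise integral, and a weighted Cauchy-Schwarz
  inequality puts it into \<open>L2\<close>.

  A tempered distribution carries no information outside the Schwartz functions, so
  \<open>weyl_form\<close> can be exploited for an unknown T only where the transformed matrix
  element is visibly Schwartz. With Gaussian states that transform is explicit; the width of
  \<open>ground_state\<close> balances position against momentum, so that the result is an isotropic
  Gaussian on phase space.

  Since \<open>schwartz\<close> speaks of lists of partial derivatives, closure properties are
  proved by exhibiting a family of functions that differentiation does not leave, rather than by
  formulas for derivatives of general order.\<close>

lemma frechet_derivative_eqI:
  "(f has_derivative f') (at x) \<Longrightarrow> frechet_derivative f (at x) b = f' b"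
  using frechet_derivative_at by metis

lemma has_frechet_derivative:
  "f differentiable (at x) \<Longrightarrow> (f has_derivative frechet_derivative f (at x)) (at x)"
  using frechet_derivative_works by blast

lemma frechet_derivative_Basis_sum:
  fixes f :: "'a::euclidean_space \<Rightarrow> complex"
  assumes "f differentiable (at x)"
  shows "frechet_derivative f (at x) v = (\<Sum>b\<in>Basis. of_real (v \<bullet> b) * frechet_derivative f (at x) b)"
proof -
  interpret bounded_linear "frechet_derivative f (at x)"
    using has_derivative_bounded_linear[OF has_frechet_derivative[OF assms]] .
  have "frechet_derivative f (at x) v = frechet_derivative f (at x) (\<Sum>b\<in>Basis. (v \<bullet> b) *\<^sub>R b)"
    by (simp add: euclidean_representation)
  then show ?thesis
    by (simp add: sum scaleR scaleR_conv_of_real)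
qed

lemma iter_partial_append: "iter_partial (as @ bs) f = iter_partial as (iter_partial bs f)"
  by (induction as) auto

text \<open>The growth condition on derivatives is a parameter, so that one calculus serves rapid
  decay, polynomial growth and decay in a single factor of a product space.\<close>

definition smooth_class :: "(('a::euclidean_space \<Rightarrow> complex) \<Rightarrow> bool) \<Rightarrow> ('a \<Rightarrow> complex) \<Rightarrow> bool" where
  "smooth_class G f \<longleftrightarrow> (\<forall>bs. set bs \<subseteq> Basis \<longrightarrow>
     (\<forall>x. iter_partial bs f differentiable (at x)) \<and> G (iter_partial bs f))"

definition growth_space :: "(('a::euclidean_space \<Rightarrow> complex) \<Rightarrow> bool) \<Rightarrow> bool" where
  "growth_space G \<longleftrightarrow> G (\<lambda>_. 0) \<and> (\<forall>c f g. G f \<longrightarrow> G g \<longrightarrow> G (\<lambda>x. c * f x + g x))"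

definition rapid :: "('a::euclidean_space \<Rightarrow> complex) \<Rightarrow> bool" where
  "rapid f \<longleftrightarrow> (\<forall>k. \<exists>C. \<forall>x. (1 + norm x) ^ k * norm (f x) \<le> C)"

definition poly_bounded :: "('a::euclidean_space \<Rightarrow> complex) \<Rightarrow> bool" where
  "poly_bounded f \<longleftrightarrow> (\<exists>k C. \<forall>x. norm (f x) \<le> C * (1 + norm x) ^ k)"

text \<open>The multiplier space O_M of the Schwartz space.\<close>

abbreviation slow :: "('a::euclidean_space \<Rightarrow> complex) \<Rightarrow> bool" where
  "slow \<equiv> smooth_class poly_bounded"

lemma schwartz_iff: "schwartz f \<longleftrightarrow> smooth_class rapid f"
  unfolding schwartz_def smooth_def smooth_class_def rapid_def by blast

text \<open>A general weight \<open>u\<close> covers, besides the norm, the norm of one component of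
  a pair, which \<open>schwartz_tensor\<close> requires.\<close>

lemma growth_space_weighted:
  assumes u: "\<And>x. u x \<ge> 0"
  shows "growth_space (\<lambda>h. \<forall>k. \<exists>C. \<forall>x. (1 + u x) ^ k * norm (h x) \<le> C)"
  unfolding growth_space_def
proof (intro conjI allI impI)
  show "\<exists>C. \<forall>x. (1 + u x) ^ k * norm (0::complex) \<le> C" for k by auto
  fix c k and f g :: "'a \<Rightarrow> complex"
  assume f: "\<forall>k. \<exists>C. \<forall>x. (1 + u x) ^ k * norm (f x) \<le> C"
    and g: "\<forall>k. \<exists>C. \<forall>x. (1 + u x) ^ k * norm (g x) \<le> C"
  obtain C where C: "\<And>x. (1 + u x) ^ k * norm (f x) \<le> C" using f by metis
  obtain D where D: "\<And>x. (1 + u x) ^ k * norm (g x) \<le> D" using g by metis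
  have "(1 + u x) ^ k * norm (c * f x + g x) \<le> norm c * C + D" for x
  proof -
    have "(1 + u x) ^ k * norm (c * f x + g x)
        \<le> (1 + u x) ^ k * (norm c * norm (f x) + norm (g x))"
      using u by (intro mult_left_mono) (auto simp: norm_mult intro: norm_triangle_le)
    also have "\<dots> = norm c * ((1 + u x) ^ k * norm (f x)) + (1 + u x) ^ k * norm (g x)"
      by (simp add: algebra_simps)
    also have "\<dots> \<le> norm c * C + D"
      by (intro add_mono mult_left_mono C D) auto
    finally show ?thesis .
  qed
  then show "\<exists>C. \<forall>x. (1 + u x) ^ k * norm (c * f x + g x) \<le> C" by blast
qed

lemma growth_space_rapid: "growth_space rapid"
  unfolding rapid_def[abs_def] by (rule growth_space_weighted) simp

lemma poly_boundedD:
  assumes "poly_bounded f"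
  shows "\<exists>C k. C \<ge> 0 \<and> (\<forall>x. norm (f x) \<le> C * (1 + norm x) ^ k)"
proof -
  from assms obtain k C where C: "\<And>x. norm (f x) \<le> C * (1 + norm x) ^ k"
    by (auto simp: poly_bounded_def)
  moreover have "C \<ge> 0" using C[of 0] order_trans[OF norm_ge_zero] by fastforce
  ultimately show ?thesis by blast
qed

lemma poly_bounded_mult:
  assumes "poly_bounded f" "poly_bounded g"
  shows "poly_bounded (\<lambda>x. f x * g x)"
proof -
  obtain C k where C: "C \<ge> 0" "\<And>x. norm (f x) \<le> C * (1 + norm x) ^ k"
    using poly_boundedD[OF assms(1)] by blast
  obtain D l where D: "D \<ge> 0" "\<And>x. norm (g x) \<le> D * (1 + norm x) ^ l"
    using poly_boundedD[OF assms(2)] by blast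
  have "norm (f x * g x) \<le> (C * D) * (1 + norm x) ^ (k + l)" for x
    using mult_mono[OF C(2) D(2), of x x] C(1) by (simp add: norm_mult power_add mult_ac)
  then show ?thesis unfolding poly_bounded_def by blast
qed

lemma growth_space_poly_bounded: "growth_space poly_bounded"
proof -
  have "poly_bounded (\<lambda>x. c * f x + g x)" if pf: "poly_bounded f" and pg: "poly_bounded g"
    for c and f g :: "'a \<Rightarrow> complex"
  proof -
    obtain C k where C: "C \<ge> 0" "\<And>x. norm (f x) \<le> C * (1 + norm x) ^ k"
      using poly_boundedD[OF pf] by blast
    obtain D l where D: "D \<ge> 0" "\<And>x. norm (g x) \<le> D * (1 + norm x) ^ l"
      using poly_boundedD[OF pg] by blast
    have "norm (c * f x + g x) \<le> (norm c * C + D) * (1 + norm x) ^ (k + l)" for x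
    proof -
      have "norm (c * f x + g x) \<le> norm c * norm (f x) + norm (g x)"
        by (rule norm_triangle_le) (simp add: norm_mult)
      also have "\<dots> \<le> norm c * (C * (1 + norm x) ^ (k + l)) + D * (1 + norm x) ^ (k + l)"
        using C D
        by (intro add_mono mult_left_mono order_trans[OF C(2)] order_trans[OF D(2)] power_increasing) auto
      finally show ?thesis by (simp add: algebra_simps)
    qed
    then show ?thesis unfolding poly_bounded_def by blast
  qed
  moreover have "poly_bounded (\<lambda>_::'a. 0)"
    unfolding poly_bounded_def by (rule exI[of _ 0], rule exI[of _ 0]) simp
  ultimately show ?thesis by (auto simp: growth_space_def)
qed

section \<open>Coinductive proofs of smoothness\<close>

inductive lspan :: "(('a::euclidean_space \<Rightarrow> complex) \<Rightarrow> bool) \<Rightarrow> ('a \<Rightarrow> complex) \<Rightarrow> bool"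
  for C where
  zero: "lspan C (\<lambda>_. 0)"
| step: "C f \<Longrightarrow> lspan C g \<Longrightarrow> lspan C (\<lambda>x. c * f x + g x)"

lemma lspan_base: "C f \<Longrightarrow> lspan C f"
  using lspan.step[OF _ lspan.zero, of C f 1] by simp

lemma lspan_lincomb: "lspan C f \<Longrightarrow> lspan C g \<Longrightarrow> lspan C (\<lambda>x. c * f x + g x)"
proof (induction rule: lspan.induct)
  case zero
  then show ?case by simp
next
  case (step f h d)
  have "lspan C (\<lambda>x. (c * d) * f x + (c * h x + g x))"
    by (rule lspan.step[where f = f]) (use step in auto)
  then show ?case by (simp add: algebra_simps)
qed

lemma lspan_sum:
  "(\<And>i. i \<in> A \<Longrightarrow> C (f i)) \<Longrightarrow> lspan C (\<lambda>x. \<Sum>i\<in>A. c i * f i x)"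
  by (induction A rule: infinite_finite_induct) (auto intro: lspan.intros)

text \<open>Coinduction up to linear combinations: the derivative of a member of \<open>C\<close> need only be a linear
  combination of members, which accommodates the product and chain rules.\<close>

lemma smooth_class_coinduct:
  assumes G: "growth_space G"
    and diff: "\<And>f x. C f \<Longrightarrow> f differentiable (at x)"
    and deriv: "\<And>f b. C f \<Longrightarrow> b \<in> Basis \<Longrightarrow> lspan C (\<lambda>x. frechet_derivative f (at x) b)"
    and CG: "\<And>f. C f \<Longrightarrow> G f"
    and "lspan C f"
  shows "smooth_class G f"
proof -
  \<comment> \<open>Every required property passes from the generators to their span, and partial
    derivatives map the span into itself; the induction on \<open>bs\<close> then stays inside
    it.\<close>
  have 1: "(\<forall>x. g differentiable (at x)) \<and> G g \<and>
      (\<forall>b\<in>Basis. lspan C (\<lambda>x. frechet_derivative g (at x) b))" if "lspan C g" for g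
    using that
  proof (induction rule: lspan.induct)
    case zero
    have "frechet_derivative (\<lambda>_. 0) (at x) b = (0::complex)" for x b :: 'a
      by (rule frechet_derivative_eqI) (rule has_derivative_const)
    then show ?case using G by (auto simp: growth_space_def intro: lspan.zero)
  next
    case (step f g c)
    have D: "((\<lambda>x. c * f x + g x) has_derivative
        (\<lambda>v. c * frechet_derivative f (at x) v + frechet_derivative g (at x) v)) (at x)" for x
      using has_frechet_derivative[OF diff[OF step(1), of x]]
        has_frechet_derivative[of g x] step(3)
      by (auto intro!: derivative_eq_intros)
    have "frechet_derivative (\<lambda>x. c * f x + g x) (at x) b =
        c * frechet_derivative f (at x) b + frechet_derivative g (at x) b" for x b
      by (rule frechet_derivative_eqI) (rule D)
    moreover have "(\<lambda>x. c * f x + g x) differentiable (at x)" for x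
      using D differentiable_def by blast
    moreover have "G (\<lambda>x. c * f x + g x)"
      using G CG[OF step(1)] step(3) by (auto simp: growth_space_def)
    ultimately show ?case
      using deriv[OF step(1)] step(3) by (auto intro: lspan_lincomb)
  qed
  have "set bs \<subseteq> Basis \<Longrightarrow> lspan C (iter_partial bs f)" for bs
    by (induction bs) (use 1 \<open>lspan C f\<close> in auto)
  then show ?thesis unfolding smooth_class_def using 1 by blast
qed

lemma smooth_class_differentiable: "smooth_class G f \<Longrightarrow> f differentiable (at x)"
  unfolding smooth_class_def by (metis empty_subsetI iter_partial.simps(1) list.set(1))

lemma smooth_class_growth: "smooth_class G f \<Longrightarrow> G f"
  unfolding smooth_class_def by (metis empty_subsetI iter_partial.simps(1) list.set(1))

lemma smooth_class_partial:
  assumes "smooth_class G f" "b \<in> Basis"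
  shows "smooth_class G (\<lambda>x. frechet_derivative f (at x) b)"
  unfolding smooth_class_def
proof (intro allI impI)
  fix bs :: "'a list" assume "set bs \<subseteq> Basis"
  then have "set (bs @ [b]) \<subseteq> Basis" using assms(2) by auto
  then have "(\<forall>x. iter_partial (bs @ [b]) f differentiable (at x)) \<and> G (iter_partial (bs @ [b]) f)"
    using assms(1) unfolding smooth_class_def by blast
  then show "(\<forall>x. iter_partial bs (\<lambda>x. frechet_derivative f (at x) b) differentiable (at x)) \<and>
      G (iter_partial bs (\<lambda>x. frechet_derivative f (at x) b))"
    by (simp add: iter_partial_append)
qed

lemma smooth_class_iter_partial:
  "smooth_class G f \<Longrightarrow> set bs \<subseteq> Basis \<Longrightarrow> smooth_class G (iter_partial bs f)"
  by (induction bs) (auto intro: smooth_class_partial)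

lemma smooth_class_lspan:
  assumes "growth_space G" "lspan (smooth_class G) f"
  shows "smooth_class G f"
proof (rule smooth_class_coinduct[OF assms(1) _ _ _ assms(2)])
  fix f assume f: "smooth_class G f"
  show "f differentiable (at x)" for x by (rule smooth_class_differentiable[OF f])
  show "G f" by (rule smooth_class_growth[OF f])
  show "lspan (smooth_class G) (\<lambda>x. frechet_derivative f (at x) b)" if "b \<in> Basis" for b
    by (rule lspan_base) (rule smooth_class_partial[OF f that])
qed

lemma smooth_class_lincomb:
  "growth_space G \<Longrightarrow> smooth_class G f \<Longrightarrow> smooth_class G g \<Longrightarrow> smooth_class G (\<lambda>x. c * f x + g x)"
  by (rule smooth_class_lspan, assumption, rule lspan_lincomb) (rule lspan_base, assumption)+

text \<open>By the Leibniz rule a derivative of a product is a sum of two products, so the family of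
  all products has its derivatives in its own span. Separate conditions \<open>G1\<close> and
  \<open>G2\<close> allow a multiplier times a Schwartz function.\<close>

lemma smooth_class_mult:
  assumes G: "growth_space G" and f: "smooth_class G1 f" and g: "smooth_class G2 g"
    and mult: "\<And>f g. G1 f \<Longrightarrow> G2 g \<Longrightarrow> G (\<lambda>x. f x * g x)"
  shows "smooth_class G (\<lambda>x. f x * g x)"
proof (rule smooth_class_coinduct[OF G])
  let ?C = "\<lambda>h. \<exists>f g. smooth_class G1 f \<and> smooth_class G2 g \<and> h = (\<lambda>x. f x * g x)"
  show "lspan ?C (\<lambda>x. f x * g x)"
    by (rule lspan_base, rule exI[of _ f], rule exI[of _ g]) (use f g in simp)
  fix h assume "?C h"
  then obtain f g where fg: "smooth_class G1 f" "smooth_class G2 g" and h: "h = (\<lambda>x. f x * g x)"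
    by blast
  have D: "(h has_derivative (\<lambda>v. f x * frechet_derivative g (at x) v + frechet_derivative f (at x) v * g x)) (at x)" for x
    unfolding h
    by (intro has_derivative_mult has_frechet_derivative smooth_class_differentiable[OF fg(1)]
        smooth_class_differentiable[OF fg(2)])
  show "h differentiable (at x)" for x using D differentiable_def by blast
  show "G h" unfolding h by (intro mult smooth_class_growth[OF fg(1)] smooth_class_growth[OF fg(2)])
  fix b :: 'a assume b: "b \<in> Basis"
  have "lspan ?C (\<lambda>x. 1 * (f x * frechet_derivative g (at x) b) + frechet_derivative f (at x) b * g x)"
  proof (intro lspan_lincomb lspan_base)
    show "?C (\<lambda>x. f x * frechet_derivative g (at x) b)"
      by (rule exI[of _ f], rule exI) (use fg smooth_class_partial[OF fg(2) b] in simp)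
    show "?C (\<lambda>x. frechet_derivative f (at x) b * g x)"
      by (rule exI, rule exI[of _ g]) (use fg smooth_class_partial[OF fg(1) b] in simp)
  qed
  then show "lspan ?C (\<lambda>x. frechet_derivative h (at x) b)"
    by (simp add: frechet_derivative_eqI[OF D])
qed

text \<open>The chain rule expresses a partial derivative of the composition through the partials of
  \<open>f\<close> at the image point, with coefficients \<open>L b \<bullet> b'\<close>; these are
  constant, which keeps the derivative in the linear span.\<close>

lemma smooth_class_affine:
  fixes L :: "'a::euclidean_space \<Rightarrow> 'b::euclidean_space"
  assumes G: "growth_space G" and f: "smooth_class G1 f" and L: "bounded_linear L"
    and comp: "\<And>f. G1 f \<Longrightarrow> G (\<lambda>x. f (L x + a))"
  shows "smooth_class G (\<lambda>x. f (L x + a))"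
proof (rule smooth_class_coinduct[OF G])
  let ?C = "\<lambda>h. \<exists>f. smooth_class G1 f \<and> h = (\<lambda>x. f (L x + a))"
  show "lspan ?C (\<lambda>x. f (L x + a))"
    by (rule lspan_base) (use f in blast)
  fix h assume "?C h"
  then obtain f where f: "smooth_class G1 f" and h: "h = (\<lambda>x. f (L x + a))"
    by blast
  have L': "((\<lambda>x. L x + a) has_derivative L) (at x)" for x
    using bounded_linear_imp_has_derivative[OF L] by (auto intro!: derivative_eq_intros)
  have D: "(h has_derivative (\<lambda>v. frechet_derivative f (at (L x + a)) (L v))) (at x)" for x
    unfolding h
    by (rule has_derivative_compose[OF L' has_frechet_derivative[OF smooth_class_differentiable[OF f]]])
  show "h differentiable (at x)" for x using D differentiable_def by blast
  show "G h" unfolding h by (intro comp smooth_class_growth[OF f])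
  fix b :: 'a assume b: "b \<in> Basis"
  have "frechet_derivative h (at x) b =
      (\<Sum>b'\<in>Basis. of_real (L b \<bullet> b') * frechet_derivative f (at (L x + a)) b')" for x
    unfolding frechet_derivative_eqI[OF D]
    by (rule frechet_derivative_Basis_sum[OF smooth_class_differentiable[OF f]])
  moreover have "lspan ?C (\<lambda>x. \<Sum>b'\<in>Basis. of_real (L b \<bullet> b') * frechet_derivative f (at (L x + a)) b')"
  proof (rule lspan_sum)
    fix b' :: 'b assume "b' \<in> Basis"
    then show "?C (\<lambda>x. frechet_derivative f (at (L x + a)) b')"
      by (intro exI[of _ "\<lambda>x. frechet_derivative f (at x) b'"]) (use smooth_class_partial[OF f] in auto)
  qed
  ultimately show "lspan ?C (\<lambda>x. frechet_derivative h (at x) b)" by simp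
qed

section \<open>Smooth functions of polynomial growth\<close>

lemma slow_lincomb: "slow f \<Longrightarrow> slow g \<Longrightarrow> slow (\<lambda>x. c * f x + g x)"
  by (intro smooth_class_lincomb growth_space_poly_bounded)

lemma slow_mult: "slow f \<Longrightarrow> slow g \<Longrightarrow> slow (\<lambda>x. f x * g x)"
  by (intro smooth_class_mult[where ?G1.0 = poly_bounded and ?G2.0 = poly_bounded]
      growth_space_poly_bounded poly_bounded_mult)

text \<open>Differentiating a linear map gives a constant and differentiating a constant gives zero,
  so the two kinds together form the closed family for the coinduction.\<close>

lemma slow_linear_or_const:
  assumes "bounded_linear (l :: 'a::euclidean_space \<Rightarrow> complex) \<or> (\<exists>c. l = (\<lambda>_. c))"
  shows "slow l"
proof -
  have pc: "poly_bounded (\<lambda>_::'a. c)" for c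
    unfolding poly_bounded_def by (rule exI[of _ 0], rule exI[of _ "norm c"]) simp
  let ?C = "\<lambda>h :: 'a \<Rightarrow> complex. bounded_linear h \<or> (\<exists>c. h = (\<lambda>_. c))"
  have *: "slow h" if "lspan ?C h" for h
  proof (rule smooth_class_coinduct[OF growth_space_poly_bounded _ _ _ that])
    fix f assume f: "?C f"
    show "f differentiable (at x)" for x
      using f by (auto simp: bounded_linear_imp_differentiable)
    show "poly_bounded f"
      using f
    proof
      assume "bounded_linear f"
      then obtain K where K: "K > 0" "\<And>x. norm (f x) \<le> norm x * K"
        using bounded_linear.pos_bounded by blast
      have "norm (f x) \<le> K * (1 + norm x) ^ 1" for x
        using K(1) by (intro order_trans[OF K(2)]) (simp add: algebra_simps)
      then show ?thesis unfolding poly_bounded_def by blast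
    qed (use pc in auto)
    fix b :: 'a
    have "\<exists>c. (\<lambda>x. frechet_derivative f (at x) b) = (\<lambda>_. c)"
      using f
    proof
      assume "bounded_linear f"
      then have "frechet_derivative f (at x) b = f b" for x
        by (intro frechet_derivative_eqI bounded_linear_imp_has_derivative)
      then show ?thesis by auto
    next
      assume "\<exists>c. f = (\<lambda>_. c)"
      then have "frechet_derivative f (at x) b = 0" for x
        by (intro frechet_derivative_eqI) auto
      then show ?thesis by auto
    qed
    then show "lspan ?C (\<lambda>x. frechet_derivative f (at x) b)"
      by (intro lspan_base) blast
  qed
  show "slow l" by (rule *, rule lspan_base, rule assms)
qed

lemma slow_linear: "bounded_linear l \<Longrightarrow> slow l"
  and slow_const: "slow (\<lambda>_. c)"
  by (auto intro: slow_linear_or_const)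

lemma slow_sum: "(\<And>i. i \<in> A \<Longrightarrow> slow (f i)) \<Longrightarrow> slow (\<lambda>x. \<Sum>i\<in>A. f i x)"
proof (induction A rule: infinite_finite_induct)
  case (insert i A)
  then show ?case using slow_lincomb[of "f i" "\<lambda>x. \<Sum>i\<in>A. f i x" 1] by simp
qed (auto intro: slow_const)

lemma slow_power: "slow f \<Longrightarrow> slow (\<lambda>x. f x ^ n)"
  by (induction n) (auto intro: slow_const slow_mult)

lemma slow_inner: "bounded_linear L \<Longrightarrow> slow (\<lambda>x. of_real (L x \<bullet> v))"
  by (intro slow_linear bounded_linear_compose[OF bounded_linear_of_real]
      bounded_linear_compose[OF bounded_linear_inner_left])

lemma slow_inner2:
  fixes L M :: "'a::euclidean_space \<Rightarrow> 'b::euclidean_space"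
  assumes "bounded_linear L" "bounded_linear M"
  shows "slow (\<lambda>x. of_real (L x \<bullet> M x))"
proof -
  have "slow (\<lambda>x. \<Sum>b\<in>Basis. of_real (L x \<bullet> b) * of_real (M x \<bullet> b))"
    by (intro slow_sum slow_mult slow_inner assms)
  moreover have "(\<Sum>b\<in>Basis. of_real (L x \<bullet> b) * of_real (M x \<bullet> b)) = (of_real (L x \<bullet> M x) :: complex)" for x
    by (subst (3) euclidean_inner) simp
  ultimately show ?thesis by simp
qed

text \<open>The exponential is kept fixed and all derivatives go into the prefactor: (m exp q)' =
  (m' + m q') exp q. How the product grows is left to \<open>grow\<close>, since
  \<open>slow_exp\<close> and \<open>schwartz_exp\<close> answer this differently.\<close>

lemma slow_times_exp:
  assumes G: "growth_space G" and q: "slow q" and m: "slow m"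
    and grow: "\<And>m. poly_bounded m \<Longrightarrow> G (\<lambda>x. m x * exp (q x))"
  shows "smooth_class G (\<lambda>x. m x * exp (q x))"
proof (rule smooth_class_coinduct[OF G])
  let ?C = "\<lambda>h. \<exists>m. slow m \<and> h = (\<lambda>x. m x * exp (q x))"
  show "lspan ?C (\<lambda>x. m x * exp (q x))"
    by (rule lspan_base) (use m in blast)
  fix h assume "?C h"
  then obtain m where m: "slow m" and h: "h = (\<lambda>x. m x * exp (q x))"
    by blast
  have D: "(h has_derivative (\<lambda>v. (frechet_derivative m (at x) v + m x * frechet_derivative q (at x) v) * exp (q x))) (at x)" for x
  proof -
    note [derivative_intros] = has_frechet_derivative[OF smooth_class_differentiable[OF m]]
      has_frechet_derivative[OF smooth_class_differentiable[OF q]]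
    have "((\<lambda>x. exp (q x)) has_derivative (\<lambda>v. frechet_derivative q (at x) v * exp (q x))) (at x)"
      using has_derivative_compose[OF has_frechet_derivative[OF smooth_class_differentiable[OF q, of x]]
          DERIV_exp[of "q x", unfolded has_field_derivative_def]]
      by (simp add: mult.commute)
    then show ?thesis
      unfolding h by (auto intro!: derivative_eq_intros simp: algebra_simps)
  qed
  show "h differentiable (at x)" for x using D differentiable_def by blast
  show "G h" unfolding h by (intro grow smooth_class_growth[OF m])
  fix b :: 'a assume b: "b \<in> Basis"
  have "slow (\<lambda>x. 1 * frechet_derivative m (at x) b + m x * frechet_derivative q (at x) b)"
    by (intro slow_lincomb slow_mult smooth_class_partial m q b)
  then show "lspan ?C (\<lambda>x. frechet_derivative h (at x) b)"
    by (intro lspan_base exI[of _ "\<lambda>x. frechet_derivative m (at x) b + m x * frechet_derivative q (at x) b"])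
      (simp add: frechet_derivative_eqI[OF D])
qed

lemma slow_exp:
  assumes "slow q" "\<And>x. Re (q x) \<le> 0"
  shows "slow (\<lambda>x. exp (q x))"
proof -
  have "poly_bounded (\<lambda>x. m x * exp (q x))" if pm: "poly_bounded m" for m
  proof -
    obtain C k where C: "C \<ge> 0" "\<And>x. norm (m x) \<le> C * (1 + norm x) ^ k"
      using poly_boundedD[OF pm] by blast
    have "norm (m x * exp (q x)) \<le> C * (1 + norm x) ^ k" for x
    proof -
      have "norm (m x * exp (q x)) \<le> norm (m x) * 1"
        unfolding norm_mult using assms(2) by (intro mult_left_mono) auto
      then show ?thesis using C(2)[of x] by simp
    qed
    then show ?thesis unfolding poly_bounded_def by blast
  qed
  then have "slow (\<lambda>x. 1 * exp (q x))"
    by (intro slow_times_exp growth_space_poly_bounded slow_const assms)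
  then show ?thesis by simp
qed

lemma slow_iexp: "slow (\<lambda>x. of_real (q x)) \<Longrightarrow> slow (\<lambda>x. exp (\<i> * of_real (q x)))"
  using slow_lincomb[of "\<lambda>x. of_real (q x)" "\<lambda>_. 0" \<i>] slow_const[of 0]
  by (intro slow_exp) auto

subsection \<open>Schwartz functions\<close>

lemma schwartz_decay:
  assumes "schwartz f"
  shows "\<exists>C\<ge>0. \<forall>x. (1 + norm x) ^ k * norm (f x) \<le> C"
proof -
  from assms obtain C where C: "\<And>x. (1 + norm x) ^ k * norm (f x) \<le> C"
    unfolding schwartz_iff using smooth_class_growth rapid_def by metis
  moreover have "0 \<le> C" using order_trans[OF _ C[of 0]] by simp
  ultimately show ?thesis by blast
qed

lemma schwartz_bound:
  assumes "schwartz f"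
  shows "\<exists>C\<ge>0. \<forall>x. norm (f x) \<le> C / (1 + norm x) ^ k"
proof -
  obtain C where C: "C \<ge> 0" "\<And>x. (1 + norm x) ^ k * norm (f x) \<le> C"
    using schwartz_decay[OF assms] by blast
  have "norm (f x) \<le> C / (1 + norm x) ^ k" for x
    using C(2)[of x] by (subst pos_le_divide_eq) (auto simp: mult.commute add_pos_nonneg)
  with C(1) show ?thesis by blast
qed

lemma schwartz_differentiable: "schwartz f \<Longrightarrow> f differentiable (at x)"
  unfolding schwartz_iff by (rule smooth_class_differentiable)

lemma schwartz_has_derivative:
  "schwartz f \<Longrightarrow> (f has_derivative frechet_derivative f (at x)) (at x)"
  by (intro has_frechet_derivative schwartz_differentiable)

lemma schwartz_continuous: "schwartz f \<Longrightarrow> continuous_on UNIV f"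
  by (simp add: continuous_at_imp_continuous_on differentiable_imp_continuous_within schwartz_differentiable)

lemma schwartz_measurable: "schwartz f \<Longrightarrow> f \<in> borel_measurable borel"
  by (intro borel_measurable_continuous_onI schwartz_continuous)

lemma schwartz_partial: "schwartz f \<Longrightarrow> b \<in> Basis \<Longrightarrow> schwartz (\<lambda>x. frechet_derivative f (at x) b)"
  unfolding schwartz_iff by (rule smooth_class_partial)

lemma schwartz_iter_partial: "schwartz f \<Longrightarrow> set bs \<subseteq> Basis \<Longrightarrow> schwartz (iter_partial bs f)"
  unfolding schwartz_iff by (rule smooth_class_iter_partial)

lemma schwartz_lincomb: "schwartz f \<Longrightarrow> schwartz g \<Longrightarrow> schwartz (\<lambda>x. c * f x + g x)"
  unfolding schwartz_iff by (intro smooth_class_lincomb growth_space_rapid)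

lemma schwartz_zero: "schwartz (\<lambda>_. 0)"
  unfolding schwartz_iff by (intro smooth_class_lspan growth_space_rapid lspan.zero)

lemma schwartz_cmult: "schwartz f \<Longrightarrow> schwartz (\<lambda>x. c * f x)"
  using schwartz_lincomb[OF _ schwartz_zero] by simp

lemma schwartz_add: "schwartz f \<Longrightarrow> schwartz g \<Longrightarrow> schwartz (\<lambda>x. f x + g x)"
  using schwartz_lincomb[of f g 1] by simp

lemma schwartz_diff: "schwartz f \<Longrightarrow> schwartz g \<Longrightarrow> schwartz (\<lambda>x. f x - g x)"
  using schwartz_lincomb[of g f "-1"] by simp

lemma schwartz_sum: "(\<And>i. i \<in> A \<Longrightarrow> schwartz (f i)) \<Longrightarrow> schwartz (\<lambda>x. \<Sum>i\<in>A. f i x)"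
  by (induction A rule: infinite_finite_induct) (auto intro: schwartz_zero schwartz_add)

lemma schwartz_directional: "schwartz f \<Longrightarrow> schwartz (\<lambda>x. frechet_derivative f (at x) v)"
  using schwartz_differentiable
  by (subst frechet_derivative_Basis_sum) (auto intro!: schwartz_sum schwartz_cmult schwartz_partial)

lemma schwartz_slow_mult:
  assumes "slow m" "schwartz f"
  shows "schwartz (\<lambda>x. m x * f x)"
  using assms unfolding schwartz_iff
proof (intro smooth_class_mult[OF growth_space_rapid])
  fix m f :: "'a \<Rightarrow> complex" assume "poly_bounded m" "rapid f"
  obtain D l where D: "D \<ge> 0" "\<And>x. norm (m x) \<le> D * (1 + norm x) ^ l"
    using poly_boundedD[OF \<open>poly_bounded m\<close>] by blast
  show "rapid (\<lambda>x. m x * f x)"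
    unfolding rapid_def
  proof
    fix k
    obtain C where C: "\<And>x. (1 + norm x) ^ (k + l) * norm (f x) \<le> C"
      using \<open>rapid f\<close> unfolding rapid_def by metis
    have "(1 + norm x) ^ k * norm (m x * f x) \<le> D * C" for x
    proof -
      have "(1 + norm x) ^ k * norm (m x * f x) \<le> (1 + norm x) ^ k * (D * (1 + norm x) ^ l * norm (f x))"
        unfolding norm_mult by (intro mult_left_mono mult_right_mono D) auto
      also have "\<dots> = D * ((1 + norm x) ^ (k + l) * norm (f x))"
        by (simp add: power_add mult_ac)
      also have "\<dots> \<le> D * C" by (intro mult_left_mono C D)
      finally show ?thesis .
    qed
    then show "\<exists>C. \<forall>x. (1 + norm x) ^ k * norm (m x * f x) \<le> C" by blast
  qed
qed

text \<open>Injectivity of \<open>L\<close>, in the quantitative form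
  \<open>norm x \<le> c * norm (L x)\<close>, converts decay in \<open>L x + a\<close> into decay in
  \<open>x\<close>. Embeddings are covered as well as invertible maps, so slices of a kernel are an
  instance.\<close>

lemma schwartz_affine:
  fixes L :: "'a::euclidean_space \<Rightarrow> 'b::euclidean_space"
  assumes "schwartz f" "bounded_linear L" and c: "\<And>x. norm x \<le> c * norm (L x)"
  shows "schwartz (\<lambda>x. f (L x + a))"
  using assms(1) unfolding schwartz_iff
proof (rule smooth_class_affine[OF growth_space_rapid _ assms(2)])
  fix f :: "'b \<Rightarrow> complex" assume "rapid f"
  \<comment> \<open>Chosen so that 1 + |c| |L x + a| + |c| |a|, a bound for 1 + |x|, is at most
    \<open>K\<close> times 1 + |L x + a|.\<close>
  define K where "K = 1 + \<bar>c\<bar> + \<bar>c\<bar> * norm a"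
  have K: "1 + norm x \<le> K * (1 + norm (L x + a))" for x
  proof -
    have "norm x \<le> \<bar>c\<bar> * norm (L x)"
      using c[of x] by (smt (verit) mult_right_mono norm_ge_zero)
    also have "\<dots> \<le> \<bar>c\<bar> * (norm (L x + a) + norm a)"
      by (intro mult_left_mono) (use norm_triangle_ineq4[of "L x + a" a] in auto)
    finally have "1 + norm x \<le> 1 + \<bar>c\<bar> * norm (L x + a) + \<bar>c\<bar> * norm a"
      by (simp add: algebra_simps)
    also have "\<dots> \<le> K * (1 + norm (L x + a))"
      unfolding K_def by (simp add: algebra_simps add_nonneg_nonneg)
    finally show ?thesis .
  qed
  show "rapid (\<lambda>x. f (L x + a))"
    unfolding rapid_def
  proof
    fix k
    obtain C where C: "\<And>x. (1 + norm x) ^ k * norm (f x) \<le> C"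
      using \<open>rapid f\<close> unfolding rapid_def by metis
    have "(1 + norm x) ^ k * norm (f (L x + a)) \<le> K ^ k * C" for x
    proof -
      have "(1 + norm x) ^ k * norm (f (L x + a)) \<le> (K * (1 + norm (L x + a))) ^ k * norm (f (L x + a))"
        by (intro mult_right_mono power_mono K) auto
      also have "\<dots> = K ^ k * ((1 + norm (L x + a)) ^ k * norm (f (L x + a)))"
        by (simp add: power_mult_distrib)
      also have "\<dots> \<le> K ^ k * C" by (intro mult_left_mono C) (simp add: K_def)
      finally show ?thesis .
    qed
    then show "\<exists>C. \<forall>x. (1 + norm x) ^ k * norm (f (L x + a)) \<le> C" by blast
  qed
qed

lemma schwartz_shift: "schwartz f \<Longrightarrow> schwartz (\<lambda>x. f (x + a))"
  by (rule schwartz_affine[where c = 1]) auto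

lemma schwartz_slice:
  assumes "schwartz (K :: 'a::euclidean_space \<times> 'b::euclidean_space \<Rightarrow> complex)"
  shows "schwartz (\<lambda>x. K (x, w))"
proof -
  have "schwartz (\<lambda>x. K ((x, 0) + (0, w)))"
    by (rule schwartz_affine[where c = 1 and L = "\<lambda>x. (x, 0)"])
      (auto intro!: assms bounded_linear_Pair bounded_linear_ident bounded_linear_zero)
  then show ?thesis by simp
qed

text \<open>Neither factor decays in both variables, so each is treated with the weight of its own
  component; the inequality 1 + |p| <= (1 + |x|)(1 + |y|) for p = (x, y) combines the two
  decays.\<close>

lemma schwartz_tensor:
  fixes f :: "'a::euclidean_space \<Rightarrow> complex" and g :: "'b::euclidean_space \<Rightarrow> complex"
  assumes "schwartz f" "schwartz g"
  shows "schwartz (\<lambda>p. f (fst p) * g (snd p))"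
  unfolding schwartz_iff
proof (rule smooth_class_mult[OF growth_space_rapid])
  let ?G = "\<lambda>u h :: 'a \<times> 'b \<Rightarrow> complex. \<forall>k. \<exists>C. \<forall>p. (1 + u p) ^ k * norm (h p) \<le> C"
  have G: "growth_space (?G u)" if "\<And>p. u p \<ge> 0" for u
    by (rule growth_space_weighted[OF that])
  have "smooth_class (?G (\<lambda>p. norm (fst p))) (\<lambda>p. f (fst p + 0))"
    by (rule smooth_class_affine[OF G assms(1)[unfolded schwartz_iff] bounded_linear_fst])
      (simp, fastforce simp: rapid_def)
  then show "smooth_class (?G (\<lambda>p. norm (fst p))) (\<lambda>p. f (fst p))" by simp
  have "smooth_class (?G (\<lambda>p. norm (snd p))) (\<lambda>p. g (snd p + 0))"
    by (rule smooth_class_affine[OF G assms(2)[unfolded schwartz_iff] bounded_linear_snd])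
      (simp, fastforce simp: rapid_def)
  then show "smooth_class (?G (\<lambda>p. norm (snd p))) (\<lambda>p. g (snd p))" by simp
  fix f g assume f: "?G (\<lambda>p. norm (fst p)) f" and g: "?G (\<lambda>p. norm (snd p)) g"
  show "rapid (\<lambda>x. f x * g x)"
    unfolding rapid_def
  proof
    fix k
    obtain C where C: "\<And>x. (1 + norm (fst x)) ^ k * norm (f x) \<le> C" using f by metis
    obtain D where D: "\<And>x. (1 + norm (snd x)) ^ k * norm (g x) \<le> D" using g by metis
    have C0: "0 \<le> C" using order_trans[OF _ C[of 0]] by simp
    have "(1 + norm x) ^ k * norm (f x * g x) \<le> C * D" for x :: "'a \<times> 'b"
    proof -
      have "1 + norm x \<le> 1 + (norm (fst x) + norm (snd x))"
        using norm_Pair_le[of "fst x" "snd x"] by simp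
      also have "1 + (norm (fst x) + norm (snd x)) \<le> (1 + norm (fst x)) * (1 + norm (snd x))"
        by (simp add: algebra_simps)
      finally have "1 + norm x \<le> (1 + norm (fst x)) * (1 + norm (snd x))"
        by simp
      then have "(1 + norm x) ^ k * norm (f x * g x) \<le>
          ((1 + norm (fst x)) * (1 + norm (snd x))) ^ k * norm (f x * g x)"
        by (intro mult_right_mono power_mono) auto
      also have "\<dots> = ((1 + norm (fst x)) ^ k * norm (f x)) * ((1 + norm (snd x)) ^ k * norm (g x))"
        by (simp add: power_mult_distrib norm_mult mult_ac)
      also have "\<dots> \<le> C * D" by (intro mult_mono C D C0) auto
      finally show ?thesis .
    qed
    then show "\<exists>C. \<forall>x. (1 + norm x) ^ k * norm (f x * g x) \<le> C" by blast
  qed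
qed

lemma schwartz_coinduct:
  assumes diff: "\<And>f x. C f \<Longrightarrow> f differentiable (at x)"
    and deriv: "\<And>f b. C f \<Longrightarrow> b \<in> Basis \<Longrightarrow> C (\<lambda>x. frechet_derivative f (at x) b)"
    and "\<And>f. C f \<Longrightarrow> rapid f" and "C f"
  shows "schwartz f"
  unfolding schwartz_iff
  by (rule smooth_class_coinduct[OF growth_space_rapid, of C]) (use assms in \<open>auto intro: lspan_base\<close>)

lemma schwartz_exp:
  assumes q: "slow q" and rapid: "\<And>k. \<exists>C. \<forall>x. (1 + norm x) ^ k * exp (Re (q x)) \<le> C"
  shows "schwartz (\<lambda>x. exp (q x))"
proof -
  have "rapid (\<lambda>x. m x * exp (q x))" if pm: "poly_bounded m" for m
    unfolding rapid_def
  proof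
    fix k
    obtain D l where D: "D \<ge> 0" "\<And>x. norm (m x) \<le> D * (1 + norm x) ^ l"
      using poly_boundedD[OF pm] by blast
    obtain C where C: "\<And>x. (1 + norm x) ^ (k + l) * exp (Re (q x)) \<le> C" using rapid by blast
    have "(1 + norm x) ^ k * norm (m x * exp (q x)) \<le> D * C" for x
    proof -
      have "(1 + norm x) ^ k * norm (m x * exp (q x)) \<le> (1 + norm x) ^ k * (D * (1 + norm x) ^ l * exp (Re (q x)))"
        unfolding norm_mult norm_exp_eq_Re by (intro mult_left_mono mult_right_mono D) auto
      also have "\<dots> = D * ((1 + norm x) ^ (k + l) * exp (Re (q x)))"
        by (simp add: power_add mult_ac)
      also have "\<dots> \<le> D * C" by (intro mult_left_mono C D)
      finally show ?thesis .
    qed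
    then show "\<exists>C. \<forall>x. (1 + norm x) ^ k * norm (m x * exp (q x)) \<le> C" by blast
  qed
  then have "smooth_class rapid (\<lambda>x. 1 * exp (q x))"
    by (intro slow_times_exp growth_space_rapid slow_const q)
  then show ?thesis by (simp add: schwartz_iff)
qed

subsection \<open>Integrals of Schwartz functions\<close>

text \<open>Each factor 1 + (x . b)^2 is at most (1 + |x|)^2, so the integrand lies below a product
  of one-variable functions 1 / (1 + t^2), whose integral factorises. Hence the exponent is twice
  the dimension.\<close>

lemma integrable_decay:
  "integrable lborel (\<lambda>x :: 'a::euclidean_space. 1 / (1 + norm x) ^ (2 * DIM('a)))"
proof (rule integrableI_bounded)
  let ?g = "\<lambda>x::real. 1 / (1 + x\<^sup>2)"
  have "integrable lborel ?g"
    using integrable_inverse_1_plus_square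
    by (simp add: set_integrable_def einterval_def inverse_eq_divide)
  then have fin: "(\<integral>\<^sup>+x. ?g x \<partial>lborel) < \<infinity>"
    by (simp add: integrable_iff_bounded)
  have "(\<integral>\<^sup>+x. ennreal (norm (1 / (1 + norm (x::'a)) ^ (2 * DIM('a)))) \<partial>lborel)
      \<le> (\<integral>\<^sup>+x. (\<Prod>b\<in>Basis. ?g ((x::'a) \<bullet> b)) \<partial>lborel)"
  proof (rule nn_integral_mono, rule ennreal_leI)
    fix x :: 'a
    have "(\<Prod>b\<in>(Basis::'a set). 1 + (x \<bullet> b)\<^sup>2) \<le> (\<Prod>b\<in>(Basis::'a set). (1 + norm x)\<^sup>2)"
    proof (intro prod_mono conjI)
      fix b :: 'a assume "b \<in> Basis"
      then have "\<bar>x \<bullet> b\<bar> \<le> norm x" by (rule Basis_le_norm)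
      then have "(x \<bullet> b)\<^sup>2 \<le> (norm x)\<^sup>2" by (rule abs_le_square_iff[THEN iffD1, OF order_trans]) simp
      then show "1 + (x \<bullet> b)\<^sup>2 \<le> (1 + norm x)\<^sup>2"
        using norm_ge_zero[of x] unfolding power2_sum power_one by linarith
    qed simp
    also have "\<dots> = (1 + norm x) ^ (2 * DIM('a))"
      by (simp add: power_mult)
    finally have "1 / (1 + norm x) ^ (2 * DIM('a)) \<le> 1 / (\<Prod>b\<in>(Basis::'a set). 1 + (x \<bullet> b)\<^sup>2)"
      by (intro divide_left_mono mult_pos_pos prod_pos) (auto simp: add_pos_nonneg)
    then show "norm (1 / (1 + norm x) ^ (2 * DIM('a))) \<le> (\<Prod>b\<in>Basis. ?g (x \<bullet> b))"
      by (simp add: prod_dividef)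
  qed
  also have "\<dots> = (\<integral>\<^sup>+x. (\<Prod>b\<in>Basis. ennreal (?g ((x::'a) \<bullet> b))) \<partial>lborel)"
    by (simp add: prod_ennreal)
  also have "\<dots> = (\<Prod>b\<in>(Basis::'a set). (\<integral>\<^sup>+x. ?g x \<partial>lborel))"
    by (rule nn_integral_lborel_prod) auto
  also have "\<dots> < \<infinity>"
    using fin by (simp add: power_less_top_ennreal)
  finally show "(\<integral>\<^sup>+x. ennreal (norm (1 / (1 + norm (x::'a)) ^ (2 * DIM('a)))) \<partial>lborel) < \<infinity>" .
qed simp

lemma schwartz_integrable:
  fixes f :: "'a::euclidean_space \<Rightarrow> complex"
  assumes "schwartz f"
  shows "integrable lborel f"
proof -
  obtain C where C: "C \<ge> 0" "\<And>x. norm (f x) \<le> C / (1 + norm x) ^ (2 * DIM('a))"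
    using schwartz_bound[OF assms] by blast
  show ?thesis
  proof (rule Bochner_Integration.integrable_bound)
    show "integrable lborel (\<lambda>x::'a. C * (1 / (1 + norm x) ^ (2 * DIM('a))))"
      by (rule integrable_mult_right) (rule integrable_decay)
    show "f \<in> borel_measurable lborel" using schwartz_measurable[OF assms] by simp
    show "AE x in lborel. norm (f x) \<le> norm (C * (1 / (1 + norm x) ^ (2 * DIM('a))))"
      using C by (simp add: abs_mult)
  qed
qed

text \<open>Dominated convergence for the first-order remainder divided by \<open>norm v\<close>. It
  is at most \<open>2 * B w\<close>: one \<open>B w\<close> from the Lipschitz bound, one from the
  derivative. The Lipschitz bound holds on the unit ball only, so a null sequence of increments
  first loses its initial terms.\<close>

lemma has_derivative_integral:
  fixes K :: "'w \<Rightarrow> 'a::euclidean_space \<Rightarrow> complex"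
  assumes D: "\<And>w. (K w has_derivative K' w) (at x)"
    and lip: "\<And>w v. norm v \<le> 1 \<Longrightarrow> norm (K w (x + v) - K w x) \<le> B w * norm v"
    and bound: "\<And>w v. norm (K' w v) \<le> B w * norm v"
    and B: "integrable M B"
    and int: "\<And>v. norm v \<le> 1 \<Longrightarrow> integrable M (\<lambda>w. K w (x + v))"
    and meas: "\<And>v. (\<lambda>w. K' w v) \<in> borel_measurable M"
  shows "((\<lambda>x. LINT w|M. K w x) has_derivative (\<lambda>v. LINT w|M. K' w v)) (at x)"
  unfolding has_derivative_at
proof
  have lin: "linear (K' w)" for w
    using D[of w] by (simp add: has_derivative_linear)
  have int': "integrable M (\<lambda>w. K' w v)" for v
    by (rule Bochner_Integration.integrable_bound[OF integrable_mult_left[OF B, of "norm v"] meas])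
      (use bound in \<open>auto intro!: AE_I2 order_trans[OF bound]\<close>)
  show "bounded_linear (\<lambda>v. LINT w|M. K' w v)"
  proof (rule bounded_linear_intro[where K = "LINT w|M. B w"])
    show "(LINT w|M. K' w (u + v)) = (LINT w|M. K' w u) + (LINT w|M. K' w v)" for u v
      by (simp add: linear_add[OF lin] int')
    show "(LINT w|M. K' w (r *\<^sub>R u)) = r *\<^sub>R (LINT w|M. K' w u)" for r u
      by (simp add: linear_scale[OF lin])
    show "norm (LINT w|M. K' w u) \<le> norm u * (LINT w|M. B w)" for u
    proof -
      have "norm (LINT w|M. K' w u) \<le> (LINT w|M. B w * norm u)"
        by (rule order_trans[OF integral_norm_bound integral_mono])
          (use int' bound B in auto)
      then show ?thesis by (simp add: mult.commute)
    qed
  qed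
  let ?R = "\<lambda>v w. (K w (x + v) - K w x - K' w v) /\<^sub>R norm v"
  have "((\<lambda>v. norm ((LINT w|M. K w (x + v)) - (LINT w|M. K w x) - (LINT w|M. K' w v)) / norm v) \<circ> X)
      \<longlonglongrightarrow> 0" if X0: "\<And>i. X i \<noteq> 0" and X: "X \<longlonglongrightarrow> 0" for X
  proof -
    have "\<forall>\<^sub>F i in sequentially. dist (X i) 0 < 1"
      using X by (rule tendstoD) simp
    then obtain N where N: "\<And>i. i \<ge> N \<Longrightarrow> norm (X i) < 1"
      by (auto simp: eventually_sequentially)
    define Y where "Y i = X (i + N)" for i
    have Y: "Y \<longlonglongrightarrow> 0" unfolding Y_def by (rule LIMSEQ_ignore_initial_segment[OF X])
    have Y1: "norm (Y i) \<le> 1" and Y0: "Y i \<noteq> 0" for i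
      unfolding Y_def using N[of "i + N"] X0 by auto
    have intx: "integrable M (\<lambda>w. K w x)" using int[of 0] by simp
    have "(\<lambda>i. LINT w|M. ?R (Y i) w) \<longlonglongrightarrow> (LINT w|M. 0)"
    proof (rule integral_dominated_convergence[where w = "\<lambda>w. 2 * B w"])
      show "(\<lambda>w. ?R (Y i) w) \<in> borel_measurable M" for i
        using int[OF Y1] intx int'
        by (intro borel_measurable_scaleR borel_measurable_diff borel_measurable_const
            borel_measurable_integrable)
      show "AE w in M. (\<lambda>i. ?R (Y i) w) \<longlonglongrightarrow> 0"
      proof (rule AE_I2)
        fix w
        have "(\<lambda>v. norm (K w (x + v) - K w x - K' w v) / norm v) \<midarrow>0\<rightarrow> 0"
          using D[of w] unfolding has_derivative_at by blast
        then have "(\<lambda>i. norm (K w (x + Y i) - K w x - K' w (Y i)) / norm (Y i)) \<longlonglongrightarrow> 0"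
          using Y Y0 by (auto simp: tendsto_at_iff_sequentially o_def)
        then show "(\<lambda>i. ?R (Y i) w) \<longlonglongrightarrow> 0"
          by (subst tendsto_norm_zero_iff[symmetric]) (simp add: divide_inverse mult.commute)
      qed
      show "AE w in M. norm (?R (Y i) w) \<le> 2 * B w" for i
      proof (rule AE_I2)
        fix w
        have "norm (K w (x + Y i) - K w x - K' w (Y i)) \<le> norm (K w (x + Y i) - K w x) + norm (K' w (Y i))"
          by (rule norm_triangle_ineq4)
        also have "\<dots> \<le> 2 * B w * norm (Y i)"
          using lip[OF Y1[of i], of w] bound[of w "Y i"] by simp
        finally show "norm (?R (Y i) w) \<le> 2 * B w"
          unfolding norm_scaleR using Y0[of i] by (simp add: divide_simps mult.commute)
      qed
    qed (use B in auto)
    moreover have "norm ((LINT w|M. K w (x + Y i)) - (LINT w|M. K w x) - (LINT w|M. K' w (Y i))) / norm (Y i)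
        = norm (LINT w|M. ?R (Y i) w)" for i
      using int[OF Y1] intx int'
      by (simp add: divide_inverse mult.commute)
    ultimately have "(\<lambda>i. norm ((LINT w|M. K w (x + Y i)) - (LINT w|M. K w x) - (LINT w|M. K' w (Y i))) / norm (Y i)) \<longlonglongrightarrow> 0"
      using tendsto_norm_zero by fastforce
    then show ?thesis
      unfolding Y_def o_def by (rule LIMSEQ_offset)
  qed
  then show "(\<lambda>v. norm ((LINT w|M. K w (x + v)) - (LINT w|M. K w x) - (LINT w|M. K' w v)) / norm v) \<midarrow>0\<rightarrow> 0"
    by (auto simp: tendsto_at_iff_sequentially)
qed

lemma schwartz_derivative_bound:
  assumes f: "schwartz (f :: 'a::euclidean_space \<Rightarrow> complex)"
  shows "\<exists>C\<ge>0. \<forall>x u. norm (frechet_derivative f (at x) u) \<le> C * norm u / (1 + norm x) ^ k"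
proof -
  have "\<exists>C\<ge>0. \<forall>x. norm (frechet_derivative f (at x) b) \<le> C / (1 + norm x) ^ k" if "b \<in> Basis" for b
    by (rule schwartz_bound[OF schwartz_partial[OF f that]])
  then obtain C where C: "\<And>b. b \<in> Basis \<Longrightarrow> C b \<ge> 0"
    "\<And>b x. b \<in> Basis \<Longrightarrow> norm (frechet_derivative f (at x) b) \<le> C b / (1 + norm x) ^ k"
    by metis
  have "norm (frechet_derivative f (at x) u) \<le> (\<Sum>b\<in>Basis. C b) * norm u / (1 + norm x) ^ k" for x u
  proof -
    have "norm (frechet_derivative f (at x) u) \<le> (\<Sum>b\<in>Basis. norm u * (C b / (1 + norm x) ^ k))"
      unfolding frechet_derivative_Basis_sum[OF schwartz_differentiable[OF f], of x u]
    proof (rule sum_norm_le)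
      fix b :: 'a assume b: "b \<in> Basis"
      show "norm (of_real (u \<bullet> b) * frechet_derivative f (at x) b) \<le> norm u * (C b / (1 + norm x) ^ k)"
        unfolding norm_mult norm_of_real
        by (rule mult_mono[OF Basis_le_norm[OF b] C(2)[OF b]]) auto
    qed
    also have "\<dots> = (\<Sum>b\<in>Basis. C b) * norm u / (1 + norm x) ^ k"
      by (simp add: sum_distrib_left sum_divide_distrib mult_ac)
    finally show ?thesis .
  qed
  then show ?thesis using C(1) by (intro exI[of _ "\<Sum>b\<in>Basis. C b"]) (auto intro: sum_nonneg)
qed

text \<open>Mean value inequality on the unit ball around \<open>x\<close>, where 1 + |x| <= 2 (1 +
  |y|); this costs the factor \<open>2 ^ k\<close>.\<close>

lemma schwartz_local_lipschitz:
  assumes f: "schwartz (f :: 'a::euclidean_space \<Rightarrow> complex)"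
  shows "\<exists>C\<ge>0. (\<forall>x u. norm (frechet_derivative f (at x) u) \<le> C * norm u / (1 + norm x) ^ k) \<and>
    (\<forall>x v. norm v \<le> 1 \<longrightarrow> norm (f (x + v) - f x) \<le> C * norm v / (1 + norm x) ^ k)"
proof -
  obtain C where C: "C \<ge> 0" "\<And>x u. norm (frechet_derivative f (at x) u) \<le> C * norm u / (1 + norm x) ^ k"
    using schwartz_derivative_bound[OF f] by blast
  have CC: "C \<le> 2 ^ k * C" using mult_right_mono[OF one_le_power[of "2::real" k] C(1)] by simp
  have "norm (f (x + v) - f x) \<le> 2 ^ k * C * norm v / (1 + norm x) ^ k" if v: "norm v \<le> 1" for x v
  proof -
    have "norm (f (x + v) - f x) \<le> (2 ^ k * C / (1 + norm x) ^ k) * norm (x + v - x)"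
    proof (rule differentiable_bound[where S = "cball x 1"])
      fix y assume y: "y \<in> cball x 1"
      show "(f has_derivative frechet_derivative f (at y)) (at y within cball x 1)"
        by (rule has_derivative_at_withinI[OF schwartz_has_derivative[OF f]])
      show "onorm (frechet_derivative f (at y)) \<le> 2 ^ k * C / (1 + norm x) ^ k"
      proof (rule onorm_le)
        fix u
        have "norm x \<le> norm y + 1"
          using y norm_triangle_sub[of x y] by (simp add: dist_norm)
        moreover have "0 \<le> norm y" by simp
        ultimately have "1 + norm x \<le> 2 * (1 + norm y)" by argo
        then have "(1 + norm x) ^ k \<le> (2 * (1 + norm y)) ^ k"
          by (rule power_mono) simp
        then have "(1 + norm x) ^ k \<le> 2 ^ k * (1 + norm y) ^ k"
          unfolding power_mult_distrib .
        then have "1 / (1 + norm y) ^ k \<le> 2 ^ k / (1 + norm x) ^ k"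
          by (simp add: divide_simps add_pos_nonneg mult.commute)
        from mult_left_mono[OF this, of "C * norm u"]
        show "norm (frechet_derivative f (at y) u) \<le> 2 ^ k * C / (1 + norm x) ^ k * norm u"
          using C(1) by (intro order_trans[OF C(2)]) (simp add: mult_ac)
      qed
    qed (use v in \<open>auto simp: dist_norm\<close>)
    then show ?thesis by simp
  qed
  moreover have "C * norm u / (1 + norm x) ^ k \<le> 2 ^ k * C * norm u / (1 + norm x) ^ k" for x u :: 'a
    using CC by (intro divide_right_mono mult_right_mono) auto
  ultimately show ?thesis using C order_trans[OF C(2)] by (intro exI[of _ "2 ^ k * C"]) auto
qed

lemma norm_snd_power_le:
  "C \<ge> 0 \<Longrightarrow> C / (1 + norm (x, w)) ^ k \<le> C / (1 + norm w) ^ k"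
  by (intro divide_left_mono power_mono mult_pos_pos zero_less_power)
    (auto simp: norm_snd_le add_pos_nonneg)

lemma schwartz_slice_snd:
  assumes "schwartz (K :: 'a::euclidean_space \<times> 'b::euclidean_space \<Rightarrow> complex)"
  shows "schwartz (\<lambda>w. K (x, w))"
proof -
  have "schwartz (\<lambda>w. K ((0, w) + (x, 0)))"
    by (rule schwartz_affine[where c = 1 and L = "\<lambda>w. (0, w)"])
      (auto intro!: assms bounded_linear_Pair bounded_linear_ident bounded_linear_zero simp: norm_Pair)
  then show ?thesis by simp
qed

lemma schwartz_partial_integral_derivative:
  fixes K :: "'a::euclidean_space \<times> 'b::euclidean_space \<Rightarrow> complex"
  assumes K: "schwartz K"
  shows "((\<lambda>x. LINT w|lborel. K (x, w)) has_derivative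
    (\<lambda>v. LINT w|lborel. frechet_derivative K (at (x, w)) (v, 0))) (at x)"
proof -
  let ?k = "2 * DIM('b)"
  obtain C where C: "C \<ge> 0"
    "\<And>p u. norm (frechet_derivative K (at p) u) \<le> C * norm u / (1 + norm p) ^ ?k"
    "\<And>p v. norm v \<le> 1 \<Longrightarrow> norm (K (p + v) - K p) \<le> C * norm v / (1 + norm p) ^ ?k"
    using schwartz_local_lipschitz[OF K, of ?k] by blast
  have le: "C * norm (v :: 'a) / (1 + norm (x, w)) ^ ?k \<le> C * (1 / (1 + norm w) ^ ?k) * norm v" for v w
    using norm_snd_power_le[of "C * norm v" x w ?k] C(1) by simp
  show ?thesis
  proof (rule has_derivative_integral[where K = "\<lambda>w x. K (x, w)" and B = "\<lambda>w. C * (1 / (1 + norm w) ^ ?k)"])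
    have D: "((\<lambda>x. (x, w)) has_derivative (\<lambda>v. (v, 0))) (at x)" for w :: 'b
      by (auto intro!: derivative_eq_intros)
    show "((\<lambda>x. K (x, w)) has_derivative (\<lambda>v. frechet_derivative K (at (x, w)) (v, 0))) (at x)" for w
      by (rule has_derivative_compose[OF D schwartz_has_derivative[OF K]])
    show "norm (K (x + v, w) - K (x, w)) \<le> C * (1 / (1 + norm w) ^ ?k) * norm v" if "norm v \<le> 1" for w v
      using C(3)[of "(v, 0)" "(x, w)"] that le[of v w] by (simp add: norm_Pair)
    show "norm (frechet_derivative K (at (x, w)) (v, 0)) \<le> C * (1 / (1 + norm w) ^ ?k) * norm v" for w v
      using C(2)[of "(x, w)" "(v, 0)"] le[of v w] by (simp add: norm_Pair)
    show "integrable lborel (\<lambda>w::'b. C * (1 / (1 + norm w) ^ ?k))"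
      by (intro integrable_mult_right integrable_decay)
    show "integrable lborel (\<lambda>w. K (x + v, w))" for v
      by (intro schwartz_integrable schwartz_slice_snd K)
    show "(\<lambda>w. frechet_derivative K (at (x, w)) (v, 0)) \<in> borel_measurable lborel" for v
      using schwartz_measurable[OF schwartz_slice_snd[OF schwartz_directional[OF K, of "(v, 0)"], of x]] by simp
  qed
qed

text \<open>Partial integrals of Schwartz kernels form a family closed under differentiation in the
  remaining variable. For the decay, the kernel is bounded with exponent
  \<open>k + 2 * DIM('b)\<close>: \<open>k\<close> powers pay for the weight in \<open>x\<close>,
  the others make the integral over \<open>w\<close> finite.\<close>

lemma schwartz_partial_integral:
  fixes K :: "'a::euclidean_space \<times> 'b::euclidean_space \<Rightarrow> complex"
  assumes "schwartz K"
  shows "schwartz (\<lambda>x. LINT w|lborel. K (x, w))"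
proof (rule schwartz_coinduct[where C = "\<lambda>h. \<exists>K :: 'a \<times> 'b \<Rightarrow> complex. schwartz K \<and> h = (\<lambda>x. LINT w|lborel. K (x, w))"])
  let ?C = "\<lambda>h. \<exists>K :: 'a \<times> 'b \<Rightarrow> complex. schwartz K \<and> h = (\<lambda>x. LINT w|lborel. K (x, w))"
  show "?C (\<lambda>x. LINT w|lborel. K (x, w))" using assms by blast
  fix h assume "?C h"
  then obtain K :: "'a \<times> 'b \<Rightarrow> complex" where K: "schwartz K" and h: "h = (\<lambda>x. LINT w|lborel. K (x, w))"
    by blast
  note D = schwartz_partial_integral_derivative[OF K, folded h]
  show "h differentiable (at x)" for x using D differentiable_def by blast
  show "rapid h"
    unfolding rapid_def
  proof
    fix k
    let ?k = "2 * DIM('b)"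
    obtain C where C: "C \<ge> 0" "\<And>p. norm (K p) \<le> C / (1 + norm p) ^ (k + ?k)"
      using schwartz_bound[OF K] by blast
    have "(1 + norm x) ^ k * norm (h x) \<le> (LINT w|lborel. C * (1 / (1 + norm (w::'b)) ^ ?k))" for x
    proof -
      have "norm (LINT w|lborel. (1 + norm x) ^ k *\<^sub>R K (x, w)) \<le> (LINT w|lborel. C * (1 / (1 + norm (w::'b)) ^ ?k))"
      proof (rule Bochner_Integration.integral_norm_bound_integral)
        show "integrable lborel (\<lambda>w. (1 + norm x) ^ k *\<^sub>R K (x, w))"
          by (intro integrable_scaleR_right schwartz_integrable schwartz_slice_snd K)
        show "norm ((1 + norm x) ^ k *\<^sub>R K (x, w)) \<le> C * (1 / (1 + norm w) ^ ?k)" for w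
        proof -
          have "norm ((1 + norm x) ^ k *\<^sub>R K (x, w)) = (1 + norm x) ^ k * norm (K (x, w))"
            by simp
          also have "\<dots> \<le> (1 + norm (x, w)) ^ k * (C / (1 + norm (x, w)) ^ (k + ?k))"
            using norm_fst_le[of x w] by (intro mult_mono C power_mono) auto
          also have "\<dots> = C / (1 + norm (x, w)) ^ ?k"
            by (simp add: power_add add_nonneg_eq_0_iff)
          also have "\<dots> \<le> C / (1 + norm w) ^ ?k"
            by (rule norm_snd_power_le[OF C(1)])
          finally show "norm ((1 + norm x) ^ k *\<^sub>R K (x, w)) \<le> C * (1 / (1 + norm w) ^ ?k)"
            by simp
        qed
      qed (intro integrable_mult_right integrable_decay)
      then show ?thesis by (simp add: h)
    qed
    then show "\<exists>C. \<forall>x. (1 + norm x) ^ k * norm (h x) \<le> C" by blast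
  qed
  fix b :: 'a assume "b \<in> Basis"
  then have "schwartz (\<lambda>p. frechet_derivative K (at p) (b, 0))"
    by (intro schwartz_directional K)
  then show "?C (\<lambda>x. frechet_derivative h (at x) b)"
    unfolding frechet_derivative_eqI[OF D] by (intro exI[of _ "\<lambda>p. frechet_derivative K (at p) (b, 0)"]) simp
qed

text \<open>Together with \<open>iter_partial_slice\<close> this lets an integral and its
  approximating sums be compared derivative by derivative in a Schwartz seminorm.\<close>

lemma iter_partial_integral:
  fixes K :: "'a::euclidean_space \<times> 'b::euclidean_space \<Rightarrow> complex"
  assumes "schwartz K" "set bs \<subseteq> Basis"
  shows "iter_partial bs (\<lambda>x. LINT w|lborel. K (x, w)) =
    (\<lambda>x. LINT w|lborel. iter_partial (map (\<lambda>b. (b, 0)) bs) K (x, w))"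
  using assms(2)
proof (induction bs)
  case (Cons b bs)
  then have "set (map (\<lambda>b. (b, 0)) bs) \<subseteq> (Basis :: ('a \<times> 'b) set)"
    by (auto simp: Basis_prod_def)
  then have "schwartz (iter_partial (map (\<lambda>b. (b, 0)) bs) K)"
    by (rule schwartz_iter_partial[OF assms(1)])
  from frechet_derivative_eqI[OF schwartz_partial_integral_derivative[OF this]] show ?case
    using Cons by simp
qed simp

lemma iter_partial_slice:
  fixes K :: "'a::euclidean_space \<times> 'b::euclidean_space \<Rightarrow> complex"
  assumes "schwartz K" "set bs \<subseteq> Basis"
  shows "iter_partial bs (\<lambda>x. K (x, w)) = (\<lambda>x. iter_partial (map (\<lambda>b. (b, 0)) bs) K (x, w))"
  using assms(2)
proof (induction bs)
  case (Cons b bs)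
  then have "set (map (\<lambda>b. (b, 0)) bs) \<subseteq> (Basis :: ('a \<times> 'b) set)"
    by (auto simp: Basis_prod_def)
  then have S: "schwartz (iter_partial (map (\<lambda>b. (b, 0)) bs) K)"
    by (rule schwartz_iter_partial[OF assms(1)])
  have D: "((\<lambda>x. (x, w)) has_derivative (\<lambda>v. (v, 0))) (at x)" for x
    by (auto intro!: derivative_eq_intros)
  from frechet_derivative_eqI[OF has_derivative_compose[OF D schwartz_has_derivative[OF S]]] show ?case
    using Cons by simp
qed simp

section \<open>Changes of variables and integration by parts\<close>

lemma lborel_integral_affine:
  fixes f :: "'a::euclidean_space \<Rightarrow> complex"
  assumes "c \<noteq> 0" "f \<in> borel_measurable borel"
  shows "(LINT x|lborel. f (t + c *\<^sub>R x)) = of_real (1 / \<bar>c\<bar> ^ DIM('a)) * (LINT x|lborel. f x)"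
proof -
  have [measurable]: "f \<in> borel_measurable borel" by fact
  have "(LINT x|lborel. f x) = (LINT x|density (distr lborel borel (\<lambda>x. t + c *\<^sub>R x)) (\<lambda>_. \<bar>c\<bar> ^ DIM('a)). f x)"
    using lborel_affine[OF assms(1), of t] by simp
  also have "\<dots> = (LINT x|lborel. (\<bar>c\<bar> ^ DIM('a)) *\<^sub>R f (t + c *\<^sub>R x))"
    by (subst integral_density) (auto simp: integral_distr)
  also have "\<dots> = of_real (\<bar>c\<bar> ^ DIM('a)) * (LINT x|lborel. f (t + c *\<^sub>R x))"
    by (simp add: scaleR_conv_of_real)
  finally show ?thesis using assms(1) by (simp add: field_simps)
qed

lemma lborel_integrable_affine:
  fixes f :: "'a::euclidean_space \<Rightarrow> 'b::{banach, second_countable_topology}"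
  assumes "c \<noteq> 0" "integrable lborel f"
  shows "integrable lborel (\<lambda>x. f (t + c *\<^sub>R x))"
proof -
  have [measurable]: "f \<in> borel_measurable borel" using assms(2) by auto
  have "integrable (density (distr lborel borel (\<lambda>x. t + c *\<^sub>R x)) (\<lambda>_. \<bar>c\<bar> ^ DIM('a))) f"
    using assms(2) lborel_affine[OF assms(1), of t] by simp
  then have "integrable lborel (\<lambda>x. (\<bar>c\<bar> ^ DIM('a)) *\<^sub>R f (t + c *\<^sub>R x))"
    by (subst (asm) integrable_density) (auto simp: integrable_distr_eq)
  from integrable_scaleR_right[OF this, of "inverse (\<bar>c\<bar> ^ DIM('a))"] show ?thesis
    using assms(1) by simp
qed

lemma lborel_integral_shift:
  fixes f :: "'a::euclidean_space \<Rightarrow> complex"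
  assumes "f \<in> borel_measurable borel"
  shows "(LINT x|lborel. f (x + t)) = (LINT x|lborel. f x)"
  using lborel_integral_affine[OF _ assms, of 1 t] by (simp add: add.commute)

text \<open>The integral of a translate does not depend on the translation; differentiating under
  the integral at 0 gives the claim. Integration by parts is later obtained by applying this to a
  product.\<close>

lemma integral_partial_schwartz:
  fixes f :: "'a::euclidean_space \<Rightarrow> complex"
  assumes f: "schwartz f"
  shows "(LINT x|lborel. frechet_derivative f (at x) v) = 0"
proof -
  let ?k = "2 * DIM('a)"
  obtain C where C: "C \<ge> 0"
    "\<And>p u. norm (frechet_derivative f (at p) u) \<le> C * norm u / (1 + norm p) ^ ?k"
    "\<And>p v. norm v \<le> 1 \<Longrightarrow> norm (f (p + v) - f p) \<le> C * norm v / (1 + norm p) ^ ?k"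
    using schwartz_local_lipschitz[OF f, of ?k] by blast
  have "((\<lambda>v. LINT x|lborel. f (x + v)) has_derivative
      (\<lambda>v. LINT x|lborel. frechet_derivative f (at x) v)) (at 0)"
  proof (rule has_derivative_integral[where K = "\<lambda>x v. f (x + v)" and B = "\<lambda>x. C * (1 / (1 + norm x) ^ ?k)"])
    have D: "((\<lambda>v. x + v) has_derivative (\<lambda>v. v)) (at 0)" for x :: 'a
      by (auto intro!: derivative_eq_intros)
    show "((\<lambda>v. f (x + v)) has_derivative frechet_derivative f (at x)) (at 0)" for x
      using has_derivative_compose[OF D, of f "frechet_derivative f (at x)" x] schwartz_has_derivative[OF f, of x]
      by simp
    show "integrable lborel (\<lambda>x::'a. C * (1 / (1 + norm x) ^ ?k))"
      by (intro integrable_mult_right integrable_decay)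
    show "integrable lborel (\<lambda>x. f (x + (0 + v)))" for v
      by (simp add: schwartz_integrable schwartz_shift f)
    show "(\<lambda>x. frechet_derivative f (at x) v) \<in> borel_measurable lborel" for v
      using schwartz_measurable[OF schwartz_directional[OF f]] by simp
  qed (use C in auto)
  moreover have "(\<lambda>v. LINT x|lborel. f (x + v)) = (\<lambda>v. LINT x|lborel. f x)"
    using lborel_integral_shift[OF schwartz_measurable[OF f]] by simp
  ultimately have "((\<lambda>_::'a. LINT x|lborel. f x) has_derivative
      (\<lambda>v. LINT x|lborel. frechet_derivative f (at x) v)) (at 0)" by simp
  from has_derivative_unique[OF this has_derivative_const] show ?thesis by meson
qed

subsection \<open>Gaussian integrals\<close>

lemma integrable_tensor:
  fixes u :: "'a::euclidean_space \<Rightarrow> complex" and v :: "'b::euclidean_space \<Rightarrow> complex"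
  assumes "integrable lborel u" "integrable lborel v"
  shows "integrable (lborel \<Otimes>\<^sub>M lborel) (\<lambda>p. u (fst p) * v (snd p))"
proof (rule lborel_pair.Fubini_integrable)
  have [measurable]: "u \<in> borel_measurable borel" "v \<in> borel_measurable borel"
    using assms by auto
  show "(\<lambda>p. u (fst p) * v (snd p)) \<in> borel_measurable (lborel \<Otimes>\<^sub>M lborel)" by measurable
  show "integrable lborel (\<lambda>x. LINT y|lborel. norm (u (fst (x, y)) * v (snd (x, y))))"
    using assms by (simp add: norm_mult)
  show "AE x in lborel. integrable lborel (\<lambda>y. u (fst (x, y)) * v (snd (x, y)))"
    using assms by simp
qed

lemma lborel_integral_prod_Basis:
  fixes g :: "'a::euclidean_space \<Rightarrow> real \<Rightarrow> complex"
  assumes g: "\<And>b. b \<in> Basis \<Longrightarrow> integrable lborel (g b)"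
  shows "integrable lborel (\<lambda>x. (\<Prod>b\<in>Basis. g b (x \<bullet> b)))"
    and "(LINT x|lborel. (\<Prod>b\<in>Basis. g b (x \<bullet> b))) = (\<Prod>b\<in>Basis. (LINT t|lborel. g b t))"
proof -
  interpret product_sigma_finite "\<lambda>_::'a. lborel :: real measure" ..
  have [measurable]: "b \<in> Basis \<Longrightarrow> g b \<in> borel_measurable borel" for b
    using g by auto
  have eq: "(\<Prod>b\<in>Basis. g b ((\<Sum>b\<in>Basis. f b *\<^sub>R b) \<bullet> b)) = (\<Prod>b\<in>Basis. g b (f b))" for f
    by (intro prod.cong) auto
  have m: "(\<lambda>x. (\<Prod>b\<in>Basis. g b (x \<bullet> b))) \<in> borel_measurable borel"
    by measurable
  have m': "(\<lambda>f. \<Sum>b\<in>(Basis::'a set). f b *\<^sub>R b) \<in> measurable (\<Pi>\<^sub>M b\<in>Basis. lborel) borel"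
    by measurable
  show "integrable lborel (\<lambda>x. (\<Prod>b\<in>Basis. g b (x \<bullet> b)))"
    by (subst lborel_eq, subst integrable_distr_eq[OF m' m], unfold eq)
      (intro product_integrable_prod g finite_Basis)
  show "(LINT x|lborel. (\<Prod>b\<in>Basis. g b (x \<bullet> b))) = (\<Prod>b\<in>Basis. (LINT t|lborel. g b t))"
    by (subst lborel_eq, subst integral_distr[OF m' m], unfold eq)
      (intro product_integral_prod g finite_Basis)
qed

text \<open>A rescaling of the characteristic function of the standard normal distribution: for s =
  sqrt (2 c) its density at s x is exp (- c x^2) / sqrt (2 pi).\<close>

lemma gaussian_fourier_real:
  fixes c u :: real
  assumes c: "c > 0"
  shows "integrable lborel (\<lambda>x. iexp (u * x) * of_real (exp (- c * x\<^sup>2)))"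
    and "(LINT x|lborel. iexp (u * x) * of_real (exp (- c * x\<^sup>2))) = of_real (sqrt (pi / c) * exp (- u\<^sup>2 / (4 * c)))"
proof -
  define s where "s = sqrt (2 * c)"
  have s: "s > 0" "s\<^sup>2 = 2 * c" using c by (auto simp: s_def)
  let ?h = "\<lambda>t x. std_normal_density x *\<^sub>R iexp (t * x)"
  have int: "integrable lborel (?h t)" for t
    by (rule Bochner_Integration.integrable_bound[OF integrable_normal_density[of 1 0]])
      (auto simp: std_normal_density_def)
  have I: "(LINT x|lborel. ?h t x) = of_real (exp (- t\<^sup>2 / 2))" for t
    using fun_cong[OF char_std_normal_distribution, of t]
    by (simp add: char_def integral_density)
  have eq: "iexp (u * x) * of_real (exp (- c * x\<^sup>2)) = of_real (sqrt (2 * pi)) * ?h (u / s) (0 + s *\<^sub>R x)" for x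
    using s by (simp add: std_normal_density_def scaleR_conv_of_real power_mult_distrib)
  show "integrable lborel (\<lambda>x. iexp (u * x) * of_real (exp (- c * x\<^sup>2)))"
    unfolding eq using s by (intro integrable_mult_right lborel_integrable_affine int) auto
  have "(LINT x|lborel. iexp (u * x) * of_real (exp (- c * x\<^sup>2))) =
      of_real (sqrt (2 * pi)) * (LINT x|lborel. ?h (u / s) (0 + s *\<^sub>R x))"
    unfolding eq by (rule integral_mult_right_zero)
  also have "(LINT x|lborel. ?h (u / s) (0 + s *\<^sub>R x)) = of_real (1 / \<bar>s\<bar> ^ DIM(real)) * (LINT x|lborel. ?h (u / s) x)"
    using s borel_measurable_integrable[OF int] by (intro lborel_integral_affine) auto
  also note I
  also have "of_real (sqrt (2 * pi)) * (complex_of_real (1 / \<bar>s\<bar> ^ DIM(real)) * of_real (exp (- (u / s)\<^sup>2 / 2))) =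
      of_real (sqrt (2 * pi) / s * exp (- (u / s)\<^sup>2 / 2))"
    using s by simp
  also have "sqrt (2 * pi) / s = sqrt (pi / c)"
    unfolding s_def by (subst real_sqrt_divide[symmetric]) simp
  also have "- (u / s)\<^sup>2 / 2 = - u\<^sup>2 / (4 * c)"
    by (simp add: power_divide s)
  finally show "(LINT x|lborel. iexp (u * x) * of_real (exp (- c * x\<^sup>2))) = of_real (sqrt (pi / c) * exp (- u\<^sup>2 / (4 * c)))" .
qed

lemma gaussian_fourier:
  fixes u :: "'a::euclidean_space"
  assumes c: "c > 0"
  shows "integrable lborel (\<lambda>x. iexp (u \<bullet> x) * of_real (exp (- c * (norm x)\<^sup>2)))"
    and "(LINT x|lborel. iexp (u \<bullet> x) * of_real (exp (- c * (norm x)\<^sup>2))) =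
      of_real (sqrt (pi / c) ^ DIM('a) * exp (- (norm u)\<^sup>2 / (4 * c)))"
proof -
  have nsq: "(norm x)\<^sup>2 = (\<Sum>b\<in>Basis. (x \<bullet> b)\<^sup>2)" for x :: 'a
    by (subst power2_norm_eq_inner, subst euclidean_inner) (simp add: power2_eq_square)
  have eq: "iexp (u \<bullet> x) * of_real (exp (- c * (norm x)\<^sup>2)) =
      (\<Prod>b\<in>Basis. iexp ((u \<bullet> b) * (x \<bullet> b)) * of_real (exp (- c * (x \<bullet> b)\<^sup>2)))" for x :: 'a
    by (subst euclidean_inner)
      (simp add: nsq prod.distrib sum_distrib_left exp_sum sum_negf[symmetric] flip: of_real_prod)
  show "integrable lborel (\<lambda>x. iexp (u \<bullet> x) * of_real (exp (- c * (norm x)\<^sup>2)))"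
    unfolding eq
    by (rule lborel_integral_prod_Basis(1)[where g = "\<lambda>b t. iexp ((u \<bullet> b) * t) * of_real (exp (- c * t\<^sup>2))"])
      (rule gaussian_fourier_real(1)[OF c])
  have "(LINT x|lborel. iexp (u \<bullet> x) * of_real (exp (- c * (norm x)\<^sup>2))) =
      (\<Prod>b\<in>Basis. of_real (sqrt (pi / c) * exp (- (u \<bullet> b)\<^sup>2 / (4 * c))))"
    unfolding eq
    by (subst lborel_integral_prod_Basis(2)[where g = "\<lambda>b t. iexp ((u \<bullet> b) * t) * of_real (exp (- c * t\<^sup>2))"])
      (simp_all only: gaussian_fourier_real[OF c])
  also have "\<dots> = of_real (sqrt (pi / c) ^ DIM('a) * exp (- (norm u)\<^sup>2 / (4 * c)))"
    by (simp add: nsq prod.distrib sum_divide_distrib exp_sum sum_negf[symmetric] flip: of_real_prod)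
  finally show "(LINT x|lborel. iexp (u \<bullet> x) * of_real (exp (- c * (norm x)\<^sup>2))) =
      of_real (sqrt (pi / c) ^ DIM('a) * exp (- (norm u)\<^sup>2 / (4 * c)))" .
qed

lemma gaussian_integral:
  assumes c: "c > 0"
  shows "integrable lborel (\<lambda>x :: 'a::euclidean_space. complex_of_real (exp (- c * (norm x)\<^sup>2)))"
    and "(LINT x::'a|lborel. complex_of_real (exp (- c * (norm x)\<^sup>2))) = of_real (sqrt (pi / c) ^ DIM('a))"
  using gaussian_fourier[OF c, of "0::'a"] by simp_all

subsection \<open>The symplectic Fourier transform\<close>

text \<open>The complex structure J with \<sigma>(X,Y) = J X . Y; as an isometry it transfers norm
  bounds and Gaussian integrals to the symplectic Fourier transform.\<close>

definition symp_rot :: "'d::finite phase_space \<Rightarrow> 'd phase_space" where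
  "symp_rot X = (snd X, - fst X)"

lemma symp_form_inner: "symp_form X Y = symp_rot X \<bullet> Y"
  by (simp add: symp_form_def symp_rot_def inner_prod_def)

lemma symp_form_swap: "symp_form X Y = - symp_form Y X"
  by (simp add: symp_form_def inner_commute)

lemma norm_symp_rot [simp]: "norm (symp_rot X) = norm X"
  by (simp add: symp_rot_def norm_prod_def add.commute)

lemma symp_form_rot: "symp_form X (symp_rot Y) = X \<bullet> Y"
  by (simp add: symp_form_def symp_rot_def inner_prod_def)

lemma bounded_linear_symp_rot: "bounded_linear symp_rot"
  unfolding symp_rot_def
  by (intro bounded_linear_Pair bounded_linear_snd bounded_linear_minus bounded_linear_fst)

lemma symp_form_simps:
  "symp_form (X + Y) Z = symp_form X Z + symp_form Y Z"
  "symp_form X (Y + Z) = symp_form X Y + symp_form X Z"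
  "symp_form (X - Y) Z = symp_form X Z - symp_form Y Z"
  "symp_form X (Y - Z) = symp_form X Y - symp_form X Z"
  "symp_form (- X) Z = - symp_form X Z"
  "symp_form X (- Z) = - symp_form X Z"
  "symp_form (c *\<^sub>R X) Z = c * symp_form X Z"
  "symp_form X (c *\<^sub>R Z) = c * symp_form X Z"
  "symp_form X X = 0"
  by (simp_all add: symp_form_def inner_simps algebra_simps inner_commute)

lemma abs_symp_form_le: "\<bar>symp_form X Y\<bar> \<le> norm X * norm Y"
  unfolding symp_form_inner using Cauchy_Schwarz_ineq2[of "symp_rot X" Y] by simp

lemma measurable_symp_form [measurable (raw)]:
  assumes "f \<in> borel_measurable M" "g \<in> borel_measurable M"
  shows "(\<lambda>x. symp_form (f x) (g x)) \<in> borel_measurable M"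
proof -
  have "continuous_on UNIV symp_rot"
    by (rule linear_continuous_on[OF bounded_linear_symp_rot])
  then have [measurable]: "symp_rot \<in> borel_measurable borel"
    by (rule borel_measurable_continuous_onI)
  note [measurable] = assms
  show ?thesis unfolding symp_form_inner by measurable
qed

lemma slow_symp_form:
  assumes "bounded_linear L" "bounded_linear M"
  shows "slow (\<lambda>x. of_real (symp_form (L x) (M x)))"
  unfolding symp_form_inner
  by (intro slow_inner2 bounded_linear_compose[OF bounded_linear_symp_rot] assms)

lemma slow_symp_form_right: "slow (\<lambda>Y. of_real (symp_form X Y))"
  unfolding symp_form_inner
  by (intro slow_linear bounded_linear_compose[OF bounded_linear_of_real] bounded_linear_inner_right)

lemma norm_iexp_diff_le: "norm (iexp s - iexp t) \<le> \<bar>s - t\<bar>"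
proof -
  have "iexp s - iexp t = iexp t * (iexp (s - t) - 1)"
    by (simp add: algebra_simps flip: exp_add)
  then show ?thesis
    using iexp_approx1[of "s - t" 0] by (simp add: norm_mult)
qed

text \<open>The class \<open>P\<close> is to be closed under multiplication by coordinates, up to sums of two members.\<close>

lemma rapid_by_coordinates:
  fixes h :: "'a::euclidean_space \<Rightarrow> complex"
  assumes bdd: "\<And>h. P h \<Longrightarrow> \<exists>C. \<forall>x. norm (h x) \<le> C"
    and coord: "\<And>h b. P h \<Longrightarrow> b \<in> Basis \<Longrightarrow>
      \<exists>h1 h2. P h1 \<and> P h2 \<and> (\<forall>x. \<bar>x \<bullet> b\<bar> * norm (h x) \<le> norm (h1 x) + norm (h2 x))"
    and "P h"
  shows "rapid h"
  unfolding rapid_def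
proof
  fix k
  show "\<exists>C. \<forall>x. (1 + norm x) ^ k * norm (h x) \<le> C"
    using \<open>P h\<close>
  proof (induction k arbitrary: h)
    case 0
    then show ?case using bdd by simp
  next
    case (Suc k)
    obtain h1 h2 where h: "\<And>b. b \<in> Basis \<Longrightarrow> P (h1 b)" "\<And>b. b \<in> Basis \<Longrightarrow> P (h2 b)"
      "\<And>b x. b \<in> Basis \<Longrightarrow> \<bar>x \<bullet> b\<bar> * norm (h x) \<le> norm (h1 b x) + norm (h2 b x)"
      using coord[OF Suc.prems] by metis
    obtain C where C: "\<And>x. (1 + norm x) ^ k * norm (h x) \<le> C"
      using Suc.IH[OF Suc.prems] by blast
    obtain C1 where C1: "\<And>b x. b \<in> Basis \<Longrightarrow> (1 + norm x) ^ k * norm (h1 b x) \<le> C1 b"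
      using Suc.IH[OF h(1)] by metis
    obtain C2 where C2: "\<And>b x. b \<in> Basis \<Longrightarrow> (1 + norm x) ^ k * norm (h2 b x) \<le> C2 b"
      using Suc.IH[OF h(2)] by metis
    have "(1 + norm x) ^ Suc k * norm (h x) \<le> C + (\<Sum>b\<in>Basis. C1 b + C2 b)" for x
    proof -
      \<comment> \<open>One more power of the norm is paid for by one application of
        \<open>coord\<close> in each direction.\<close>
      have "norm x * norm (h x) \<le> (\<Sum>b\<in>Basis. \<bar>x \<bullet> b\<bar>) * norm (h x)"
        by (intro mult_right_mono norm_le_l1) auto
      also have "\<dots> \<le> (\<Sum>b\<in>Basis. norm (h1 b x) + norm (h2 b x))"
        unfolding sum_distrib_right by (intro sum_mono h(3))
      finally have "(1 + norm x) ^ k * (norm x * norm (h x)) \<le>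
          (1 + norm x) ^ k * (\<Sum>b\<in>Basis. norm (h1 b x) + norm (h2 b x))"
        by (intro mult_left_mono) auto
      also have "\<dots> = (\<Sum>b\<in>Basis. (1 + norm x) ^ k * norm (h1 b x) + (1 + norm x) ^ k * norm (h2 b x))"
        by (simp add: sum_distrib_left distrib_left)
      also have "\<dots> \<le> (\<Sum>b\<in>Basis. C1 b + C2 b)"
        by (intro sum_mono add_mono C1 C2)
      finally show ?thesis using C[of x] by (simp add: algebra_simps)
    qed
    then show ?case by blast
  qed
qed

text \<open>The symplectic Fourier transform without its normalising factor, which
  \<open>symp_fourier_eq\<close> restores.\<close>

definition symp_integral :: "('d::finite phase_space \<Rightarrow> complex) \<Rightarrow> 'd phase_space \<Rightarrow> complex" where
  "symp_integral f X = (LINT Y|lborel. iexp (symp_form X Y) * f Y)"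

lemma symp_fourier_eq:
  "symp_fourier f = (\<lambda>X. complex_of_real (1 / (2 * pi) ^ CARD('d)) * symp_integral f X)"
  for f :: "'d::finite phase_space \<Rightarrow> complex"
  by (simp add: fun_eq_iff symp_fourier_def symp_integral_def)

lemma integrable_iexp_mult:
  assumes "integrable M f" "q \<in> borel_measurable M"
  shows "integrable M (\<lambda>x. iexp (q x) * f x)"
proof (rule Bochner_Integration.integrable_bound[OF assms(1)])
  note [measurable] = assms(2) borel_measurable_integrable[OF assms(1)]
  show "(\<lambda>x. iexp (q x) * f x) \<in> borel_measurable M" by measurable
qed (simp add: norm_mult)

lemma integrable_symp_integrand:
  "integrable lborel f \<Longrightarrow> integrable lborel (\<lambda>Y. iexp (symp_form X Y) * f Y)"
  by (intro integrable_iexp_mult) auto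

lemma norm_symp_integral_le: "norm (symp_integral f X) \<le> (LINT Y|lborel. norm (f Y))"
  unfolding symp_integral_def
  by (rule order_trans[OF integral_norm_bound]) (simp add: norm_mult)

lemma symp_integral_cmult: "symp_integral (\<lambda>Y. c * f Y) X = c * symp_integral f X"
  unfolding symp_integral_def by (subst integral_mult_right_zero[symmetric]) (simp add: mult.left_commute)

lemma schwartz_norm_mult_integrable:
  fixes f :: "'a::euclidean_space \<Rightarrow> complex"
  assumes "schwartz f"
  shows "integrable lborel (\<lambda>x. norm x * norm (f x))"
proof -
  obtain C where C: "C \<ge> 0" "\<And>x. norm (f x) \<le> C / (1 + norm x) ^ (1 + 2 * DIM('a))"
    using schwartz_bound[OF assms] by blast
  show ?thesis
  proof (rule Bochner_Integration.integrable_bound)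
    show "integrable lborel (\<lambda>x::'a. C * (1 / (1 + norm x) ^ (2 * DIM('a))))"
      by (rule integrable_mult_right) (rule integrable_decay)
    have "norm x * norm (f x) \<le> C * (1 / (1 + norm x) ^ (2 * DIM('a)))" for x
    proof -
      have "norm x * norm (f x) \<le> (1 + norm x) * (C / (1 + norm x) ^ (1 + 2 * DIM('a)))"
        by (intro mult_mono C) auto
      also have "\<dots> = C * (1 / (1 + norm x) ^ (2 * DIM('a)))"
        by (simp add: power_add add_nonneg_eq_0_iff)
      finally show ?thesis .
    qed
    then show "AE x in lborel. norm (norm x * norm (f x)) \<le> norm (C * (1 / (1 + norm x) ^ (2 * DIM('a))))"
      using C by (intro AE_I2) (auto intro: order_trans[OF _ abs_ge_self])
  qed (use schwartz_measurable[OF assms] in simp)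
qed

lemma symp_integral_has_derivative:
  assumes f: "schwartz f"
  shows "(symp_integral f has_derivative (\<lambda>v. symp_integral (\<lambda>Y. \<i> * of_real (symp_form v Y) * f Y) X)) (at X)"
  unfolding symp_integral_def
proof (rule has_derivative_integral[where K = "\<lambda>Y X. iexp (symp_form X Y) * f Y" and B = "\<lambda>Y. norm Y * norm (f Y)"])
  have [measurable]: "f \<in> borel_measurable borel" by (rule schwartz_measurable[OF f])
  show "((\<lambda>X. iexp (symp_form X Y) * f Y) has_derivative
      (\<lambda>v. iexp (symp_form X Y) * (\<i> * of_real (symp_form v Y) * f Y))) (at X)" for Y
  proof -
    have "bounded_linear (\<lambda>X. symp_form X Y)"
      unfolding symp_form_inner
      by (intro bounded_linear_compose[OF bounded_linear_inner_left bounded_linear_symp_rot])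
    from bounded_linear_compose[OF bounded_linear_mult_right[of \<i>]
        bounded_linear_compose[OF bounded_linear_of_real this]]
    have "((\<lambda>X. \<i> * of_real (symp_form X Y)) has_derivative (\<lambda>v. \<i> * of_real (symp_form v Y))) (at X)"
      by (rule bounded_linear_imp_has_derivative)
    from has_derivative_mult_left[OF has_derivative_compose[OF this DERIV_exp[unfolded has_field_derivative_def]], of "f Y"]
    show ?thesis by (simp add: mult.assoc)
  qed
  show "norm (iexp (symp_form (X + v) Y) * f Y - iexp (symp_form X Y) * f Y) \<le> norm Y * norm (f Y) * norm v" for Y v
  proof -
    have "norm (iexp (symp_form (X + v) Y) * f Y - iexp (symp_form X Y) * f Y) =
        norm (iexp (symp_form (X + v) Y) - iexp (symp_form X Y)) * norm (f Y)"
      by (simp add: norm_mult[symmetric] left_diff_distrib)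
    also have "\<dots> \<le> (norm v * norm Y) * norm (f Y)"
      by (intro mult_right_mono order_trans[OF norm_iexp_diff_le])
        (simp_all add: symp_form_simps abs_symp_form_le)
    finally show ?thesis by (simp add: mult_ac)
  qed
  show "norm (iexp (symp_form X Y) * (\<i> * of_real (symp_form v Y) * f Y)) \<le> norm Y * norm (f Y) * norm v" for Y v
    using mult_right_mono[OF abs_symp_form_le[of v Y], of "norm (f Y)"] by (simp add: norm_mult mult_ac)
  show "integrable lborel (\<lambda>Y. norm Y * norm (f Y))"
    by (rule schwartz_norm_mult_integrable[OF f])
  show "integrable lborel (\<lambda>Y. iexp (symp_form (X + v) Y) * f Y)" for v
    by (intro integrable_symp_integrand schwartz_integrable f)
  show "(\<lambda>Y. iexp (symp_form X Y) * (\<i> * of_real (symp_form v Y) * f Y)) \<in> borel_measurable lborel" for v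
    by measurable
qed

text \<open>Integration by parts in direction \<open>B\<close>: differentiating the phase produces
  the factor \<open>\<i> * of_real (symp_form X B)\<close>.\<close>

lemma symp_integral_mult:
  assumes f: "schwartz f"
  shows "of_real (symp_form X B) * symp_integral f X = \<i> * symp_integral (\<lambda>Y. frechet_derivative f (at Y) B) X"
proof -
  let ?e = "\<lambda>Y. iexp (symp_form X Y)"
  have e: "slow ?e"
    by (intro slow_iexp slow_symp_form_right)
  have S: "schwartz (\<lambda>Y. ?e Y * f Y)"
    by (rule schwartz_slow_mult[OF e f])
  have De: "(?e has_derivative (\<lambda>v. ?e Y * (\<i> * of_real (symp_form X v)))) (at Y)" for Y
  proof -
    have "bounded_linear (\<lambda>Y. symp_form X Y)"
      unfolding symp_form_inner by (rule bounded_linear_inner_right)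
    from bounded_linear_compose[OF bounded_linear_mult_right[of \<i>]
        bounded_linear_compose[OF bounded_linear_of_real this]]
    have "((\<lambda>Y. \<i> * of_real (symp_form X Y)) has_derivative (\<lambda>v. \<i> * of_real (symp_form X v))) (at Y)"
      by (rule bounded_linear_imp_has_derivative)
    from has_derivative_compose[OF this DERIV_exp[unfolded has_field_derivative_def]]
    show ?thesis .
  qed
  have D: "frechet_derivative (\<lambda>Y. ?e Y * f Y) (at Y) B =
      \<i> * of_real (symp_form X B) * (?e Y * f Y) + ?e Y * frechet_derivative f (at Y) B" for Y
    using frechet_derivative_eqI[OF has_derivative_mult[OF De schwartz_has_derivative[OF f]], of Y B]
    by (simp add: algebra_simps)
  have int: "integrable lborel (\<lambda>Y. ?e Y * f Y)" "integrable lborel (\<lambda>Y. ?e Y * frechet_derivative f (at Y) B)"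
    by (intro integrable_symp_integrand schwartz_integrable f schwartz_directional)+
  have "0 = (LINT Y|lborel. \<i> * of_real (symp_form X B) * (?e Y * f Y) + ?e Y * frechet_derivative f (at Y) B)"
    using integral_partial_schwartz[OF S, of B] unfolding D by simp
  also have "\<dots> = \<i> * of_real (symp_form X B) * symp_integral f X + symp_integral (\<lambda>Y. frechet_derivative f (at Y) B) X"
    unfolding symp_integral_def using int
    by (subst Bochner_Integration.integral_add) (auto simp del: times_divide_eq_left)
  finally have "\<i> * 0 = \<i> * (\<i> * of_real (symp_form X B) * symp_integral f X + symp_integral (\<lambda>Y. frechet_derivative f (at Y) B) X)"
    by simp
  then show ?thesis by (simp add: distrib_left flip: mult.assoc)
qed

text \<open>Differentiating the transform multiplies \<open>f\<close> by a linear function, and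
  multiplying the transform by a coordinate differentiates \<open>f\<close>. Both stay among the
  transforms of Schwartz functions, which gives smoothness and rapid decay.\<close>

lemma schwartz_symp_integral:
  assumes "schwartz f"
  shows "schwartz (symp_integral f)"
proof (rule schwartz_coinduct[where C = "\<lambda>h. \<exists>f. schwartz f \<and> h = symp_integral f"])
  show "\<exists>f'. schwartz f' \<and> symp_integral f = symp_integral f'" using assms by blast
  fix h :: "'a phase_space \<Rightarrow> complex" assume "\<exists>f. schwartz f \<and> h = symp_integral f"
  then obtain f where f: "schwartz f" and h: "h = symp_integral f" by blast
  show "h differentiable (at X)" for X
    using symp_integral_has_derivative[OF f] h differentiable_def by blast
  show "rapid h"
  proof (rule rapid_by_coordinates[where P = "\<lambda>h. \<exists>f. schwartz f \<and> h = symp_integral f"])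
    show "\<exists>f. schwartz f \<and> h = symp_integral f" using f h by blast
    fix h :: "'a phase_space \<Rightarrow> complex" assume "\<exists>f. schwartz f \<and> h = symp_integral f"
    then obtain f where f: "schwartz f" and h: "h = symp_integral f" by blast
    show "\<exists>C. \<forall>x. norm (h x) \<le> C"
      unfolding h using norm_symp_integral_le by blast
    fix b :: "'a phase_space"
    \<comment> \<open>The direction is rotated because \<open>symp_form X (symp_rot b)\<close> is
      the ordinary coordinate \<open>X \<bullet> b\<close>.\<close>
    let ?g = "\<lambda>Y. frechet_derivative f (at Y) (symp_rot b)"
    have "norm (of_real (X \<bullet> b) * symp_integral f X) = norm (symp_integral ?g X)" for X
      using symp_integral_mult[OF f, of X "symp_rot b"] by (simp add: symp_form_rot norm_mult)
    then have "\<bar>X \<bullet> b\<bar> * norm (h X) \<le> norm (symp_integral ?g X) + norm (symp_integral ?g X)" for X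
      by (simp add: h norm_mult)
    then show "\<exists>h1 h2. (\<exists>f. schwartz f \<and> h1 = symp_integral f) \<and> (\<exists>f. schwartz f \<and> h2 = symp_integral f) \<and>
        (\<forall>x. \<bar>x \<bullet> b\<bar> * norm (h x) \<le> norm (h1 x) + norm (h2 x))"
      using schwartz_directional[OF f] by blast
  qed
  fix b :: "'a phase_space" assume "b \<in> Basis"
  have "schwartz (\<lambda>Y. \<i> * (of_real (symp_form b Y) * f Y))"
    by (intro schwartz_cmult schwartz_slow_mult slow_symp_form_right f)
  then show "\<exists>f. schwartz f \<and> (\<lambda>x. frechet_derivative h (at x) b) = symp_integral f"
    unfolding h frechet_derivative_eqI[OF symp_integral_has_derivative[OF f]]
    by (intro exI[of _ "\<lambda>Y. \<i> * of_real (symp_form b Y) * f Y"]) (simp add: mult.assoc)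
qed

lemma schwartz_symp_fourier: "schwartz f \<Longrightarrow> schwartz (symp_fourier f)"
  unfolding symp_fourier_eq by (intro schwartz_cmult schwartz_symp_integral)

text \<open>The Gaussian factor makes the double integral absolutely convergent, so the order can be
  exchanged. The inner integral is then a Gaussian in Z - X of width s, and Z = X + s U turns it
  into an average of \<open>f\<close>. The damping constant s^2 / 4 is the one whose transform is a
  multiple of exp (- |Z - X|^2 / s^2).\<close>

lemma symp_integral_regularised:
  fixes f :: "'d::finite phase_space \<Rightarrow> complex"
  assumes f: "schwartz f" and s: "s > 0"
  shows "(LINT Y|lborel. iexp (symp_form X Y) * of_real (exp (- (s\<^sup>2 / 4) * (norm Y)\<^sup>2)) * symp_integral f Y) =
    of_real ((4 * pi) ^ CARD('d)) * (LINT U|lborel. f (X + s *\<^sub>R U) * of_real (exp (- (norm U)\<^sup>2)))"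
proof -
  let ?g = "\<lambda>Y. complex_of_real (exp (- (s\<^sup>2 / 4) * (norm Y)\<^sup>2))"
  have c: "s\<^sup>2 / 4 > 0" using s by simp
  have [measurable]: "f \<in> borel_measurable borel" by (rule schwartz_measurable[OF f])
  have int: "integrable (lborel \<Otimes>\<^sub>M lborel)
      (\<lambda>(Y, Z). iexp (symp_form X Y) * ?g Y * (iexp (symp_form Y Z) * f Z))"
  proof (rule Bochner_Integration.integrable_bound)
    show "integrable (lborel \<Otimes>\<^sub>M lborel) (\<lambda>p. ?g (fst p) * f (snd p))"
      by (intro integrable_tensor gaussian_integral c schwartz_integrable f)
    show "(\<lambda>(Y, Z). iexp (symp_form X Y) * ?g Y * (iexp (symp_form Y Z) * f Z)) \<in> borel_measurable (lborel \<Otimes>\<^sub>M lborel)"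
      by measurable
  qed (auto simp: norm_mult)
  have "(LINT Y|lborel. iexp (symp_form X Y) * ?g Y * symp_integral f Y) =
      (LINT Y|lborel. LINT Z|lborel. iexp (symp_form X Y) * ?g Y * (iexp (symp_form Y Z) * f Z))"
    by (simp add: symp_integral_def)
  also have "\<dots> = (LINT Z|lborel. LINT Y|lborel. iexp (symp_form X Y) * ?g Y * (iexp (symp_form Y Z) * f Z))"
    by (rule lborel_pair.Fubini_integral[OF int, symmetric])
  also have "\<dots> = (LINT Z|lborel. f Z * of_real (sqrt (pi / (s\<^sup>2 / 4)) ^ DIM('d phase_space) *
      exp (- (norm (Z - X))\<^sup>2 / s\<^sup>2)))"
  proof (rule Bochner_Integration.integral_cong[OF refl])
    fix Z
    have "iexp (symp_form X Y) * ?g Y * (iexp (symp_form Y Z) * f Z) =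
        f Z * (iexp (symp_rot (X - Z) \<bullet> Y) * ?g Y)" for Y
      unfolding symp_form_inner[symmetric] symp_form_swap[of Y Z]
      by (simp add: symp_form_simps algebra_simps flip: exp_add)
    then have "(LINT Y|lborel. iexp (symp_form X Y) * ?g Y * (iexp (symp_form Y Z) * f Z)) =
        f Z * (LINT Y|lborel. iexp (symp_rot (X - Z) \<bullet> Y) * ?g Y)"
      by (simp only: integral_mult_right_zero)
    then show "(LINT Y|lborel. iexp (symp_form X Y) * ?g Y * (iexp (symp_form Y Z) * f Z)) =
        f Z * of_real (sqrt (pi / (s\<^sup>2 / 4)) ^ DIM('d phase_space) * exp (- (norm (Z - X))\<^sup>2 / s\<^sup>2))"
      using gaussian_fourier(2)[OF c, of "symp_rot (X - Z)"] by (simp add: norm_minus_commute)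
  qed
  also have "\<dots> = of_real (s ^ DIM('d phase_space)) * (LINT U|lborel. f (X + s *\<^sub>R U) *
      of_real (sqrt (pi / (s\<^sup>2 / 4)) ^ DIM('d phase_space) * exp (- (norm U)\<^sup>2)))"
    using lborel_integral_affine[of s "\<lambda>Z. f Z * of_real (sqrt (pi / (s\<^sup>2 / 4)) ^ DIM('d phase_space) *
      exp (- (norm (Z - X))\<^sup>2 / s\<^sup>2))" X] s
    by (simp add: power_mult_distrib)
  also have "\<dots> = of_real ((s * sqrt (pi / (s\<^sup>2 / 4))) ^ DIM('d phase_space)) *
      (LINT U|lborel. f (X + s *\<^sub>R U) * of_real (exp (- (norm U)\<^sup>2)))"
  proof -
    let ?A = "sqrt (pi / (s\<^sup>2 / 4)) ^ DIM('d phase_space)"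
    have "(LINT U|lborel. f (X + s *\<^sub>R U) * of_real (?A * exp (- (norm U)\<^sup>2))) =
        (LINT U|lborel. of_real ?A * (f (X + s *\<^sub>R U) * of_real (exp (- (norm U)\<^sup>2))))"
      by (simp only: of_real_mult mult_ac)
    also have "\<dots> = of_real ?A * (LINT U|lborel. f (X + s *\<^sub>R U) * of_real (exp (- (norm U)\<^sup>2)))"
      by (rule integral_mult_right_zero)
    finally show ?thesis by (simp only: power_mult_distrib of_real_mult mult.assoc)
  qed
  also have "s * sqrt (pi / (s\<^sup>2 / 4)) = 2 * sqrt pi"
    using s by (simp add: real_sqrt_divide real_sqrt_mult)
  also have "(2 * sqrt pi) ^ DIM('d phase_space) = (4 * pi) ^ CARD('d)"
    by (simp add: power_mult power_mult_distrib flip: mult_2)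
  finally show ?thesis .
qed

text \<open>Let s tend to 0 on both sides of \<open>symp_integral_regularised\<close>. The constant
  is (4 pi)^d from there times the Gaussian integral pi^d. Antisymmetry of \<open>symp_form\<close>
  is the reason why applying the transform twice returns \<open>f\<close> and not its
  reflection.\<close>

lemma symp_integral_involution:
  fixes f :: "'d::finite phase_space \<Rightarrow> complex"
  assumes f: "schwartz f"
  shows "symp_integral (symp_integral f) X = of_real ((2 * pi) ^ (2 * CARD('d))) * f X"
proof -
  define s where "s n = inverse (real (Suc n))" for n
  have s: "s n > 0" "s \<longlonglongrightarrow> 0" for n
    unfolding s_def using LIMSEQ_inverse_real_of_nat by auto
  have [measurable]: "f \<in> borel_measurable borel" by (rule schwartz_measurable[OF f])
  have [measurable]: "symp_integral f \<in> borel_measurable borel"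
    by (rule schwartz_measurable[OF schwartz_symp_integral[OF f]])
  have "(\<lambda>n. LINT Y|lborel. iexp (symp_form X Y) * of_real (exp (- ((s n)\<^sup>2 / 4) * (norm Y)\<^sup>2)) * symp_integral f Y)
      \<longlonglongrightarrow> (LINT Y|lborel. iexp (symp_form X Y) * symp_integral f Y)"
  proof (rule integral_dominated_convergence[where w = "\<lambda>Y. norm (symp_integral f Y)"])
    show "integrable lborel (\<lambda>Y. norm (symp_integral f Y))"
      by (intro integrable_norm schwartz_integrable schwartz_symp_integral f)
    show "AE Y in lborel. (\<lambda>n. iexp (symp_form X Y) * of_real (exp (- ((s n)\<^sup>2 / 4) * (norm Y)\<^sup>2)) * symp_integral f Y)
        \<longlonglongrightarrow> iexp (symp_form X Y) * symp_integral f Y"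
    proof (rule AE_I2)
      fix Y
      have "(\<lambda>n. iexp (symp_form X Y) * of_real (exp (- ((s n)\<^sup>2 / 4) * (norm Y)\<^sup>2)) * symp_integral f Y)
        \<longlonglongrightarrow> iexp (symp_form X Y) * of_real (exp (- (0\<^sup>2 / 4) * (norm Y)\<^sup>2)) * symp_integral f Y"
        by (intro tendsto_intros s) auto
      then show "(\<lambda>n. iexp (symp_form X Y) * of_real (exp (- ((s n)\<^sup>2 / 4) * (norm Y)\<^sup>2)) * symp_integral f Y)
        \<longlonglongrightarrow> iexp (symp_form X Y) * symp_integral f Y" by simp
    qed
    show "AE Y in lborel. norm (iexp (symp_form X Y) * of_real (exp (- ((s n)\<^sup>2 / 4) * (norm Y)\<^sup>2)) * symp_integral f Y)
        \<le> norm (symp_integral f Y)" for n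
      by (intro AE_I2) (simp add: norm_mult mult_left_le_one_le)
  qed measurable
  moreover have "(\<lambda>n. of_real ((4 * pi) ^ CARD('d)) * (LINT U|lborel. f (X + s n *\<^sub>R U) * of_real (exp (- (norm U)\<^sup>2))))
      \<longlonglongrightarrow> of_real ((4 * pi) ^ CARD('d)) * (LINT U|lborel. f X * of_real (exp (- (norm (U :: 'd phase_space))\<^sup>2)))"
  proof (intro tendsto_mult tendsto_const)
    obtain M where M: "M \<ge> 0" "\<And>X. norm (f X) \<le> M" using schwartz_bound[OF f, of 0] by auto
    show "(\<lambda>n. LINT U|lborel. f (X + s n *\<^sub>R U) * of_real (exp (- (norm U)\<^sup>2)))
      \<longlonglongrightarrow> (LINT U|lborel. f X * of_real (exp (- (norm (U :: 'd phase_space))\<^sup>2)))"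
    proof (rule integral_dominated_convergence[where w = "\<lambda>U. M * norm (complex_of_real (exp (- 1 * (norm U)\<^sup>2)))"])
      show "integrable lborel (\<lambda>U :: 'd phase_space. M * norm (complex_of_real (exp (- 1 * (norm U)\<^sup>2))))"
        by (intro integrable_mult_right integrable_norm gaussian_integral) simp
      show "AE U in lborel. (\<lambda>n. f (X + s n *\<^sub>R U) * of_real (exp (- (norm U)\<^sup>2)))
        \<longlonglongrightarrow> f X * of_real (exp (- (norm (U :: 'd phase_space))\<^sup>2))"
      proof (intro AE_I2 tendsto_mult tendsto_const)
        fix U :: "'d phase_space"
        have "(\<lambda>n. X + s n *\<^sub>R U) \<longlonglongrightarrow> X + 0 *\<^sub>R U"
          by (intro tendsto_intros s)
        moreover have "isCont f X"
          using schwartz_differentiable[OF f] differentiable_imp_continuous_within by blast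
        ultimately show "(\<lambda>n. f (X + s n *\<^sub>R U)) \<longlonglongrightarrow> f X"
          using isCont_tendsto_compose[of X f] by simp
      qed
      show "AE U in lborel. norm (f (X + s n *\<^sub>R U) * of_real (exp (- (norm U)\<^sup>2)))
          \<le> M * norm (complex_of_real (exp (- 1 * (norm U)\<^sup>2)))" for n
        by (intro AE_I2) (simp add: norm_mult mult_right_mono M)
    qed measurable
  qed
  ultimately have "(LINT Y|lborel. iexp (symp_form X Y) * symp_integral f Y) =
      of_real ((4 * pi) ^ CARD('d)) * (LINT U|lborel. f X * of_real (exp (- (norm (U :: 'd phase_space))\<^sup>2)))"
    unfolding symp_integral_regularised[OF f s(1)] by (rule LIMSEQ_unique)
  also have "\<dots> = of_real ((4 * pi) ^ CARD('d) * sqrt pi ^ DIM('d phase_space)) * f X"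
    using gaussian_integral(2)[of 1, where 'a = "'d phase_space"] by simp
  also have "(4 * pi) ^ CARD('d) * sqrt pi ^ DIM('d phase_space) = (2 * pi) ^ (2 * CARD('d))"
    by (simp add: power_mult power_mult_distrib power2_eq_square flip: mult_2)
  finally show ?thesis by (simp add: symp_integral_def)
qed

lemma symp_fourier_involution:
  assumes f: "schwartz f"
  shows "symp_fourier (symp_fourier f) = f"
  unfolding symp_fourier_eq symp_integral_cmult symp_integral_involution[OF f] mult_2 power_add
  by (simp add: fun_eq_iff del: power_mult_distrib)

subsection \<open>Gaussian Schwartz functions\<close>

text \<open>From (1 + s/j)^j <= exp s at s = c t; the division by j is why j = 0 is
  separate.\<close>

lemma power_le_exp:
  fixes c :: real
  assumes "c > 0"
  shows "\<exists>K. \<forall>t\<ge>0. t ^ j \<le> K * exp (c * t)"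
proof (cases "j = 0")
  case True
  then show ?thesis using assms by (intro exI[of _ 1]) simp
next
  case False
  have "t ^ j \<le> (real j / c) ^ j * exp (c * t)" if t: "t \<ge> 0" for t
  proof -
    have "t ^ j = (real j / c) ^ j * (c * t / real j) ^ j"
      using False assms by (simp add: power_mult_distrib[symmetric])
    also have "(c * t / real j) ^ j \<le> (1 + c * t / real j) ^ j"
      using t assms by (intro power_mono) auto
    also have "\<dots> \<le> exp (c * t)"
      using False t assms by (intro exp_ge_one_plus_x_over_n_power_n) (auto intro: order_trans[of _ 0])
    finally show ?thesis using assms by (simp add: mult_left_mono)
  qed
  then show ?thesis by blast
qed

lemma gaussian_rapid:
  fixes c :: real
  assumes c: "c > 0"
  shows "\<exists>C. \<forall>x::'a::euclidean_space. (1 + norm x) ^ k * exp (- c * (norm x)\<^sup>2) \<le> C"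
proof -
  obtain K where K: "\<And>t. t \<ge> 0 \<Longrightarrow> t ^ k \<le> K * exp (c * t)"
    using power_le_exp[OF c, of k] by blast
  have "(1 + norm x) ^ k * exp (- c * (norm x)\<^sup>2) \<le> 2 ^ k * K * exp c" for x :: 'a
  proof -
    \<comment> \<open>Passes from powers of 1 + |x| to powers of t = 1 + |x|^2, which
      \<open>power_le_exp\<close> bounds by exp (c t).\<close>
    have "1 + norm x \<le> 2 * (1 + (norm x)\<^sup>2)"
      using zero_le_power2[of "norm x - 1"] zero_le_power2[of "norm x"] unfolding power2_diff power_one by argo
    then have "(1 + norm x) ^ k \<le> (2 * (1 + (norm x)\<^sup>2)) ^ k"
      by (intro power_mono) auto
    also have "\<dots> \<le> 2 ^ k * (K * exp (c * (1 + (norm x)\<^sup>2)))"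
      unfolding power_mult_distrib by (intro mult_left_mono K) auto
    also have "\<dots> = (2 ^ k * K * exp c) / exp (- c * (norm x)\<^sup>2)"
      by (simp add: exp_minus field_simps exp_add)
    finally show ?thesis by (simp add: pos_le_divide_eq)
  qed
  then show ?thesis by blast
qed

lemma schwartz_gaussian:
  fixes c :: real
  assumes "c > 0"
  shows "schwartz (\<lambda>x::'a::euclidean_space. complex_of_real (exp (- c * (norm x)\<^sup>2)))"
proof -
  have "slow (\<lambda>x::'a. of_real (- c) * complex_of_real (x \<bullet> x))"
    by (intro slow_mult slow_const slow_inner2 bounded_linear_ident)
  then have "schwartz (\<lambda>x::'a. exp (of_real (- c) * complex_of_real (x \<bullet> x)))"
    by (rule schwartz_exp) (use gaussian_rapid[OF assms] in \<open>simp add: power2_norm_eq_inner\<close>)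
  then show ?thesis by (simp add: power2_norm_eq_inner flip: exp_of_real)
qed

text \<open>As \<open>k\<close> tends to infinity these functions tend to the indicator function of a box off its boundary.\<close>

lemma schwartz_box_function:
  fixes r :: "'a::euclidean_space \<Rightarrow> real"
  assumes r: "\<And>i. i \<in> Basis \<Longrightarrow> r i > 0"
  shows "\<exists>C c. c > 0 \<and> (\<forall>x k. exp (- (\<Sum>i\<in>Basis. (x \<bullet> i / r i) ^ (2 * Suc k))) \<le> C * exp (- c * (norm x)\<^sup>2))"
    and "schwartz (\<lambda>x. complex_of_real (exp (- (\<Sum>i\<in>Basis. (x \<bullet> i / r i) ^ (2 * Suc k)))))"
proof -
  define R where "R = (\<Sum>i\<in>Basis. r i)"
  have R: "r i \<le> R" if "i \<in> Basis" for i
    unfolding R_def using r less_imp_le by (intro member_le_sum that) auto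
  have R0: "R > 0" unfolding R_def by (intro sum_pos r) auto
  \<comment> \<open>Uniformity in \<open>k\<close> comes from t - 1 <= t^(k+1) for t >= 0: each even
    power exceeds its square minus 1. The sum \<open>R\<close> of all half-widths replaces each
    \<open>r i\<close>, and the lost units add up to the dimension, hence the factor
    \<open>exp (real DIM('a))\<close>.\<close>
  have bound: "exp (- (\<Sum>i\<in>Basis. (x \<bullet> i / r i) ^ (2 * Suc k))) \<le> exp (real DIM('a)) * exp (- (1 / R\<^sup>2) * (norm x)\<^sup>2)" for x k
  proof -
    have "(x \<bullet> i)\<^sup>2 / R\<^sup>2 - 1 \<le> (x \<bullet> i / r i) ^ (2 * Suc k)" if i: "i \<in> Basis" for i
    proof -
      define t where "t = (x \<bullet> i / r i)\<^sup>2"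
      have "(x \<bullet> i)\<^sup>2 / R\<^sup>2 \<le> t"
        unfolding t_def power_divide using r[OF i] R[OF i]
        by (intro divide_left_mono power_mono mult_pos_pos) auto
      moreover have "t - 1 \<le> t ^ Suc k"
      proof (cases "t \<ge> 1")
        case True
        then have "t ^ 1 \<le> t ^ Suc k" by (intro power_increasing) auto
        then show ?thesis by simp
      next
        case False
        moreover have "0 \<le> t ^ Suc k" by (simp add: t_def)
        ultimately show ?thesis by linarith
      qed
      ultimately show ?thesis unfolding t_def power_mult by linarith
    qed
    then have "(\<Sum>i\<in>Basis. (x \<bullet> i)\<^sup>2 / R\<^sup>2 - 1) \<le> (\<Sum>i\<in>Basis. (x \<bullet> i / r i) ^ (2 * Suc k))"
      by (rule sum_mono)
    moreover have "(\<Sum>i\<in>Basis. (x \<bullet> i)\<^sup>2 / R\<^sup>2 - 1) = (1 / R\<^sup>2) * (norm x)\<^sup>2 - real DIM('a)"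
      by (subst power2_norm_eq_inner, subst (2) euclidean_inner)
        (simp add: sum_subtractf sum_divide_distrib power2_eq_square)
    ultimately show ?thesis by (simp flip: exp_add)
  qed
  then show "\<exists>C c. c > 0 \<and> (\<forall>x k. exp (- (\<Sum>i\<in>Basis. (x \<bullet> i / r i) ^ (2 * Suc k))) \<le> C * exp (- c * (norm x)\<^sup>2))"
    using R0 by (intro exI[of _ "exp (real DIM('a))"] exI[of _ "1 / R\<^sup>2"]) auto
  have "schwartz (\<lambda>x. exp (\<Sum>i\<in>Basis. - 1 * (of_real (x \<bullet> (i /\<^sub>R r i)) :: complex) ^ (2 * Suc k)))"
  proof (rule schwartz_exp)
    show "slow (\<lambda>x. \<Sum>i\<in>Basis. - 1 * (of_real (x \<bullet> (i /\<^sub>R r i)) :: complex) ^ (2 * Suc k))"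
      by (intro slow_sum slow_mult slow_const slow_power slow_inner bounded_linear_ident)
    fix j
    obtain C where C: "\<And>x::'a. (1 + norm x) ^ j * exp (- (1 / R\<^sup>2) * (norm x)\<^sup>2) \<le> C"
      using gaussian_rapid[of "1 / R\<^sup>2" j] R0 by auto
    have "(1 + norm x) ^ j * exp (- (\<Sum>i\<in>Basis. (x \<bullet> i / r i) ^ (2 * Suc k))) \<le> exp (real DIM('a)) * C" for x
    proof -
      have "(1 + norm x) ^ j * exp (- (\<Sum>i\<in>Basis. (x \<bullet> i / r i) ^ (2 * Suc k))) \<le>
          (1 + norm x) ^ j * (exp (real DIM('a)) * exp (- (1 / R\<^sup>2) * (norm x)\<^sup>2))"
        by (intro mult_left_mono bound) auto
      also have "\<dots> \<le> exp (real DIM('a)) * C"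
        using mult_left_mono[OF C[of x], of "exp (real DIM('a))"] by (simp add: mult_ac)
      finally show ?thesis .
    qed
    moreover have "Re (\<Sum>i\<in>Basis. - 1 * (of_real (x \<bullet> (i /\<^sub>R r i)) :: complex) ^ (2 * Suc k)) =
        - (\<Sum>i\<in>Basis. (x \<bullet> i / r i) ^ (2 * Suc k))" for x
      by (simp add: sum_negf divide_inverse mult.commute flip: of_real_power of_real_mult power_Suc)
    ultimately show "\<exists>C. \<forall>x. (1 + norm x) ^ j *
        exp (Re (\<Sum>i\<in>Basis. - 1 * (of_real (x \<bullet> (i /\<^sub>R r i)) :: complex) ^ (2 * Suc k))) \<le> C"
      by auto
  qed
  moreover have "(\<Sum>i\<in>Basis. - 1 * (of_real (x \<bullet> (i /\<^sub>R r i)) :: complex) ^ (2 * Suc k)) =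
        of_real (- (\<Sum>i\<in>Basis. (x \<bullet> i / r i) ^ (2 * Suc k)))" for x
    by (simp add: sum_negf divide_inverse mult.commute)
  ultimately show "schwartz (\<lambda>x. complex_of_real (exp (- (\<Sum>i\<in>Basis. (x \<bullet> i / r i) ^ (2 * Suc k)))))"
    by (simp only: exp_of_real)
qed

subsection \<open>Density of the Schwartz functions\<close>

lemma schwartz_square_integrable:
  assumes f: "schwartz f"
  shows "square_integrable f"
proof -
  obtain M where M: "M \<ge> 0" "\<And>x. norm (f x) \<le> M" using schwartz_bound[OF f, of 0] by auto
  have [measurable]: "f \<in> borel_measurable borel" by (rule schwartz_measurable[OF f])
  have "integrable lborel (\<lambda>x. (norm (f x))\<^sup>2)"
  proof (rule Bochner_Integration.integrable_bound)
    show "integrable lborel (\<lambda>x. M * norm (f x))"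
      by (intro integrable_mult_right integrable_norm schwartz_integrable f)
    show "AE x in lborel. norm ((norm (f x))\<^sup>2) \<le> norm (M * norm (f x))"
      by (intro AE_I2) (simp add: power2_eq_square mult_right_mono M)
  qed simp
  then show ?thesis by (simp add: square_integrable_def)
qed

lemma square_integrable_lincomb:
  "square_integrable f \<Longrightarrow> square_integrable g \<Longrightarrow> square_integrable (\<lambda>x. c * f x + g x)"
  by (intro square_integrable_add square_integrable_mult)

lemma square_integrable_diff:
  "square_integrable f \<Longrightarrow> square_integrable g \<Longrightarrow> square_integrable (\<lambda>x. f x - g x)"
  using square_integrable_lincomb[of g f "-1"] by simp

lemma square_integrable_norm: "square_integrable f \<Longrightarrow> integrable lborel (\<lambda>x. (norm (f x))\<^sup>2)"
  by (simp add: square_integrable_def)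

lemma square_integrable_bound:
  assumes "square_integrable w" "f \<in> borel_measurable borel" "AE x in lborel. norm (f x) \<le> norm (w x)"
  shows "square_integrable f"
  unfolding square_integrable_def
proof
  show "f \<in> borel_measurable lborel" using assms by simp
  show "integrable lborel (\<lambda>x. (norm (f x))\<^sup>2)"
  proof (rule Bochner_Integration.integrable_bound[OF square_integrable_norm[OF assms(1)]])
    show "(\<lambda>x. (norm (f x))\<^sup>2) \<in> borel_measurable lborel" using assms(2) by simp
    show "AE x in lborel. norm ((norm (f x))\<^sup>2) \<le> norm ((norm (w x))\<^sup>2)"
      using assms(3) by eventually_elim (simp add: power_mono)
  qed
qed

lemma norm_add_sq_le: "(norm (a + b))\<^sup>2 \<le> 2 * (norm a)\<^sup>2 + 2 * (norm b)\<^sup>2" for a b :: complex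
proof -
  have "(norm (a + b))\<^sup>2 \<le> (norm a + norm b)\<^sup>2"
    by (simp add: norm_triangle_ineq power_mono)
  also have "\<dots> \<le> 2 * (norm a)\<^sup>2 + 2 * (norm b)\<^sup>2"
    using zero_le_power2[of "norm a - norm b"]
    by (simp add: power2_eq_square algebra_simps)
  finally show ?thesis .
qed

lemma integral_norm_add_sq_le:
  assumes "square_integrable f" "square_integrable g"
  shows "(LINT x|lborel. (norm (f x + g x))\<^sup>2) \<le>
    2 * (LINT x|lborel. (norm (f x))\<^sup>2) + 2 * (LINT x|lborel. (norm (g x))\<^sup>2)"
proof -
  have "(LINT x|lborel. (norm (f x + g x))\<^sup>2) \<le> (LINT x|lborel. 2 * (norm (f x))\<^sup>2 + 2 * (norm (g x))\<^sup>2)"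
    using assms square_integrable_add[OF assms]
    by (intro integral_mono norm_add_sq_le Bochner_Integration.integrable_add integrable_mult_right square_integrable_norm)
  also have "\<dots> = 2 * (LINT x|lborel. (norm (f x))\<^sup>2) + 2 * (LINT x|lborel. (norm (g x))\<^sup>2)"
    using assms by (simp add: square_integrable_norm)
  finally show ?thesis .
qed

text \<open>Stated with the squared distance of representatives, so that dominated convergence
  applies directly; the role of the triangle inequality falls to
  \<open>integral_norm_add_sq_le\<close>, with its factors 2.\<close>

definition schwartz_approx :: "('a::euclidean_space \<Rightarrow> complex) \<Rightarrow> bool" where
  "schwartz_approx f \<longleftrightarrow> square_integrable f \<and>
     (\<forall>e>0. \<exists>\<psi>. schwartz \<psi> \<and> (LINT x|lborel. (norm (f x - \<psi> x))\<^sup>2) < e)"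

lemma schwartz_approx_schwartz: "schwartz f \<Longrightarrow> schwartz_approx f"
  unfolding schwartz_approx_def by (auto intro!: schwartz_square_integrable exI[of _ f])

lemma schwartz_approx_limit:
  assumes f: "square_integrable f"
    and g: "\<And>e. e > 0 \<Longrightarrow> \<exists>g. schwartz_approx g \<and> (LINT x|lborel. (norm (f x - g x))\<^sup>2) < e"
  shows "schwartz_approx f"
  unfolding schwartz_approx_def
proof (intro conjI allI impI f)
  fix e :: real assume "e > 0"
  then obtain g where g: "schwartz_approx g" "(LINT x|lborel. (norm (f x - g x))\<^sup>2) < e / 4"
    using g[of "e / 4"] by auto
  then obtain \<psi> where \<psi>: "schwartz \<psi>" "(LINT x|lborel. (norm (g x - \<psi> x))\<^sup>2) < e / 4"
    using \<open>e > 0\<close> unfolding schwartz_approx_def by (meson divide_pos_pos zero_less_numeral)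
  have "square_integrable g" using g(1) by (simp add: schwartz_approx_def)
  then have "(LINT x|lborel. (norm ((f x - g x) + (g x - \<psi> x)))\<^sup>2) \<le>
      2 * (LINT x|lborel. (norm (f x - g x))\<^sup>2) + 2 * (LINT x|lborel. (norm (g x - \<psi> x))\<^sup>2)"
    using f \<psi>(1) by (intro integral_norm_add_sq_le) (auto intro: square_integrable_diff schwartz_square_integrable)
  then have "(LINT x|lborel. (norm (f x - \<psi> x))\<^sup>2) < e"
    using g(2) \<psi>(2) by simp
  with \<psi>(1) show "\<exists>\<psi>. schwartz \<psi> \<and> (LINT x|lborel. (norm (f x - \<psi> x))\<^sup>2) < e" by blast
qed

lemma schwartz_approx_lincomb:
  assumes f: "schwartz_approx f" and g: "schwartz_approx g"
  shows "schwartz_approx (\<lambda>x. c * f x + g x)"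
  unfolding schwartz_approx_def
proof (intro conjI allI impI)
  have fg: "square_integrable f" "square_integrable g"
    using f g by (auto simp: schwartz_approx_def)
  then show "square_integrable (\<lambda>x. c * f x + g x)" by (rule square_integrable_lincomb)
  fix e :: real assume e: "e > 0"
  \<comment> \<open>Chosen so that \<open>4 * (1 + (norm c)\<^sup>2) * e' = e\<close>, twice what
    the two errors need.\<close>
  define e' where "e' = e / (4 * (1 + (norm c)\<^sup>2))"
  have n0: "1 + (norm c)\<^sup>2 > 0" by (simp add: add_pos_nonneg)
  then have ee: "e' * (4 * (1 + (norm c)\<^sup>2)) = e" unfolding e'_def by (subst times_divide_eq_left, subst nonzero_mult_div_cancel_right) auto
  have e': "e' > 0"
    using e n0 by (simp add: e'_def)
  have e'_le: "4 * e' + 4 * (norm c)\<^sup>2 * e' \<le> e"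
    using ee by (simp add: algebra_simps)
  obtain \<psi> where \<psi>: "schwartz \<psi>" "(LINT x|lborel. (norm (f x - \<psi> x))\<^sup>2) < e'"
    using f e' by (auto simp: schwartz_approx_def)
  obtain \<theta> where \<theta>: "schwartz \<theta>" "(LINT x|lborel. (norm (g x - \<theta> x))\<^sup>2) < e'"
    using g e' by (auto simp: schwartz_approx_def)
  have "(LINT x|lborel. (norm (c * (f x - \<psi> x) + (g x - \<theta> x)))\<^sup>2) \<le>
      2 * (LINT x|lborel. (norm (c * (f x - \<psi> x)))\<^sup>2) + 2 * (LINT x|lborel. (norm (g x - \<theta> x))\<^sup>2)"
    using fg \<psi>(1) \<theta>(1)
    by (intro integral_norm_add_sq_le square_integrable_mult square_integrable_diff)
      (auto intro: schwartz_square_integrable)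
  also have "(LINT x|lborel. (norm (c * (f x - \<psi> x)))\<^sup>2) = (norm c)\<^sup>2 * (LINT x|lborel. (norm (f x - \<psi> x))\<^sup>2)"
    by (simp add: norm_mult power_mult_distrib)
  also have "2 * ((norm c)\<^sup>2 * (LINT x|lborel. (norm (f x - \<psi> x))\<^sup>2)) + 2 * (LINT x|lborel. (norm (g x - \<theta> x))\<^sup>2)
      \<le> 2 * ((norm c)\<^sup>2 * e') + 2 * e'"
    using \<psi>(2) \<theta>(2) by (intro add_mono mult_left_mono) auto
  also have "\<dots> < 4 * e' + 4 * (norm c)\<^sup>2 * e'"
    using e' by (simp add: algebra_simps add_pos_nonneg)
  finally have "(LINT x|lborel. (norm (c * f x + g x - (c * \<psi> x + \<theta> x)))\<^sup>2) < e"
    using e'_le by (simp add: algebra_simps)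
  then show "\<exists>\<psi>. schwartz \<psi> \<and> (LINT x|lborel. (norm (c * f x + g x - \<psi> x))\<^sup>2) < e"
    using schwartz_lincomb[OF \<psi>(1) \<theta>(1)] by blast
qed

lemma schwartz_approx_zero: "schwartz_approx (\<lambda>_. 0)"
  by (rule schwartz_approx_schwartz[OF schwartz_zero])

lemma schwartz_approx_sum:
  "(\<And>i. i \<in> A \<Longrightarrow> schwartz_approx (f i)) \<Longrightarrow> schwartz_approx (\<lambda>x. \<Sum>i\<in>A. c i * f i x)"
  by (induction A rule: infinite_finite_induct)
    (auto intro: schwartz_approx_zero schwartz_approx_lincomb)

lemma integral_sq_dominated_limit:
  fixes f :: "'a::euclidean_space \<Rightarrow> complex"
  assumes w: "square_integrable w" and [measurable]: "f \<in> borel_measurable borel" "\<And>n. g n \<in> borel_measurable borel"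
    and lim: "AE x in lborel. (\<lambda>n. g n x) \<longlonglongrightarrow> f x"
    and dom: "\<And>n. AE x in lborel. norm (g n x) \<le> norm (w x)"
    and dom': "AE x in lborel. norm (f x) \<le> norm (w x)"
  shows "(\<lambda>n. LINT x|lborel. (norm (f x - g n x))\<^sup>2) \<longlonglongrightarrow> 0"
proof -
  have "(\<lambda>n. LINT x|lborel. (norm (f x - g n x))\<^sup>2) \<longlonglongrightarrow> (LINT x|(lborel :: 'a measure). 0)"
  proof (rule integral_dominated_convergence[where w = "\<lambda>x. 4 * (norm (w x))\<^sup>2"])
    show "integrable lborel (\<lambda>x. 4 * (norm (w x))\<^sup>2)"
      by (intro integrable_mult_right square_integrable_norm w)
    show "AE x in lborel. (\<lambda>n. (norm (f x - g n x))\<^sup>2) \<longlonglongrightarrow> 0"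
      using lim
    proof eventually_elim
      case (elim x)
      have "(\<lambda>n. (norm (f x - g n x))\<^sup>2) \<longlonglongrightarrow> (norm (f x - f x))\<^sup>2"
        by (intro tendsto_intros elim)
      then show ?case by simp
    qed
    show "AE x in lborel. norm ((norm (f x - g n x))\<^sup>2) \<le> 4 * (norm (w x))\<^sup>2" for n
      using dom[of n] dom'
    proof eventually_elim
      case (elim x)
      have "norm (f x - g n x) \<le> 2 * norm (w x)"
        using norm_triangle_ineq4[of "f x" "g n x"] elim by simp
      then have "(norm (f x - g n x))\<^sup>2 \<le> (2 * norm (w x))\<^sup>2" by (intro power_mono) auto
      then show ?case by (simp add: power_mult_distrib)
    qed
  qed measurable
  then show ?thesis by simp
qed

lemma schwartz_approx_dominated:
  assumes w: "square_integrable w" and f: "f \<in> borel_measurable borel"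
    and g: "\<And>n. schwartz_approx (g n)"
    and lim: "AE x in lborel. (\<lambda>n. g n x) \<longlonglongrightarrow> f x"
    and dom: "\<And>n. AE x in lborel. norm (g n x) \<le> norm (w x)"
    and dom': "AE x in lborel. norm (f x) \<le> norm (w x)"
  shows "schwartz_approx f"
proof (rule schwartz_approx_limit)
  show "square_integrable f" by (rule square_integrable_bound[OF w f dom'])
  have m: "g n \<in> borel_measurable borel" for n
    using g[of n] by (simp add: schwartz_approx_def square_integrable_def)
  fix e :: real assume "e > 0"
  then have "\<forall>\<^sub>F n in sequentially. (LINT x|lborel. (norm (f x - g n x))\<^sup>2) < e"
    using order_tendstoD(2)[OF integral_sq_dominated_limit[OF w f m lim dom dom']] by blast
  then obtain n where "(LINT x|lborel. (norm (f x - g n x))\<^sup>2) < e"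
    by (auto simp: eventually_sequentially)
  then show "\<exists>g. schwartz_approx g \<and> (LINT x|lborel. (norm (f x - g x))\<^sup>2) < e"
    using g by blast
qed

text \<open>In coordinates rescaled by the centre \<open>m\<close> and the half-widths
  \<open>r\<close>, the powers tend to 0 inside the box and one of them tends to infinity outside
  its closure; the boundary is a null set. The Gaussian bound of
  \<open>schwartz_box_function\<close>, uniform in \<open>k\<close>, dominates.\<close>

lemma schwartz_approx_box:
  fixes a b :: "'a::euclidean_space"
  shows "schwartz_approx (indicator (box a b))"
proof (cases "box a b = {}")
  case True
  then show ?thesis using schwartz_approx_zero by (simp add: indicator_def[abs_def])
next
  case False
  then have ab: "a \<bullet> i < b \<bullet> i" if "i \<in> Basis" for i
    using that by (simp add: box_ne_empty)
  define m where "m = (1/2) *\<^sub>R (a + b)"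
  define r where "r i = (b \<bullet> i - a \<bullet> i) / 2" for i
  have r: "r i > 0" if "i \<in> Basis" for i using ab[OF that] by (simp add: r_def)
  have t: "\<bar>(x - m) \<bullet> i / r i\<bar> < 1 \<longleftrightarrow> a \<bullet> i < x \<bullet> i \<and> x \<bullet> i < b \<bullet> i"
    "\<bar>(x - m) \<bullet> i / r i\<bar> \<le> 1 \<longleftrightarrow> a \<bullet> i \<le> x \<bullet> i \<and> x \<bullet> i \<le> b \<bullet> i" if "i \<in> Basis" for x i
    using r[OF that] by (auto simp: m_def r_def inner_simps abs_less_iff abs_le_iff field_simps)
  obtain C c where c: "c > 0" and C: "\<And>x k. exp (- (\<Sum>i\<in>Basis. (x \<bullet> i / r i) ^ (2 * Suc k))) \<le> C * exp (- c * (norm x)\<^sup>2)"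
    using schwartz_box_function(1)[of r] r by blast
  have "C \<ge> 1 * exp 0" using C[of 0 0] by simp
  then have C1: "C \<ge> 1" by simp
  define g where "g k x = complex_of_real (exp (- (\<Sum>i\<in>Basis. ((x - m) \<bullet> i / r i) ^ (2 * Suc k))))" for k x
  have lim: "(\<lambda>k. g k x) \<longlonglongrightarrow> indicator (box a b) x" if x: "x \<notin> cbox a b - box a b" for x
  proof (cases "x \<in> box a b")
    case True
    have "(\<lambda>k. ((x - m) \<bullet> i / r i) ^ (2 * Suc k)) \<longlonglongrightarrow> 0" if "i \<in> Basis" for i
    proof -
      have "\<bar>(x - m) \<bullet> i / r i\<bar> < 1" using t[OF that] True that by (simp add: mem_box)
      then have "norm (((x - m) \<bullet> i / r i)\<^sup>2) < 1"
        by (simp add: abs_square_less_1 del: abs_divide)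
      from LIMSEQ_Suc[OF LIMSEQ_power_zero[OF this]] show ?thesis by (simp only: power_mult)
    qed
    then have "(\<lambda>k. g k x) \<longlonglongrightarrow> complex_of_real (exp (- (\<Sum>i\<in>(Basis::'a set). 0)))"
      unfolding g_def by (intro tendsto_intros)
    then show ?thesis using True by simp
  next
    case False
    then have "x \<notin> cbox a b" using x by blast
    then obtain j where j: "j \<in> Basis" "\<not> \<bar>(x - m) \<bullet> j / r j\<bar> \<le> 1"
      using t(2) by (auto simp: mem_box)
    then have j1: "((x - m) \<bullet> j / r j)\<^sup>2 > 1"
      unfolding abs_square_le_1[symmetric] by (simp only: not_le)
    have "norm (g k x) \<le> inverse ((((x - m) \<bullet> j / r j)\<^sup>2) ^ Suc k)" for k
    proof -
      let ?S = "\<Sum>i\<in>Basis. ((x - m) \<bullet> i / r i) ^ (2 * Suc k)"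
      have "((x - m) \<bullet> j / r j) ^ (2 * Suc k) \<le> ?S"
        using j by (intro member_le_sum) (auto intro!: zero_le_even_power simp del: power_Suc)
      then have "(((x - m) \<bullet> j / r j)\<^sup>2) ^ Suc k \<le> exp ?S"
        using exp_ge_add_one_self[of ?S] unfolding power_mult by linarith
      then have "inverse (exp ?S) \<le> inverse ((((x - m) \<bullet> j / r j)\<^sup>2) ^ Suc k)"
        by (rule le_imp_inverse_le) (rule zero_less_power, use j1 in linarith)
      then show ?thesis unfolding g_def norm_of_real exp_minus by (simp del: power_Suc)
    qed
    moreover have "(\<lambda>k. inverse ((((x - m) \<bullet> j / r j)\<^sup>2) ^ Suc k)) \<longlonglongrightarrow> 0"
      by (rule LIMSEQ_Suc[OF LIMSEQ_inverse_realpow_zero[OF j1]])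
    ultimately have "(\<lambda>k. g k x) \<longlonglongrightarrow> 0"
      by (intro Lim_null_comparison[of "\<lambda>k. g k x"]) auto
    then show ?thesis using False by simp
  qed
  have ae: "AE x in lborel. x \<notin> cbox a b - box a b"
    by (rule AE_not_in) (rule null_sets_cbox_Diff_box)
  show ?thesis
  proof (rule schwartz_approx_dominated[where g = g and w = "\<lambda>x. of_real C * complex_of_real (exp (- c * (norm (x + - m))\<^sup>2))"])
    have "schwartz (\<lambda>x. of_real C * complex_of_real (exp (- c * (norm (x + - m))\<^sup>2)))"
      by (intro schwartz_cmult schwartz_shift[where f = "\<lambda>x. complex_of_real (exp (- c * (norm x)\<^sup>2))"] schwartz_gaussian c)
    then show "square_integrable (\<lambda>x. of_real C * complex_of_real (exp (- c * (norm (x + - m))\<^sup>2)))"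
      by (rule schwartz_square_integrable)
    show "indicator (box a b) \<in> borel_measurable borel" by measurable
    show "schwartz_approx (g k)" for k
      using schwartz_shift[OF schwartz_box_function(2)[of r k], of "- m"] r
      by (intro schwartz_approx_schwartz) (simp add: g_def[abs_def])
    show "AE x in lborel. (\<lambda>n. g n x) \<longlonglongrightarrow> indicator (box a b) x"
      using ae by eventually_elim (rule lim)
    have dom: "norm (g k x) \<le> norm (of_real C * complex_of_real (exp (- c * (norm (x + - m))\<^sup>2)))" for k x
      using C[of "x - m" k] C1 by (simp add: g_def norm_mult)
    then show "AE x in lborel. norm (g n x) \<le> norm (of_real C * complex_of_real (exp (- c * (norm (x + - m))\<^sup>2)))" for n
      by simp
    \<comment> \<open>The indicator is an almost everywhere limit of the functions
      \<open>g k\<close>, so it inherits their common bound.\<close>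
    show "AE x in lborel. norm (indicator (box a b) x :: complex) \<le> norm (of_real C * complex_of_real (exp (- c * (norm (x + - m))\<^sup>2)))"
      using ae
    proof eventually_elim
      case (elim x)
      show ?case
        by (rule LIMSEQ_le_const2[OF tendsto_norm[OF lim[OF elim]]]) (use dom in blast)
    qed
  qed
qed

text \<open>Dynkin's argument over the intersection-stable generator of boxes. Intersecting with one
  fixed box \<open>B\<close> keeps complements square integrable and supplies the dominating
  function for disjoint unions.\<close>

lemma schwartz_approx_bounded_set:
  fixes A B :: "'a::euclidean_space set"
  assumes "A \<in> sets borel" and B: "B = box p q"
  shows "schwartz_approx (indicator (A \<inter> B))"
proof -
  let ?G = "range (\<lambda>(a, b). box a b :: 'a set)"
  have A: "A \<in> sigma_sets UNIV ?G"
    using assms(1) by (subst (asm) borel_eq_box) simp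
  have G: "Int_stable ?G"
    by (auto simp: Int_stable_def box_Int_box)
  have "?G \<subseteq> Pow UNIV" by simp
  from G this A show ?thesis
  proof (induction rule: sigma_sets_induct_disjoint)
    case (basic A)
    then show ?case unfolding B by (auto simp: box_Int_box intro: schwartz_approx_box)
  next
    case empty
    then show ?case using schwartz_approx_zero by (simp add: indicator_def[abs_def])
  next
    case (compl A)
    have "schwartz_approx (\<lambda>x. - 1 * indicator (A \<inter> B) x + indicator B x)"
      using compl schwartz_approx_box unfolding B by (intro schwartz_approx_lincomb) auto
    also have "(\<lambda>x. - 1 * indicator (A \<inter> B) x + indicator B x :: complex) = indicator ((UNIV - A) \<inter> B)"
      by (auto simp: fun_eq_iff indicator_def)
    finally show ?case .
  next
    case (union A)
    have Am: "A i \<in> sets borel" for i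
      using union(2) by (subst borel_eq_box) auto
    have [measurable]: "B \<in> sets borel" using B by simp
    show ?case
    proof (rule schwartz_approx_dominated[where g = "\<lambda>n x. \<Sum>i<n. 1 * indicator (A i \<inter> B) x" and w = "indicator B"])
      show "square_integrable (indicator B)"
        using schwartz_approx_box[of p q] by (simp add: B schwartz_approx_def)
      show "indicator (\<Union> (range A) \<inter> B) \<in> borel_measurable borel"
        using Am by measurable
      show "schwartz_approx (\<lambda>x. \<Sum>i<n. 1 * indicator (A i \<inter> B) x)" for n
        by (rule schwartz_approx_sum) (rule union(3))
      have eq: "(\<Sum>i<n. 1 * indicator (A i \<inter> B) x) = (indicator (\<Union>i<n. A i \<inter> B) x :: complex)" for n x
      proof -
        have "disjoint_family_on (\<lambda>i. A i \<inter> B) {..<n}"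
          using union(1) by (auto simp: disjoint_family_on_def)
        from indicator_UN_disjoint[OF finite_lessThan this, of x, symmetric]
        show ?thesis by (simp only: mult_1)
      qed
      show "AE x in lborel. (\<lambda>n. \<Sum>i<n. 1 * indicator (A i \<inter> B) x) \<longlonglongrightarrow> (indicator (\<Union> (range A) \<inter> B) x :: complex)"
      proof (rule AE_I2)
        fix x
        have "(\<lambda>n. indicator (\<Union>i<n. A i \<inter> B) x) \<longlonglongrightarrow> (indicator (\<Union>i. A i \<inter> B) x :: complex)"
          by (rule LIMSEQ_indicator_UN)
        moreover have "(\<Union>i. A i \<inter> B) = \<Union> (range A) \<inter> B" by auto
        ultimately show "(\<lambda>n. \<Sum>i<n. 1 * indicator (A i \<inter> B) x) \<longlonglongrightarrow> (indicator (\<Union> (range A) \<inter> B) x :: complex)"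
          unfolding eq by simp
      qed
      show "AE x in lborel. norm (\<Sum>i<n. 1 * indicator (A i \<inter> B) x :: complex) \<le> norm (indicator B x :: complex)" for n
        unfolding eq by (intro AE_I2) (auto simp: indicator_def)
      show "AE x in lborel. norm (indicator (\<Union> (range A) \<inter> B) x :: complex) \<le> norm (indicator B x :: complex)"
        by (intro AE_I2) (auto simp: indicator_def)
    qed
  qed
qed

text \<open>Simple functions cut off to growing boxes converge in square mean. Writing such a
  cut-off as a sum over its finitely many values reduces it to indicators of level sets within a
  box.\<close>

lemma schwartz_approx_square_integrable:
  fixes f :: "'a::euclidean_space \<Rightarrow> complex"
  assumes f: "square_integrable f"
  shows "schwartz_approx f"
proof -
  have fm: "f \<in> borel_measurable borel" using f by (simp add: square_integrable_def)
  obtain s where s: "\<And>i. simple_function borel (s i)" "\<And>x. (\<lambda>i. s i x) \<longlonglongrightarrow> f x"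
    "\<And>i x. norm (s i x) \<le> 2 * norm (f x)"
    using borel_measurable_implies_sequence_metric[OF fm, of 0] by (auto simp: dist_norm)
  define B where "B n = (box (- real n *\<^sub>R One) (real n *\<^sub>R One) :: 'a set)" for n
  define g where "g n x = (\<Sum>y\<in>range (s n). y * indicator ((s n -` {y}) \<inter> B n) x)" for n x
  have fin: "finite (range (s n))" for n
    using simple_functionD(1)[OF s(1)] by simp
  have g: "g n x = s n x * indicator (B n) x" for n x
  proof -
    have "g n x = (\<Sum>y\<in>range (s n). if y = s n x then y * indicator (B n) x else 0)"
      unfolding g_def by (intro sum.cong refl) (auto simp: indicator_def)
    then show ?thesis using fin by simp
  qed
  show ?thesis
  proof (rule schwartz_approx_dominated[where g = g and w = "\<lambda>x. 2 * f x"])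
    show "square_integrable (\<lambda>x. 2 * f x)" by (rule square_integrable_mult[OF f])
    show "schwartz_approx (g n)" for n
      unfolding g_def[abs_def]
    proof (rule schwartz_approx_sum)
      fix y
      have "s n -` {y} \<in> sets borel" using simple_functionD(2)[OF s(1), of n "{y}"] by simp
      then show "schwartz_approx (indicator ((s n -` {y}) \<inter> B n))"
        by (rule schwartz_approx_bounded_set) (rule B_def)
    qed
    show "AE x in lborel. (\<lambda>n. g n x) \<longlonglongrightarrow> f x"
    proof (rule AE_I2)
      fix x :: 'a
      obtain N where N: "norm x < real N" using reals_Archimedean2 by blast
      have "x \<in> B n" if "n \<ge> N" for n
        unfolding B_def mem_box
      proof
        fix i :: 'a assume "i \<in> Basis"
        then have "\<bar>x \<bullet> i\<bar> < real n"
          using Basis_le_norm[of i x] N that by linarith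
        then show "(- real n *\<^sub>R One) \<bullet> i < x \<bullet> i \<and> x \<bullet> i < (real n *\<^sub>R One) \<bullet> i"
          using \<open>i \<in> Basis\<close> by auto
      qed
      then have "\<forall>\<^sub>F n in sequentially. s n x = g n x"
        unfolding g eventually_sequentially by (auto intro!: exI[of _ N])
      then show "(\<lambda>n. g n x) \<longlonglongrightarrow> f x"
        by (rule Lim_transform_eventually[OF s(2)])
    qed
    show "AE x in lborel. norm (g n x) \<le> norm (2 * f x)" for n
      unfolding g using s(3) by (intro AE_I2) (auto simp: indicator_def norm_mult)
    show "AE x in lborel. norm (f x) \<le> norm (2 * f x)"
      by (intro AE_I2) (simp add: norm_mult)
  qed (rule fm)
qed

subsection \<open>The space of square-integrable functions\<close>

lemma L2_cases:
  obtains f where "square_integrable f" "\<phi> = abs_L2 f"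
proof -
  have "L2_rel (rep_L2 \<phi>) (rep_L2 \<phi>)" using Quotient_rep_reflp[OF Quotient_L2] .
  then show thesis
    using that[of "rep_L2 \<phi>"] by (simp add: L2_rel_def Quotient_abs_rep[OF Quotient_L2])
qed

lemma L2_rel_refl: "square_integrable f \<Longrightarrow> L2_rel f f"
  by (simp add: L2_rel_def)

lemma abs_L2_add: "square_integrable f \<Longrightarrow> square_integrable g \<Longrightarrow> abs_L2 f + abs_L2 g = abs_L2 (\<lambda>x. f x + g x)"
  by (rule plus_L2.abs_eq) (auto intro: L2_rel_refl)

lemma scaleC_abs_L2: "square_integrable f \<Longrightarrow> scaleC c (abs_L2 f) = abs_L2 (\<lambda>x. c * f x)"
  by (rule scaleC.abs_eq) (auto intro: L2_rel_refl)

lemma abs_L2_diff: "square_integrable f \<Longrightarrow> square_integrable g \<Longrightarrow> abs_L2 f - abs_L2 g = abs_L2 (\<lambda>x. f x - g x)"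
  using abs_L2_add[of f "\<lambda>x. - 1 * g x"] square_integrable_mult[of g "- 1"]
  by (simp add: minus_L2_def uminus_L2_def scaleC_abs_L2)

lemma scaleR_abs_L2: "square_integrable f \<Longrightarrow> r *\<^sub>R abs_L2 f = abs_L2 (\<lambda>x. of_real r * f x)"
  by (simp add: scaleR_L2_def scaleC_abs_L2)

lemma cinner_abs_L2:
  "square_integrable f \<Longrightarrow> square_integrable g \<Longrightarrow> cinner (abs_L2 f) (abs_L2 g) = (LINT x|lborel. cnj (f x) * g x)"
  by (rule cinner.abs_eq) (auto intro: L2_rel_refl)

lemma cinner_same: "cinner \<phi> \<phi> = of_real ((norm \<phi>)\<^sup>2)"
proof -
  obtain f where f: "square_integrable f" "\<phi> = abs_L2 f" by (rule L2_cases)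
  have "cinner \<phi> \<phi> = (LINT x|lborel. complex_of_real ((norm (f x))\<^sup>2))"
    unfolding f(2) cinner_abs_L2[OF f(1) f(1)]
    by (rule Bochner_Integration.integral_cong)
      (auto simp: complex_norm_square mult.commute simp del: of_real_power)
  then have "cinner \<phi> \<phi> = of_real (LINT x|lborel. (norm (f x))\<^sup>2)"
    by (simp del: of_real_power)
  moreover have "(norm \<phi>)\<^sup>2 = Re (cinner \<phi> \<phi>)"
    by (simp add: power2_norm_eq_inner inner_L2_def)
  ultimately show ?thesis by simp
qed

lemma norm_abs_L2_sq: "square_integrable f \<Longrightarrow> (norm (abs_L2 f))\<^sup>2 = (LINT x|lborel. (norm (f x))\<^sup>2)"
proof -
  assume f: "square_integrable f"
  have "complex_of_real ((norm (abs_L2 f))\<^sup>2) = (LINT x|lborel. complex_of_real ((norm (f x))\<^sup>2))"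
    unfolding cinner_same[symmetric] cinner_abs_L2[OF f f]
    by (rule Bochner_Integration.integral_cong)
      (auto simp: complex_norm_square mult.commute simp del: of_real_power)
  then show ?thesis using of_real_eq_iff by (metis integral_complex_of_real)
qed

lemma schwartz_dense_L2:
  fixes \<phi> :: "'a::euclidean_space L2"
  assumes "e > 0"
  shows "\<exists>\<psi>. schwartz \<psi> \<and> norm (\<phi> - abs_L2 \<psi>) < e"
proof -
  obtain f where f: "square_integrable f" "\<phi> = abs_L2 f" by (rule L2_cases)
  obtain \<psi> where \<psi>: "schwartz \<psi>" "(LINT x|lborel. (norm (f x - \<psi> x))\<^sup>2) < e\<^sup>2"
    using schwartz_approx_square_integrable[OF f(1)] assms unfolding schwartz_approx_def
    by (meson zero_less_power)
  have "(norm (\<phi> - abs_L2 \<psi>))\<^sup>2 < e\<^sup>2"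
    using f \<psi> by (simp add: abs_L2_diff norm_abs_L2_sq schwartz_square_integrable square_integrable_diff)
  then show ?thesis using \<psi>(1) assms power_less_imp_less_base[of _ 2 e] by force
qed

lemma cinner_add_right: "cinner \<phi> (\<psi> + \<theta>) = cinner \<phi> \<psi> + cinner \<phi> \<theta>"
proof -
  obtain f where f: "square_integrable f" "\<phi> = abs_L2 f" by (rule L2_cases)
  obtain g where g: "square_integrable g" "\<psi> = abs_L2 g" by (rule L2_cases)
  obtain h where h: "square_integrable h" "\<theta> = abs_L2 h" by (rule L2_cases)
  show ?thesis
    using f(1) g(1) h(1) unfolding f(2) g(2) h(2)
    by (simp add: abs_L2_add cinner_abs_L2 square_integrable_add square_integrable_cnj_mult distrib_left)
qed

lemma cinner_scaleC_right: "cinner \<phi> (scaleC c \<psi>) = c * cinner \<phi> \<psi>"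
proof -
  obtain f where f: "square_integrable f" "\<phi> = abs_L2 f" by (rule L2_cases)
  obtain g where g: "square_integrable g" "\<psi> = abs_L2 g" by (rule L2_cases)
  show ?thesis
    using f(1) g(1) unfolding f(2) g(2)
    by (simp add: scaleC_abs_L2 cinner_abs_L2 square_integrable_mult mult.left_commute)
qed

lemma cinner_commute: "cinner \<phi> \<psi> = cnj (cinner \<psi> \<phi>)"
proof -
  obtain f where f: "square_integrable f" "\<phi> = abs_L2 f" by (rule L2_cases)
  obtain g where g: "square_integrable g" "\<psi> = abs_L2 g" by (rule L2_cases)
  show ?thesis
    using f(1) g(1) unfolding f(2) g(2)
    by (simp add: cinner_abs_L2 mult.commute flip: Bochner_Integration.integral_cnj)
qed

lemma cinner_diff_right: "cinner \<phi> (\<psi> - \<theta>) = cinner \<phi> \<psi> - cinner \<phi> \<theta>"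
  by (simp add: minus_L2_def uminus_L2_def cinner_add_right cinner_scaleC_right)

lemma scaleC_scaleC: "scaleC a (scaleC b \<phi>) = scaleC (a * b) \<phi>"
proof -
  obtain f where f: "square_integrable f" "\<phi> = abs_L2 f" by (rule L2_cases)
  show ?thesis using f(1) unfolding f(2) by (simp add: scaleC_abs_L2 square_integrable_mult mult.assoc)
qed

lemma scaleC_one: "scaleC 1 \<phi> = \<phi>"
proof -
  obtain f where f: "square_integrable f" "\<phi> = abs_L2 f" by (rule L2_cases)
  show ?thesis using f(1) unfolding f(2) by (simp add: scaleC_abs_L2)
qed

text \<open>The real Cauchy-Schwarz inequality, after multiplying \<open>\<psi>\<close> by the phase
  \<open>u\<close> that makes the complex inner product real and nonnegative.\<close>

lemma norm_cinner_le: "norm (cinner \<phi> \<psi>) \<le> norm \<phi> * norm \<psi>"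
proof (cases "cinner \<phi> \<psi> = 0")
  case False
  define u where "u = cnj (cinner \<phi> \<psi>) / of_real (norm (cinner \<phi> \<psi>))"
  have u: "norm u = 1" using False by (simp add: u_def norm_divide)
  have "norm (scaleC u \<psi>) = norm \<psi>"
  proof -
    have "complex_of_real ((norm (scaleC u \<psi>))\<^sup>2) = of_real ((norm \<psi>)\<^sup>2)"
      unfolding cinner_same[symmetric] cinner_scaleC_right
      using cinner_commute[of "scaleC u \<psi>" \<psi>] u
      by (simp add: cinner_scaleC_right cinner_same mult.assoc[symmetric] complex_norm_square[symmetric])
    then show ?thesis using of_real_eq_iff power2_eq_iff_nonneg norm_ge_zero by metis
  qed
  moreover have "inner \<phi> (scaleC u \<psi>) = norm (cinner \<phi> \<psi>)"
  proof -
    have "u * cinner \<phi> \<psi> = of_real (norm (cinner \<phi> \<psi>))"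
      using False unfolding u_def
      using complex_norm_square[of "cinner \<phi> \<psi>"] by (simp add: field_simps power2_eq_square)
    then show ?thesis by (simp add: inner_L2_def cinner_scaleC_right)
  qed
  ultimately show ?thesis using norm_cauchy_schwarz[of \<phi> "scaleC u \<psi>"] by simp
qed simp

lemma L2_eqI_cinner: "(\<And>\<phi>. cinner \<phi> \<psi> = cinner \<phi> \<theta>) \<Longrightarrow> \<psi> = \<theta>"
  using cinner_diff_right[of "\<psi> - \<theta>" \<psi> \<theta>] cinner_same[of "\<psi> - \<theta>"] by simp

subsection \<open>The Weyl operators\<close>

definition weyl_fun :: "real \<Rightarrow> 'd::finite phase_space \<Rightarrow> (real^'d \<Rightarrow> complex) \<Rightarrow> real^'d \<Rightarrow> complex" where
  "weyl_fun eps X f = (\<lambda>y. iexp (- (snd X \<bullet> y + eps / 2 * (snd X \<bullet> fst X))) * f (y + eps *\<^sub>R fst X))"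

lemma AE_lborel_shift:
  fixes a :: "'a::euclidean_space"
  assumes "AE x in lborel. P x"
  shows "AE x in lborel. P (x + a)"
proof -
  have "AE x in distr lborel borel ((+) a). P x"
    unfolding lborel_distr_plus by (rule assms)
  then have "AE x in lborel. P (a + x)"
    by (rule AE_distrD[rotated]) simp
  then show ?thesis by (simp add: add.commute)
qed

lemma square_integrable_shift:
  fixes f :: "'a::euclidean_space \<Rightarrow> complex"
  assumes "square_integrable f"
  shows "square_integrable (\<lambda>x. f (x + a))"
proof -
  have [measurable]: "f \<in> borel_measurable borel" using assms by (simp add: square_integrable_def)
  have "integrable lborel (\<lambda>x. (norm (f (a + 1 *\<^sub>R x)))\<^sup>2)"
    by (rule lborel_integrable_affine[where f = "\<lambda>x. (norm (f x))\<^sup>2"])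
      (use assms in \<open>auto simp: square_integrable_def\<close>)
  then show ?thesis by (simp add: square_integrable_def add.commute)
qed

lemma norm_weyl_fun: "norm (weyl_fun eps X f y) = norm (f (y + eps *\<^sub>R fst X))"
  by (simp add: weyl_fun_def norm_mult)

lemma measurable_weyl_fun:
  assumes [measurable]: "f \<in> borel_measurable borel"
  shows "weyl_fun eps X f \<in> borel_measurable borel"
  unfolding weyl_fun_def by measurable

lemma square_integrable_weyl_fun:
  assumes "square_integrable f"
  shows "square_integrable (weyl_fun eps X f)"
proof (rule square_integrable_bound[OF square_integrable_shift[OF assms, of "eps *\<^sub>R fst X"]])
  show "weyl_fun eps X f \<in> borel_measurable borel"
    using assms by (intro measurable_weyl_fun) (simp add: square_integrable_def)
qed (simp add: norm_weyl_fun)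

lift_definition weyl :: "real \<Rightarrow> 'd::finite phase_space \<Rightarrow> (real^'d) L2 \<Rightarrow> (real^'d) L2" is weyl_fun
proof -
  fix eps :: real and X :: "'d phase_space" and f g :: "real^'d \<Rightarrow> complex"
  assume fg: "L2_rel f g"
  then have "AE y in lborel. f (y + eps *\<^sub>R fst X) = g (y + eps *\<^sub>R fst X)"
    unfolding L2_rel_def by (intro AE_lborel_shift[of "\<lambda>x. f x = g x"]) simp
  then have "AE y in lborel. weyl_fun eps X f y = weyl_fun eps X g y"
    by eventually_elim (simp add: weyl_fun_def)
  with fg show "L2_rel (weyl_fun eps X f) (weyl_fun eps X g)"
    unfolding L2_rel_def by (auto intro: square_integrable_weyl_fun)
qed

lemma weyl_abs_L2: "square_integrable f \<Longrightarrow> weyl eps X (abs_L2 f) = abs_L2 (weyl_fun eps X f)"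
  by (rule weyl.abs_eq) (rule L2_rel_refl)

lemma weyl_fun_mult:
  "weyl_fun eps Y (weyl_fun eps Z f) = (\<lambda>y. iexp (eps / 2 * symp_form Y Z) * weyl_fun eps (Y + Z) f y)"
proof
  fix y
  have "- (snd Y \<bullet> y + eps / 2 * (snd Y \<bullet> fst Y)) +
      - (snd Z \<bullet> (y + eps *\<^sub>R fst Y) + eps / 2 * (snd Z \<bullet> fst Z)) =
      eps / 2 * symp_form Y Z + - (snd (Y + Z) \<bullet> y + eps / 2 * (snd (Y + Z) \<bullet> fst (Y + Z)))"
    by (simp add: symp_form_def inner_simps algebra_simps inner_commute)
  then have "iexp (- (snd Y \<bullet> y + eps / 2 * (snd Y \<bullet> fst Y))) *
      iexp (- (snd Z \<bullet> (y + eps *\<^sub>R fst Y) + eps / 2 * (snd Z \<bullet> fst Z))) =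
      iexp (eps / 2 * symp_form Y Z) * iexp (- (snd (Y + Z) \<bullet> y + eps / 2 * (snd (Y + Z) \<bullet> fst (Y + Z))))"
    by (simp only: exp_add[symmetric] distrib_left[symmetric] of_real_add[symmetric])
  then show "weyl_fun eps Y (weyl_fun eps Z f) y = iexp (eps / 2 * symp_form Y Z) * weyl_fun eps (Y + Z) f y"
    unfolding weyl_fun_def by (simp only: mult.assoc[symmetric] fst_add scaleR_add_right add.assoc)
qed

lemma weyl_mult: "weyl eps Y (weyl eps Z \<phi>) = scaleC (iexp (eps / 2 * symp_form Y Z)) (weyl eps (Y + Z) \<phi>)"
proof -
  obtain f where f: "square_integrable f" "\<phi> = abs_L2 f" by (rule L2_cases)
  show ?thesis
    using f(1) unfolding f(2)
    by (simp add: weyl_abs_L2 square_integrable_weyl_fun scaleC_abs_L2 weyl_fun_mult)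
qed

lemma weyl_zero: "weyl eps 0 \<phi> = \<phi>"
proof -
  obtain f where f: "square_integrable f" "\<phi> = abs_L2 f" by (rule L2_cases)
  show ?thesis
    using f(1) unfolding f(2) by (simp add: weyl_abs_L2 weyl_fun_def)
qed

lemma cinner_weyl_weyl: "cinner (weyl eps X \<phi>) (weyl eps X \<psi>) = cinner \<phi> \<psi>"
proof -
  obtain f where f: "square_integrable f" "\<phi> = abs_L2 f" by (rule L2_cases)
  obtain g where g: "square_integrable g" "\<psi> = abs_L2 g" by (rule L2_cases)
  have [measurable]: "f \<in> borel_measurable borel" "g \<in> borel_measurable borel"
    using f(1) g(1) by (auto simp: square_integrable_def)
  have "cnj (weyl_fun eps X f y) * weyl_fun eps X g y = cnj (f (y + eps *\<^sub>R fst X)) * g (y + eps *\<^sub>R fst X)" for y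
  proof -
    have "cnj (iexp t * a) * (iexp t * b) = (cnj (iexp t) * iexp t) * (cnj a * b)" for t a b
      by (simp only: complex_cnj_mult mult_ac)
    moreover have "cnj (iexp t) * iexp t = 1" for t
      by (simp add: exp_cnj flip: exp_add)
    ultimately show ?thesis unfolding weyl_fun_def by (simp only: mult_1)
  qed
  then show ?thesis
    using f(1) g(1) lborel_integral_shift[of "\<lambda>y. cnj (f y) * g y" "eps *\<^sub>R fst X"] unfolding f(2) g(2)
    by (simp add: weyl_abs_L2 square_integrable_weyl_fun cinner_abs_L2)
qed

lemma unitary_weyl: "unitary (weyl eps X)"
  unfolding unitary_def
proof (intro conjI allI)
  show "weyl eps X (\<phi> + \<psi>) = weyl eps X \<phi> + weyl eps X \<psi>" for \<phi> \<psi>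
  proof -
    obtain f where f: "square_integrable f" "\<phi> = abs_L2 f" by (rule L2_cases)
    obtain g where g: "square_integrable g" "\<psi> = abs_L2 g" by (rule L2_cases)
    show ?thesis
      using f(1) g(1) unfolding f(2) g(2)
      by (simp add: weyl_abs_L2 square_integrable_weyl_fun abs_L2_add square_integrable_add)
        (simp add: weyl_fun_def distrib_left)
  qed
  show "weyl eps X (scaleC c \<phi>) = scaleC c (weyl eps X \<phi>)" for c \<phi>
  proof -
    obtain f where f: "square_integrable f" "\<phi> = abs_L2 f" by (rule L2_cases)
    show ?thesis
      using f(1) unfolding f(2)
      by (simp add: weyl_abs_L2 square_integrable_weyl_fun scaleC_abs_L2 square_integrable_mult)
        (simp add: weyl_fun_def mult.left_commute)
  qed
  have "weyl eps X (weyl eps (- X) \<phi>) = \<phi>" for \<phi>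
    by (simp add: weyl_mult symp_form_simps weyl_zero scaleC_one)
  then show "surj (weyl eps X)" by (metis surj_def)
  show "cinner (weyl eps X \<phi>) (weyl eps X \<psi>) = cinner \<phi> \<psi>" for \<phi> \<psi>
    by (rule cinner_weyl_weyl)
qed

lemma unitaryD:
  assumes "unitary V"
  shows "V (\<phi> + \<psi>) = V \<phi> + V \<psi>" "V (scaleC c \<phi>) = scaleC c (V \<phi>)" "cinner (V \<phi>) (V \<psi>) = cinner \<phi> \<psi>"
    "V (\<phi> - \<psi>) = V \<phi> - V \<psi>" "norm (V \<phi>) = norm \<phi>"
proof -
  show add: "V (\<phi> + \<psi>) = V \<phi> + V \<psi>" for \<phi> \<psi> using assms by (simp add: unitary_def)
  show "V (scaleC c \<phi>) = scaleC c (V \<phi>)" "cinner (V \<phi>) (V \<psi>) = cinner \<phi> \<psi>"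
    using assms by (auto simp: unitary_def)
  show "V (\<phi> - \<psi>) = V \<phi> - V \<psi>"
    using add[of "\<phi> - \<psi>" \<psi>] by (simp add: eq_diff_eq)
  have "cinner (V \<phi>) (V \<phi>) = cinner \<phi> \<phi>" using assms by (simp add: unitary_def)
  then show "norm (V \<phi>) = norm \<phi>"
    by (simp add: norm_eq_sqrt_inner inner_L2_def)
qed

section \<open>The Weyl operators as the unitary group with the prescribed generator\<close>

lemma schwartz_weyl_fun:
  fixes f :: "real^'d::finite \<Rightarrow> complex"
  assumes "schwartz f"
  shows "schwartz (weyl_fun eps X f)"
proof -
  have "slow (\<lambda>y. of_real (y \<bullet> snd X))"
    by (intro slow_inner bounded_linear_ident)
  from slow_lincomb[OF this slow_const[of "of_real (eps / 2 * (snd X \<bullet> fst X))"], of 1]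
  have "slow (\<lambda>y. complex_of_real (snd X \<bullet> y + eps / 2 * (snd X \<bullet> fst X)))"
    by (simp add: inner_commute)
  from slow_lincomb[OF this slow_const[of 0], of "- 1"]
  have "slow (\<lambda>y. complex_of_real (- (snd X \<bullet> y + eps / 2 * (snd X \<bullet> fst X))))"
    by simp
  then show ?thesis
    unfolding weyl_fun_def
    by (intro schwartz_slow_mult slow_iexp schwartz_shift assms)
qed

text \<open>The operator -i(\<xi>.Q - x.P) on functions, where X = (x, \<xi>).\<close>

definition weyl_generator :: "real \<Rightarrow> 'd::finite phase_space \<Rightarrow> (real^'d \<Rightarrow> complex) \<Rightarrow> real^'d \<Rightarrow> complex" where
  "weyl_generator eps X \<psi> = (\<lambda>y. frechet_derivative \<psi> (at y) (eps *\<^sub>R fst X) - \<i> * of_real (snd X \<bullet> y) * \<psi> y)"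

lemma weyl_generator_eq:
  fixes \<psi> :: "real^'d::finite \<Rightarrow> complex"
  assumes "schwartz \<psi>"
  shows "weyl_generator eps X \<psi> = (\<lambda>y. - \<i> * (\<Sum>j\<in>UNIV. complex_of_real (snd X $ j) * Q_op j \<psi> y -
    complex_of_real (fst X $ j) * P_op eps j \<psi> y))"
proof
  fix y
  have lin: "linear (frechet_derivative \<psi> (at y))"
    using has_derivative_linear[OF schwartz_has_derivative[OF assms]] .
  have "fst X = (\<Sum>j\<in>UNIV. (fst X $ j) *\<^sub>R axis j 1)"
    by (simp add: vec_eq_iff axis_def if_distrib cong: if_cong)
  then have "frechet_derivative \<psi> (at y) (fst X) = frechet_derivative \<psi> (at y) (\<Sum>j\<in>UNIV. (fst X $ j) *\<^sub>R axis j 1)"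
    by simp
  also have "\<dots> = (\<Sum>j\<in>UNIV. complex_of_real (fst X $ j) * frechet_derivative \<psi> (at y) (axis j 1))"
    by (simp add: linear_sum[OF lin] linear_scale[OF lin] scaleR_conv_of_real[where 'a = complex])
  finally have D: "frechet_derivative \<psi> (at y) (eps *\<^sub>R fst X) =
      of_real eps * (\<Sum>j\<in>UNIV. complex_of_real (fst X $ j) * frechet_derivative \<psi> (at y) (axis j 1))"
    by (simp add: linear_scale[OF lin] scaleR_conv_of_real[where 'a = complex])
  show "weyl_generator eps X \<psi> y = - \<i> * (\<Sum>j\<in>UNIV. complex_of_real (snd X $ j) * Q_op j \<psi> y -
      complex_of_real (fst X $ j) * P_op eps j \<psi> y)"
    unfolding weyl_generator_def D Q_op_def P_op_def inner_vec_def
    by (simp add: sum_subtractf sum_distrib_left sum_distrib_right algebra_simps sum.distrib sum_negf)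
qed

lemma schwartz_weyl_generator:
  assumes "schwartz \<psi>"
  shows "schwartz (weyl_generator eps X \<psi>)"
proof -
  have "slow (\<lambda>y. \<i> * complex_of_real (y \<bullet> snd X))"
    by (intro slow_mult slow_const slow_inner bounded_linear_ident)
  then show ?thesis
    unfolding weyl_generator_def
    by (intro schwartz_diff schwartz_directional schwartz_slow_mult assms) (simp add: inner_commute)
qed

text \<open>The derivative is computed at every \<open>s\<close>, where it is the group applied to
  the generator, because the mean value inequality for the difference quotients at 0 uses it on a
  whole interval.\<close>

lemma weyl_fun_has_vector_derivative:
  fixes \<psi> :: "real^'d::finite \<Rightarrow> complex"
  assumes \<psi>: "schwartz \<psi>"
  shows "((\<lambda>t. weyl_fun eps (t *\<^sub>R X) \<psi> y) has_vector_derivative weyl_fun eps (s *\<^sub>R X) (weyl_generator eps X \<psi>) y) (at s)"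
proof -
  define p where "p t = y + eps *\<^sub>R (t *\<^sub>R fst X)" for t
  \<comment> \<open>The phase along the ray is quadratic in \<open>t\<close>, since both components
    of \<open>t *\<^sub>R X\<close> enter the term \<open>snd X \<bullet> fst X\<close>.\<close>
  define q where "q t = - (t * (snd X \<bullet> y) + eps / 2 * t\<^sup>2 * (snd X \<bullet> fst X))" for t
  have p: "(p has_derivative (\<lambda>h. eps *\<^sub>R (h *\<^sub>R fst X))) (at s)"
    unfolding p_def by (auto intro!: derivative_eq_intros)
  have 1: "((\<lambda>t. \<psi> (p t)) has_derivative (\<lambda>h. frechet_derivative \<psi> (at (p s)) (eps *\<^sub>R (h *\<^sub>R fst X)))) (at s)"
    by (rule has_derivative_compose[OF p schwartz_has_derivative[OF \<psi>]])
  have q: "(q has_derivative (\<lambda>h. - (h * (snd X \<bullet> p s)))) (at s)"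
    unfolding q_def p_def by (auto intro!: derivative_eq_intros simp: inner_simps algebra_simps power2_eq_square)
  have "((\<lambda>t. \<i> * complex_of_real (q t)) has_derivative (\<lambda>h. \<i> * complex_of_real (- (h * (snd X \<bullet> p s))))) (at s)"
    by (intro has_derivative_mult_right has_derivative_of_real q)
  from has_derivative_compose[OF this DERIV_exp[unfolded has_field_derivative_def]]
  have 2: "((\<lambda>t. iexp (q t)) has_derivative (\<lambda>h. iexp (q s) * (\<i> * complex_of_real (- (h * (snd X \<bullet> p s)))))) (at s)" .
  have lin: "linear (frechet_derivative \<psi> (at (p s)))"
    using has_derivative_linear[OF schwartz_has_derivative[OF \<psi>]] .
  have eq: "weyl_fun eps (t *\<^sub>R X) \<psi> y = iexp (q t) * \<psi> (p t)" for \<psi> t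
    by (simp add: weyl_fun_def q_def p_def power2_eq_square mult_ac)
  have "iexp (q s) * frechet_derivative \<psi> (at (p s)) (eps *\<^sub>R (h *\<^sub>R fst X)) +
      iexp (q s) * (\<i> * complex_of_real (- (h * (snd X \<bullet> p s)))) * \<psi> (p s) =
      h *\<^sub>R (iexp (q s) * weyl_generator eps X \<psi> (p s))" for h
  proof -
    have "frechet_derivative \<psi> (at (p s)) (eps *\<^sub>R (h *\<^sub>R fst X)) =
        of_real h * frechet_derivative \<psi> (at (p s)) (eps *\<^sub>R fst X)"
      unfolding scaleR_left_commute[of eps h] by (simp add: linear_scale[OF lin] scaleR_conv_of_real[where 'a = complex])
    then show ?thesis
      by (simp add: weyl_generator_def scaleR_conv_of_real[where 'a = complex] algebra_simps)
  qed
  then show ?thesis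
    unfolding has_vector_derivative_def eq
    using has_derivative_mult[OF 2 1] by simp
qed

text \<open>One square-integrable function dominates all translates by at most \<open>R\<close>,
  because 1 + |x| <= (1 + |R|)(1 + |x + v|). It will dominate the difference quotients of the Weyl
  group.\<close>

lemma schwartz_shift_dominated:
  fixes f :: "'a::euclidean_space \<Rightarrow> complex"
  assumes "schwartz f"
  shows "\<exists>w :: 'a \<Rightarrow> complex. square_integrable w \<and> (\<forall>x v. norm v \<le> R \<longrightarrow> norm (f (x + v)) \<le> norm (w x))"
proof -
  let ?k = "2 * DIM('a)"
  obtain C where C: "C \<ge> 0" "\<And>x. norm (f x) \<le> C / (1 + norm x) ^ ?k"
    using schwartz_bound[OF assms] by blast
  define w where "w x = complex_of_real (C * (1 + \<bar>R\<bar>) ^ ?k * (1 / (1 + norm x) ^ ?k))" for x :: 'a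
  have d: "1 / (1 + norm x) ^ ?k \<le> 1" "1 / (1 + norm x) ^ ?k \<ge> 0" for x :: 'a
    by (auto simp: divide_le_eq_1 one_le_power add_pos_nonneg)
  have "integrable lborel (\<lambda>x::'a. (1 / (1 + norm x) ^ ?k)\<^sup>2)"
  proof (rule Bochner_Integration.integrable_bound[OF integrable_decay[where 'a = 'a]])
    show "AE x in lborel. norm ((1 / (1 + norm x) ^ ?k)\<^sup>2) \<le> norm (1 / (1 + norm (x::'a)) ^ ?k)"
      using mult_left_le[OF d] by (intro AE_I2) (simp add: power2_eq_square)
  qed simp
  then have "integrable lborel (\<lambda>x::'a. (C * (1 + \<bar>R\<bar>) ^ ?k)\<^sup>2 * (1 / (1 + norm x) ^ ?k)\<^sup>2)"
    by (rule integrable_mult_right)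
  then have "square_integrable w"
    unfolding square_integrable_def w_def norm_of_real power2_abs power_mult_distrib by simp
  moreover have "norm (f (x + v)) \<le> norm (w x)" if "norm v \<le> R" for x v
  proof -
    have "norm x \<le> norm (x + v) + norm v"
      using norm_triangle_ineq4[of "x + v" v] by simp
    also have "\<dots> \<le> norm (x + v) + (\<bar>R\<bar> + \<bar>R\<bar> * norm (x + v))"
      using that by (intro add_left_mono add_increasing2) auto
    finally have "1 + norm x \<le> (1 + \<bar>R\<bar>) * (1 + norm (x + v))" by (simp add: algebra_simps)
    then have "(1 + norm x) ^ ?k \<le> ((1 + \<bar>R\<bar>) * (1 + norm (x + v))) ^ ?k"
      by (rule power_mono) simp
    then have "1 / (1 + norm (x + v)) ^ ?k \<le> (1 + \<bar>R\<bar>) ^ ?k * (1 / (1 + norm x) ^ ?k)"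
      unfolding power_mult_distrib by (simp add: divide_simps add_pos_nonneg mult.commute)
    from mult_left_mono[OF this C(1)] show ?thesis
      unfolding w_def norm_of_real using order_trans[OF C(2)[of "x + v"], of "C * (1 + \<bar>R\<bar>) ^ ?k * (1 / (1 + norm x) ^ ?k)"]
      by (intro order_trans[OF _ abs_ge_self]) (simp add: mult_ac)
  qed
  ultimately show ?thesis by blast
qed

text \<open>The pointwise difference quotients \<open>g t\<close> converge to the generator by
  \<open>weyl_fun_has_vector_derivative\<close> and are bounded by \<open>w\<close> through the mean
  value inequality, so they converge in square mean.\<close>

lemma weyl_L2_has_vector_derivative:
  fixes \<psi> :: "real^'d::finite \<Rightarrow> complex"
  assumes \<psi>: "schwartz \<psi>"
  shows "((\<lambda>t. weyl eps (t *\<^sub>R X) (abs_L2 \<psi>)) has_vector_derivative abs_L2 (weyl_generator eps X \<psi>)) (at 0)"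
proof -
  let ?\<theta> = "weyl_generator eps X \<psi>"
  have \<theta>: "schwartz ?\<theta>" by (rule schwartz_weyl_generator[OF \<psi>])
  note sq = schwartz_square_integrable[OF \<psi>] schwartz_square_integrable[OF \<theta>]
  obtain w :: "real^'d \<Rightarrow> complex" where w: "square_integrable w"
    "\<And>x v. norm v \<le> norm (eps *\<^sub>R fst X) \<Longrightarrow> norm (?\<theta> (x + v)) \<le> norm (w x)"
    using schwartz_shift_dominated[OF \<theta>] by blast
  have D: "((\<lambda>t. weyl_fun eps (t *\<^sub>R X) \<psi> y) has_vector_derivative weyl_fun eps (s *\<^sub>R X) ?\<theta> y) (at s)" for y s
    by (rule weyl_fun_has_vector_derivative[OF \<psi>])
  define g where "g t y = (weyl_fun eps (t *\<^sub>R X) \<psi> y - \<psi> y) / of_real t" for t y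
  have w0: "weyl_fun eps 0 f = f" for f :: "real^'d \<Rightarrow> complex" by (simp add: weyl_fun_def)
  have g: "norm (g t y) \<le> norm (w y)" if t: "\<bar>t\<bar> \<le> 1" for t y
  proof (cases "t = 0")
    case False
    have "norm (weyl_fun eps (t *\<^sub>R X) \<psi> y - weyl_fun eps (0 *\<^sub>R X) \<psi> y) \<le> norm (w y) * norm (t - 0)"
    proof (rule differentiable_bound[where S = "{-1..1}"])
      fix s :: real assume s: "s \<in> {-1..1}"
      show "((\<lambda>t. weyl_fun eps (t *\<^sub>R X) \<psi> y) has_derivative (\<lambda>h. h *\<^sub>R weyl_fun eps (s *\<^sub>R X) ?\<theta> y)) (at s within {-1..1})"
        using D[of y s] has_derivative_at_withinI unfolding has_vector_derivative_def by blast
      have "norm (weyl_fun eps (s *\<^sub>R X) ?\<theta> y) \<le> norm (w y)"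
        unfolding norm_weyl_fun
      proof (rule w(2))
        show "norm (eps *\<^sub>R fst (s *\<^sub>R X)) \<le> norm (eps *\<^sub>R fst X)"
          using s mult_right_mono[of "\<bar>s\<bar>" 1 "\<bar>eps\<bar> * norm (fst X)"] by (simp add: abs_le_iff abs_mult mult_ac)
      qed
      then show "onorm (\<lambda>h. h *\<^sub>R weyl_fun eps (s *\<^sub>R X) ?\<theta> y) \<le> norm (w y)"
        by (intro onorm_le) (simp add: mult.commute mult_left_mono)
    qed (use t in auto)
    then show ?thesis using False by (simp add: g_def w0 norm_divide field_simps)
  qed (simp add: g_def)
  have "((\<lambda>h. norm (weyl eps ((0 + h) *\<^sub>R X) (abs_L2 \<psi>) - weyl eps (0 *\<^sub>R X) (abs_L2 \<psi>) - h *\<^sub>R abs_L2 ?\<theta>) / norm h) \<circ> T) \<longlonglongrightarrow> 0"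
    if T0: "\<And>i. T i \<noteq> 0" and T: "T \<longlonglongrightarrow> 0" for T :: "nat \<Rightarrow> real"
  proof -
    have "\<forall>\<^sub>F i in sequentially. dist (T i) 0 < 1"
      using T by (rule tendstoD) simp
    then obtain N where N: "\<And>i. i \<ge> N \<Longrightarrow> \<bar>T i\<bar> < 1"
      by (auto simp: eventually_sequentially)
    define S where "S i = T (i + N)" for i
    have S: "S \<longlonglongrightarrow> 0" unfolding S_def by (rule LIMSEQ_ignore_initial_segment[OF T])
    have S1: "\<bar>S i\<bar> \<le> 1" and S0: "S i \<noteq> 0" for i
      unfolding S_def using N[of "i + N"] T0 by auto
    have meas: "g t \<in> borel_measurable borel" for t
    proof -
      have [measurable]: "\<psi> \<in> borel_measurable borel" by (rule schwartz_measurable[OF \<psi>])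
      have [measurable]: "weyl_fun eps (t *\<^sub>R X) \<psi> \<in> borel_measurable borel"
        by (intro measurable_weyl_fun) measurable
      show ?thesis unfolding g_def by measurable
    qed
    have gs: "square_integrable (g (S i))" for i
      by (rule square_integrable_bound[OF w(1) meas]) (simp add: g[OF S1])
    have "(\<lambda>i. LINT y|lborel. (norm (?\<theta> y - g (S i) y))\<^sup>2) \<longlonglongrightarrow> 0"
    proof (rule integral_sq_dominated_limit[OF w(1)])
      show "?\<theta> \<in> borel_measurable borel" by (rule schwartz_measurable[OF \<theta>])
      show "AE y in lborel. (\<lambda>i. g (S i) y) \<longlonglongrightarrow> ?\<theta> y"
      proof (rule AE_I2)
        fix y
        have "((\<lambda>t. weyl_fun eps (t *\<^sub>R X) \<psi> y) has_vector_derivative ?\<theta> y) (at 0)"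
          using D[of y 0] by (simp add: w0)
        then have "(\<lambda>h. norm (weyl_fun eps (h *\<^sub>R X) \<psi> y - \<psi> y - h *\<^sub>R ?\<theta> y) / norm h) \<midarrow>0\<rightarrow> 0"
          unfolding has_vector_derivative_def has_derivative_at by (simp add: w0)
        then have "(\<lambda>i. norm (weyl_fun eps (S i *\<^sub>R X) \<psi> y - \<psi> y - S i *\<^sub>R ?\<theta> y) / norm (S i)) \<longlonglongrightarrow> 0"
          using S S0 by (auto simp: tendsto_at_iff_sequentially o_def)
        moreover have "norm (weyl_fun eps (S i *\<^sub>R X) \<psi> y - \<psi> y - S i *\<^sub>R ?\<theta> y) / norm (S i) = norm (g (S i) y - ?\<theta> y)" for i
        proof -
          have "g (S i) y - ?\<theta> y = (weyl_fun eps (S i *\<^sub>R X) \<psi> y - \<psi> y - S i *\<^sub>R ?\<theta> y) / of_real (S i)"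
            using S0[of i] by (simp add: g_def scaleR_conv_of_real[where 'a = complex] diff_divide_distrib)
          then show ?thesis by (simp add: norm_divide)
        qed
        ultimately have "(\<lambda>i. norm (g (S i) y - ?\<theta> y)) \<longlonglongrightarrow> 0" by simp
        then show "(\<lambda>i. g (S i) y) \<longlonglongrightarrow> ?\<theta> y"
          by (rule LIM_zero_cancel[OF tendsto_norm_zero_cancel])
      qed
      show "AE y in lborel. norm (g (S i) y) \<le> norm (w y)" for i by (simp add: g[OF S1])
      show "AE y in lborel. norm (?\<theta> y) \<le> norm (w y)" using w(2)[of 0] by simp
    qed (rule meas)
    then have "(\<lambda>i. sqrt (LINT y|lborel. (norm (?\<theta> y - g (S i) y))\<^sup>2)) \<longlonglongrightarrow> sqrt 0"
      by (rule tendsto_real_sqrt)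
    moreover have "norm (weyl eps (S i *\<^sub>R X) (abs_L2 \<psi>) - weyl eps (0 *\<^sub>R X) (abs_L2 \<psi>) - S i *\<^sub>R abs_L2 ?\<theta>) / norm (S i)
        = sqrt (LINT y|lborel. (norm (?\<theta> y - g (S i) y))\<^sup>2)" for i
    proof -
      have "weyl eps (S i *\<^sub>R X) (abs_L2 \<psi>) - weyl eps (0 *\<^sub>R X) (abs_L2 \<psi>) - S i *\<^sub>R abs_L2 ?\<theta> =
          abs_L2 (\<lambda>y. weyl_fun eps (S i *\<^sub>R X) \<psi> y - \<psi> y - of_real (S i) * ?\<theta> y)"
        using sq by (simp add: weyl_zero weyl_abs_L2 scaleR_abs_L2 abs_L2_diff square_integrable_weyl_fun
            square_integrable_diff square_integrable_mult)
      also have "(\<lambda>y. weyl_fun eps (S i *\<^sub>R X) \<psi> y - \<psi> y - of_real (S i) * ?\<theta> y) =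
          (\<lambda>y. of_real (- S i) * (?\<theta> y - g (S i) y))"
        using S0[of i] by (simp add: g_def fun_eq_iff field_simps)
      also have "abs_L2 \<dots> = (- S i) *\<^sub>R abs_L2 (\<lambda>y. ?\<theta> y - g (S i) y)"
        by (intro scaleR_abs_L2[symmetric] square_integrable_diff gs sq)
      finally have "norm (weyl eps (S i *\<^sub>R X) (abs_L2 \<psi>) - weyl eps (0 *\<^sub>R X) (abs_L2 \<psi>) - S i *\<^sub>R abs_L2 ?\<theta>) / norm (S i)
          = norm (abs_L2 (\<lambda>y. ?\<theta> y - g (S i) y))"
        using S0[of i] by simp
      also have "\<dots> = sqrt ((norm (abs_L2 (\<lambda>y. ?\<theta> y - g (S i) y)))\<^sup>2)" by simp
      finally show ?thesis
        by (simp only: norm_abs_L2_sq[OF square_integrable_diff[OF sq(2) gs]])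
    qed
    ultimately have "(\<lambda>i. norm (weyl eps (S i *\<^sub>R X) (abs_L2 \<psi>) - weyl eps (0 *\<^sub>R X) (abs_L2 \<psi>) - S i *\<^sub>R abs_L2 ?\<theta>) / norm (S i)) \<longlonglongrightarrow> 0"
      by simp
    then show ?thesis
      unfolding S_def o_def add_0 by (rule LIMSEQ_offset)
  qed
  then have "(\<lambda>h. norm (weyl eps ((0 + h) *\<^sub>R X) (abs_L2 \<psi>) - weyl eps (0 *\<^sub>R X) (abs_L2 \<psi>) - h *\<^sub>R abs_L2 ?\<theta>) / norm h) \<midarrow>0\<rightarrow> 0"
    by (auto simp: tendsto_at_iff_sequentially)
  then show ?thesis
    unfolding has_vector_derivative_def has_derivative_at by (intro conjI bounded_linear_scaleR_left)
qed

text \<open>Strong continuity at 0 holds on Schwartz vectors by differentiability and extends to all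
  vectors by density and isometry; the group law carries it to every \<open>s\<close>.\<close>

lemma unitary_group_weyl: "unitary_group (\<lambda>t. weyl eps (t *\<^sub>R X))"
  unfolding unitary_group_def
proof (intro conjI allI)
  show "unitary (weyl eps (t *\<^sub>R X))" for t by (rule unitary_weyl)
  show "weyl eps (0 *\<^sub>R X) = id" by (simp add: fun_eq_iff weyl_zero)
  show mult: "weyl eps ((s + t) *\<^sub>R X) = weyl eps (s *\<^sub>R X) \<circ> weyl eps (t *\<^sub>R X)" for s t
    by (simp add: fun_eq_iff weyl_mult symp_form_simps scaleC_one scaleR_add_left)
  have at0: "((\<lambda>t. weyl eps (t *\<^sub>R X) \<phi>) \<longlongrightarrow> \<phi>) (at 0)" for \<phi>
  proof (rule tendstoI)
    fix e :: real assume "e > 0"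
    then obtain \<psi> where \<psi>: "schwartz \<psi>" "norm (\<phi> - abs_L2 \<psi>) < e / 3"
      using schwartz_dense_L2[of "e / 3" \<phi>] by auto
    have "isCont (\<lambda>t. weyl eps (t *\<^sub>R X) (abs_L2 \<psi>)) 0"
      using weyl_L2_has_vector_derivative[OF \<psi>(1)] by (rule has_vector_derivative_continuous)
    then have "((\<lambda>t. weyl eps (t *\<^sub>R X) (abs_L2 \<psi>)) \<longlongrightarrow> abs_L2 \<psi>) (at 0)"
      by (simp add: isCont_def weyl_zero)
    then have "\<forall>\<^sub>F t in at 0. dist (weyl eps (t *\<^sub>R X) (abs_L2 \<psi>)) (abs_L2 \<psi>) < e / 3"
      using \<open>e > 0\<close> by (intro tendstoD) auto
    then show "\<forall>\<^sub>F t in at 0. dist (weyl eps (t *\<^sub>R X) \<phi>) \<phi> < e"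
    proof eventually_elim
      case (elim t)
      let ?U = "weyl eps (t *\<^sub>R X)"
      have "?U \<phi> - \<phi> = ?U (\<phi> - abs_L2 \<psi>) + (?U (abs_L2 \<psi>) - abs_L2 \<psi>) - (\<phi> - abs_L2 \<psi>)"
        by (simp add: unitaryD(4)[OF unitary_weyl])
      moreover have "norm (a + b - c) \<le> norm a + norm b + norm c" for a b c :: "(real^'a) L2"
        using norm_triangle_ineq4[of "a + b" c] norm_triangle_ineq[of a b] by argo
      ultimately have "norm (?U \<phi> - \<phi>) \<le> norm (?U (\<phi> - abs_L2 \<psi>)) + norm (?U (abs_L2 \<psi>) - abs_L2 \<psi>) + norm (\<phi> - abs_L2 \<psi>)"
        by (simp only:)
      then show ?case using elim \<psi>(2) by (simp add: dist_norm unitaryD(5)[OF unitary_weyl])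
    qed
  qed
  show "continuous_on UNIV (\<lambda>t. weyl eps (t *\<^sub>R X) \<phi>)" for \<phi>
  proof (rule continuous_at_imp_continuous_on, rule ballI)
    fix s
    have "((\<lambda>h. weyl eps (s *\<^sub>R X) (weyl eps (h *\<^sub>R X) \<phi>)) \<longlongrightarrow> weyl eps (s *\<^sub>R X) \<phi>) (at 0)"
    proof (rule tendstoI)
      fix e :: real assume "e > 0"
      have "dist (weyl eps (s *\<^sub>R X) \<theta>) (weyl eps (s *\<^sub>R X) \<theta>') = dist \<theta> \<theta>'" for \<theta> \<theta>'
        by (simp add: dist_norm unitaryD(5)[OF unitary_weyl] flip: unitaryD(4)[OF unitary_weyl])
      then show "\<forall>\<^sub>F h in at 0. dist (weyl eps (s *\<^sub>R X) (weyl eps (h *\<^sub>R X) \<phi>)) (weyl eps (s *\<^sub>R X) \<phi>) < e"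
        using tendstoD[OF at0 \<open>e > 0\<close>] by simp
    qed
    then show "isCont (\<lambda>t. weyl eps (t *\<^sub>R X) \<phi>) s"
      unfolding isCont_iff mult o_def .
  qed
qed

text \<open>The curve V(-t) U(t) \<open>\<psi>\<close> has derivative zero: at time s the vector
  U(s) \<open>\<psi>\<close> is again some Schwartz \<open>\<theta>\<close>, on which both groups
  have the same derivative. Invariance is asked of \<open>U\<close> alone because \<open>V\<close>
  will be an arbitrary competitor. Density extends the equality to all vectors.\<close>

lemma unitary_group_unique:
  fixes U V :: "real \<Rightarrow> 'a::euclidean_space L2 \<Rightarrow> 'a L2"
  assumes U: "unitary_group U" and V: "unitary_group V"
    and dU: "\<And>\<psi>. schwartz \<psi> \<Longrightarrow> ((\<lambda>t. U t (abs_L2 \<psi>)) has_vector_derivative A \<psi>) (at 0)"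
    and dV: "\<And>\<psi>. schwartz \<psi> \<Longrightarrow> ((\<lambda>t. V t (abs_L2 \<psi>)) has_vector_derivative A \<psi>) (at 0)"
    and inv: "\<And>\<psi> t. schwartz \<psi> \<Longrightarrow> \<exists>\<theta>. schwartz \<theta> \<and> U t (abs_L2 \<psi>) = abs_L2 \<theta>"
  shows "U t = V t"
proof -
  have uU: "unitary (U t)" and uV: "unitary (V t)" for t
    using U V by (auto simp: unitary_group_def)
  have mU: "U (s + t) \<phi> = U s (U t \<phi>)" and mV: "V (s + t) \<phi> = V s (V t \<phi>)"
    and zU: "U 0 \<phi> = \<phi>" and zV: "V 0 \<phi> = \<phi>" for s t \<phi>
    using U V by (auto simp: unitary_group_def)
  have S: "U t (abs_L2 \<psi>) = V t (abs_L2 \<psi>)" if \<psi>: "schwartz \<psi>" for \<psi> t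
  proof -
    define m where "m t = V (- t) (U t (abs_L2 \<psi>))" for t
    have "(m has_derivative (\<lambda>h. 0)) (at s)" for s
    proof -
      obtain \<theta> where \<theta>: "schwartz \<theta>" "U s (abs_L2 \<psi>) = abs_L2 \<theta>"
        using inv[OF \<psi>] by blast
      have "((\<lambda>h. U h (abs_L2 \<theta>) - V h (abs_L2 \<theta>)) has_vector_derivative A \<theta> - A \<theta>) (at 0)"
        by (intro has_vector_derivative_diff dU dV \<theta>)
      then have "(\<lambda>h. norm (U h (abs_L2 \<theta>) - V h (abs_L2 \<theta>)) / norm h) \<midarrow>0\<rightarrow> 0"
        unfolding has_vector_derivative_def has_derivative_at by (simp add: zU zV)
      \<comment> \<open>The increment is V(-s) V(-h) applied to U(h) \<open>\<theta>\<close> - V(h)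
        \<open>\<theta>\<close>, and the outer operators are isometries; this takes the place of a
        product rule.\<close>
      moreover have "norm (m (s + h) - m s - 0) = norm (U h (abs_L2 \<theta>) - V h (abs_L2 \<theta>))" for h
      proof -
        have "m (s + h) = V (- s) (V (- h) (U h (abs_L2 \<theta>)))"
          unfolding m_def \<theta>(2)[symmetric] mU[symmetric] mV[symmetric] by (simp add: add.commute)
        moreover have "m s = V (- s) (V (- h) (V h (abs_L2 \<theta>)))"
          unfolding m_def \<theta>(2) mV[symmetric] by simp
        ultimately have "m (s + h) - m s = V (- s) (V (- h) (U h (abs_L2 \<theta>) - V h (abs_L2 \<theta>)))"
          by (simp add: unitaryD(4)[OF uV])
        then show ?thesis by (simp add: unitaryD(5)[OF uV])
      qed
      ultimately show ?thesis
        unfolding has_derivative_at by (simp add: bounded_linear_zero)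
    qed
    then have "m t = m 0"
      by (intro has_derivative_zero_unique[of UNIV m]) auto
    then have "V t (V (- t) (U t (abs_L2 \<psi>))) = V t (abs_L2 \<psi>)"
      by (simp add: m_def zU zV)
    then show ?thesis by (simp add: mV[symmetric] zV)
  qed
  have "U t \<phi> = V t \<phi>" for \<phi>
  proof (rule ccontr)
    assume "U t \<phi> \<noteq> V t \<phi>"
    then have e: "norm (U t \<phi> - V t \<phi>) / 2 > 0" by simp
    obtain \<psi> where \<psi>: "schwartz \<psi>" "norm (\<phi> - abs_L2 \<psi>) < norm (U t \<phi> - V t \<phi>) / 2"
      using schwartz_dense_L2[OF e] by blast
    have "U t \<phi> - V t \<phi> = U t (\<phi> - abs_L2 \<psi>) - V t (\<phi> - abs_L2 \<psi>)"
      using S[OF \<psi>(1)] by (simp add: unitaryD(4)[OF uU] unitaryD(4)[OF uV])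
    then have "norm (U t \<phi> - V t \<phi>) \<le> norm (U t (\<phi> - abs_L2 \<psi>)) + norm (V t (\<phi> - abs_L2 \<psi>))"
      by (simp only: norm_triangle_ineq4)
    then show False using \<psi>(2) by (simp add: unitaryD(5)[OF uU] unitaryD(5)[OF uV])
  qed
  then show ?thesis by blast
qed

text \<open>Evaluates the definite description: the explicit group is one candidate, and it takes
  the role of the invariant group in \<open>unitary_group_unique\<close> against any other.\<close>

lemma weyl_system_eq: "weyl_system eps X = weyl eps X"
  for X :: "'d::finite phase_space"
proof -
  let ?A = "\<lambda>\<psi> y. \<Sum>j\<in>UNIV. complex_of_real (snd X $ j) * Q_op j \<psi> y - complex_of_real (fst X $ j) * P_op eps j \<psi> y"
  let ?gen = "\<lambda>U. \<forall>\<psi>. schwartz \<psi> \<longrightarrow> ((\<lambda>t. U t (abs_L2 \<psi>)) has_vector_derivative scaleC (- \<i>) (abs_L2 (?A \<psi>))) (at 0)"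
  have A: "scaleC (- \<i>) (abs_L2 (?A \<psi>)) = abs_L2 (weyl_generator eps X \<psi>)" if "schwartz \<psi>" for \<psi>
  proof -
    have eq: "?A \<psi> = (\<lambda>y. \<i> * weyl_generator eps X \<psi> y)"
      unfolding weyl_generator_eq[OF that] by (simp add: fun_eq_iff flip: mult.assoc)
    have "schwartz (?A \<psi>)"
      unfolding eq by (intro schwartz_cmult schwartz_weyl_generator that)
    then show ?thesis
      by (simp only: scaleC_abs_L2 schwartz_square_integrable weyl_generator_eq[OF that])
  qed
  have gen: "?gen (\<lambda>t. weyl eps (t *\<^sub>R X))"
    by (intro allI impI) (simp only: A weyl_L2_has_vector_derivative)
  show ?thesis
    unfolding weyl_system_def exp_minus_i_def
  proof (rule the_equality)
    show "\<exists>U. unitary_group U \<and> ?gen U \<and> weyl eps X = U 1"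
      using unitary_group_weyl gen by (intro exI[of _ "\<lambda>t. weyl eps (t *\<^sub>R X)"]) simp
    fix V assume "\<exists>U. unitary_group U \<and> ?gen U \<and> V = U 1"
    then obtain U where U: "unitary_group U" "?gen U" "V = U 1" by blast
    have "weyl eps (1 *\<^sub>R X) = U 1"
    proof (rule unitary_group_unique[where U = "\<lambda>t. weyl eps (t *\<^sub>R X)" and V = U])
      show "\<exists>\<theta>. schwartz \<theta> \<and> weyl eps (t *\<^sub>R X) (abs_L2 \<psi>) = abs_L2 \<theta>" if "schwartz \<psi>" for \<psi> t
        using that schwartz_weyl_fun weyl_abs_L2[OF schwartz_square_integrable[OF that]] by blast
      show "((\<lambda>t. weyl eps (t *\<^sub>R X) (abs_L2 \<psi>)) has_vector_derivative scaleC (- \<i>) (abs_L2 (?A \<psi>))) (at 0)"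
        if "schwartz \<psi>" for \<psi> using gen that by blast
      show "((\<lambda>t. U t (abs_L2 \<psi>)) has_vector_derivative scaleC (- \<i>) (abs_L2 (?A \<psi>))) (at 0)"
        if "schwartz \<psi>" for \<psi> using U(2) that by blast
    qed (intro unitary_group_weyl U)+
    then show "V = weyl eps X" using U(3) by simp
  qed
qed

subsection \<open>Integrated Weyl operators\<close>

text \<open>Expands the nonnegative integral of \<open>g x * (h x - m)\<^sup>2\<close> at a nearly
  optimal \<open>m\<close>; the added 1 avoids dividing by a vanishing total mass.\<close>

lemma integral_weighted_Cauchy_Schwarz:
  fixes g h :: "'w \<Rightarrow> real"
  assumes nn: "\<And>x. g x \<ge> 0" and g: "integrable M g" and gh: "integrable M (\<lambda>x. g x * h x)"
    and ghh: "integrable M (\<lambda>x. g x * (h x)\<^sup>2)"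
  shows "(LINT x|M. g x * h x)\<^sup>2 \<le> ((LINT x|M. g x) + 1) * (LINT x|M. g x * (h x)\<^sup>2)"
proof -
  let ?I = "LINT x|M. g x * h x" and ?N = "LINT x|M. g x * (h x)\<^sup>2" and ?G = "LINT x|M. g x"
  have G: "?G \<ge> 0" using nn by simp
  define m where "m = ?I / (?G + 1)"
  have "0 \<le> (LINT x|M. g x * (h x - m)\<^sup>2)" using nn by simp
  also have "\<dots> = (LINT x|M. g x * (h x)\<^sup>2 - 2 * m * (g x * h x) + m\<^sup>2 * g x)"
    by (simp add: power2_diff algebra_simps)
  also have "\<dots> = ?N - 2 * m * ?I + m\<^sup>2 * ?G"
    using g gh ghh by simp
  also have "\<dots> \<le> ?N - 2 * m * ?I + m\<^sup>2 * (?G + 1)"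
    by (simp add: algebra_simps)
  also have "m\<^sup>2 * (?G + 1) = m * ?I"
    using G by (simp add: m_def power2_eq_square)
  finally have "m * ?I \<le> ?N" by simp
  then show ?thesis
    using G by (simp add: m_def power2_eq_square pos_divide_le_eq mult.commute)
qed

lemma measurable_weyl_fun_pair [measurable (raw)]:
  fixes a :: "'w \<Rightarrow> 'd::finite phase_space"
  assumes [measurable]: "f \<in> borel_measurable borel" "a \<in> borel_measurable M" "b \<in> borel_measurable M"
  shows "(\<lambda>x. weyl_fun eps (a x) f (b x)) \<in> borel_measurable M"
proof -
  have "(fst :: 'd phase_space \<Rightarrow> _) \<in> borel_measurable borel" "(snd :: 'd phase_space \<Rightarrow> _) \<in> borel_measurable borel"
    by (auto intro!: borel_measurable_continuous_onI continuous_intros)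
  from measurable_compose[OF assms(2) this(1)] measurable_compose[OF assms(2) this(2)]
  have [measurable]: "(\<lambda>x. fst (a x)) \<in> borel_measurable M" "(\<lambda>x. snd (a x)) \<in> borel_measurable M"
    by auto
  define p q where "p x = fst (a x)" and "q x = snd (a x)" for x
  have [measurable]: "p \<in> borel_measurable M" "q \<in> borel_measurable M"
    unfolding p_def q_def by simp_all
  have "(\<lambda>x. iexp (- (q x \<bullet> b x + eps / 2 * (q x \<bullet> p x))) * f (b x + eps *\<^sub>R p x)) \<in> borel_measurable M"
    by measurable
  then show ?thesis unfolding weyl_fun_def p_def q_def .
qed

lemma integral_weyl_fun_sq:
  assumes "square_integrable f"
  shows "(LINT y|lborel. (norm (weyl_fun eps X f y))\<^sup>2) = (LINT y|lborel. (norm (f y))\<^sup>2)"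
  using norm_abs_L2_sq[OF assms] norm_abs_L2_sq[OF square_integrable_weyl_fun[OF assms, of eps X]]
    unitaryD(5)[OF unitary_weyl, of eps X "abs_L2 f"]
  by (simp add: weyl_abs_L2[OF assms])

lemma integrable_weyl_pair_sq:
  fixes G :: "'d::finite phase_space \<Rightarrow> complex"
  assumes G: "integrable lborel G" and f: "square_integrable f"
  shows "integrable (lborel \<Otimes>\<^sub>M lborel) (\<lambda>(X, y). norm (G X) * (norm (weyl_fun eps X f y))\<^sup>2)"
proof (rule lborel_pair.Fubini_integrable)
  have [measurable]: "f \<in> borel_measurable borel" "G \<in> borel_measurable borel"
    using f G by (auto simp: square_integrable_def)
  show "(\<lambda>(X, y). norm (G X) * (norm (weyl_fun eps X f y))\<^sup>2) \<in> borel_measurable (lborel \<Otimes>\<^sub>M lborel)"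
    by measurable
  show "integrable lborel (\<lambda>X. LINT y|lborel. norm (case (X, y) of (X, y) \<Rightarrow> norm (G X) * (norm (weyl_fun eps X f y))\<^sup>2))"
    using G by (simp add: integral_weyl_fun_sq[OF f])
  show "AE X in lborel. integrable lborel (\<lambda>y. case (X, y) of (X, y) \<Rightarrow> norm (G X) * (norm (weyl_fun eps X f y))\<^sup>2)"
    by (simp add: square_integrable_norm[OF square_integrable_weyl_fun[OF f]])
qed

text \<open>The product of the two square-integrable factors is at most the sum of their squares.
  Both squares are integrable against |G|, the second because the Weyl operators preserve the
  norm.\<close>

lemma integrable_cinner_weyl_pair:
  fixes G :: "'d::finite phase_space \<Rightarrow> complex"
  assumes G: "integrable lborel G" and f: "square_integrable f" and g: "square_integrable g"
  shows "integrable (lborel \<Otimes>\<^sub>M lborel) (\<lambda>(X, y). cnj (g y) * (G X * weyl_fun eps X f y))"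
proof (rule Bochner_Integration.integrable_bound)
  have [measurable]: "f \<in> borel_measurable borel" "g \<in> borel_measurable borel" "G \<in> borel_measurable borel"
    using f g G by (auto simp: square_integrable_def)
  have "integrable (lborel \<Otimes>\<^sub>M lborel) (\<lambda>p. norm (G (fst p) * of_real ((norm (g (snd p)))\<^sup>2)))"
    by (intro integrable_norm integrable_tensor[of G "\<lambda>y. of_real ((norm (g y))\<^sup>2)"] G integrable_of_real square_integrable_norm g)
  moreover have "(\<lambda>p. norm (G (fst p) * of_real ((norm (g (snd p)))\<^sup>2))) = (\<lambda>(X, y). norm (G X) * (norm (g y))\<^sup>2)"
    by (simp add: fun_eq_iff norm_mult norm_power)
  ultimately show "integrable (lborel \<Otimes>\<^sub>M lborel)
      (\<lambda>p. (\<lambda>(X, y). norm (G X) * (norm (g y))\<^sup>2) p + (\<lambda>(X, y). norm (G X) * (norm (weyl_fun eps X f y))\<^sup>2) p)"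
    by (intro Bochner_Integration.integrable_add integrable_weyl_pair_sq G f) simp
  show "(\<lambda>(X, y). cnj (g y) * (G X * weyl_fun eps X f y)) \<in> borel_measurable (lborel \<Otimes>\<^sub>M lborel)"
    by measurable
  have *: "a * b \<le> a\<^sup>2 + b\<^sup>2" for a b :: real
    using zero_le_power2[of "a - b"] zero_le_power2[of a] zero_le_power2[of b] unfolding power2_diff by argo
  have "norm (cnj (g y) * (G X * weyl_fun eps X f y)) \<le>
      norm (G X) * (norm (g y))\<^sup>2 + norm (G X) * (norm (weyl_fun eps X f y))\<^sup>2" for X y
    using mult_left_mono[OF *[of "norm (g y)" "norm (weyl_fun eps X f y)"], of "norm (G X)"]
    by (simp add: norm_mult distrib_left mult_ac)
  then show "AE p in lborel \<Otimes>\<^sub>M lborel. norm ((\<lambda>(X, y). cnj (g y) * (G X * weyl_fun eps X f y)) p) \<le>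
      norm ((\<lambda>(X, y). norm (G X) * (norm (g y))\<^sup>2) p + (\<lambda>(X, y). norm (G X) * (norm (weyl_fun eps X f y))\<^sup>2) p)"
    by (intro AE_I2) (auto intro: order_trans[OF _ abs_ge_self])
qed

lemma measurable_cinner_weyl [measurable]:
  "(\<lambda>X. cinner \<phi> (weyl eps X \<psi>)) \<in> borel_measurable borel"
  for \<phi> \<psi> :: "(real^'d::finite) L2"
proof -
  obtain g where g: "square_integrable g" "\<phi> = abs_L2 g" by (rule L2_cases)
  obtain f where f: "square_integrable f" "\<psi> = abs_L2 f" by (rule L2_cases)
  have [measurable]: "f \<in> borel_measurable borel" "g \<in> borel_measurable borel"
    using f g by (auto simp: square_integrable_def)
  have "(\<lambda>X. LINT y|lborel. cnj (g y) * weyl_fun eps X f y) \<in> borel_measurable lborel"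
    by (rule lborel.borel_measurable_lebesgue_integral) measurable
  moreover have "cinner \<phi> (weyl eps X \<psi>) = (LINT y|lborel. cnj (g y) * weyl_fun eps X f y)" for X
    using f(1) g(1) unfolding f(2) g(2) by (simp add: weyl_abs_L2 cinner_abs_L2 square_integrable_weyl_fun)
  ultimately show ?thesis by simp
qed

lemma norm_cinner_weyl_le: "norm (cinner \<phi> (weyl eps X \<psi>)) \<le> norm \<phi> * norm \<psi>"
  using norm_cinner_le[of \<phi> "weyl eps X \<psi>"] by (simp add: unitaryD(5)[OF unitary_weyl])

lemma integrable_mult_cinner_weyl:
  assumes "integrable lborel G"
  shows "integrable lborel (\<lambda>X. G X * cinner \<phi> (weyl eps X \<psi>))"
proof (rule Bochner_Integration.integrable_bound)
  have [measurable]: "G \<in> borel_measurable borel" using assms by auto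
  show "integrable lborel (\<lambda>X. norm (G X) * (norm \<phi> * norm \<psi>))"
    using assms by simp
  show "AE X in lborel. norm (G X * cinner \<phi> (weyl eps X \<psi>)) \<le> norm (norm (G X) * (norm \<phi> * norm \<psi>))"
    by (intro AE_I2) (simp add: norm_mult mult_left_mono norm_cinner_weyl_le)
  show "(\<lambda>X. G X * cinner \<phi> (weyl eps X \<psi>)) \<in> borel_measurable lborel" by measurable
qed

text \<open>The vector is the pointwise integral of \<open>G X * weyl_fun eps X f y\<close> over X.
  Cauchy-Schwarz with weight |G| bounds its square by a constant times the integral of |G| |W(X)
  f|^2 over X, which is integrable in y; Fubini then yields the weak identity.\<close>

lemma weyl_integral_exists:
  fixes G :: "'d::finite phase_space \<Rightarrow> complex"
  assumes G: "integrable lborel G"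
  shows "\<exists>\<theta>. \<forall>\<phi>. cinner \<phi> \<theta> = (LINT X|lborel. G X * cinner \<phi> (weyl eps X \<psi>))"
proof -
  obtain f where f: "square_integrable f" "\<psi> = abs_L2 f" by (rule L2_cases)
  have [measurable]: "f \<in> borel_measurable borel" "G \<in> borel_measurable borel"
    using f G by (auto simp: square_integrable_def)
  let ?c = "(LINT X|lborel. norm (G X)) + 1"
  let ?N = "\<lambda>y. LINT X|lborel. norm (G X) * (norm (weyl_fun eps X f y))\<^sup>2"
  define u where "u y = (LINT X|lborel. G X * weyl_fun eps X f y)" for y
  have um: "u \<in> borel_measurable borel"
  proof -
    have "(\<lambda>y. LINT X|lborel. G X * weyl_fun eps X f y) \<in> borel_measurable lborel"
    proof (rule lborel.borel_measurable_lebesgue_integral)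
      show "(\<lambda>(y, X). G X * weyl_fun eps X f y) \<in> borel_measurable (lborel \<Otimes>\<^sub>M lborel)"
        by measurable
    qed
    then show ?thesis by (simp add: u_def[abs_def])
  qed
  have N: "integrable lborel ?N"
    using lborel_pair.integrable_snd[OF integrable_weyl_pair_sq[OF G f(1), of eps]] by simp
  \<comment> \<open>For these \<open>y\<close> the integral defining \<open>u y\<close> converges
    absolutely; on the remaining null set its value does not matter.\<close>
  have "AE y in lborel. integrable lborel (\<lambda>X. norm (G X) * (norm (weyl_fun eps X f y))\<^sup>2)"
    using lborel_pair.AE_integrable_snd[OF integrable_weyl_pair_sq[OF G f(1), of eps]] by simp
  then have le: "AE y in lborel. (norm (u y))\<^sup>2 \<le> ?c * ?N y"
  proof eventually_elim
    case (elim y)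
    have m: "(\<lambda>X. weyl_fun eps X f y) \<in> borel_measurable lborel"
      by measurable
    have i: "integrable lborel (\<lambda>X. norm (G X) * norm (weyl_fun eps X f y))"
    proof (rule Bochner_Integration.integrable_bound)
      show "integrable lborel (\<lambda>X. norm (G X) + norm (G X) * (norm (weyl_fun eps X f y))\<^sup>2)"
        using elim G by simp
      have *: "b \<le> 1 + b\<^sup>2" for b :: real
        using zero_le_power2[of "b - 1"] zero_le_power2[of b] unfolding power2_diff power_one by argo
      have "norm (G X) * norm (weyl_fun eps X f y) \<le> norm (G X) + norm (G X) * (norm (weyl_fun eps X f y))\<^sup>2" for X
        using mult_left_mono[OF *[of "norm (weyl_fun eps X f y)"], of "norm (G X)"] by (simp add: distrib_left)
      then show "AE X in lborel. norm (norm (G X) * norm (weyl_fun eps X f y)) \<le>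
          norm (norm (G X) + norm (G X) * (norm (weyl_fun eps X f y))\<^sup>2)"
        by (intro AE_I2) (auto intro: order_trans[OF _ abs_ge_self])
    qed (use m in measurable)
    have "norm (u y) \<le> (LINT X|lborel. norm (G X) * norm (weyl_fun eps X f y))"
      unfolding u_def by (rule order_trans[OF integral_norm_bound]) (simp add: norm_mult)
    then have "(norm (u y))\<^sup>2 \<le> (LINT X|lborel. norm (G X) * norm (weyl_fun eps X f y))\<^sup>2"
      by (intro power_mono) auto
    also have "\<dots> \<le> ?c * ?N y"
      using G i elim by (intro integral_weighted_Cauchy_Schwarz) auto
    finally show ?case .
  qed
  have u: "square_integrable u"
    unfolding square_integrable_def
  proof
    show "u \<in> borel_measurable lborel" using um by simp
    show "integrable lborel (\<lambda>y. (norm (u y))\<^sup>2)"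
    proof (rule Bochner_Integration.integrable_bound)
      show "integrable lborel (\<lambda>y. ?c * ?N y)" using N by simp
      show "AE y in lborel. norm ((norm (u y))\<^sup>2) \<le> norm (?c * ?N y)"
        using le by eventually_elim (auto intro: order_trans[OF _ abs_ge_self])
      show "(\<lambda>y. (norm (u y))\<^sup>2) \<in> borel_measurable lborel" using um by simp
    qed
  qed
  have "cinner \<phi> (abs_L2 u) = (LINT X|lborel. G X * cinner \<phi> (weyl eps X \<psi>))" for \<phi>
  proof -
    obtain g where g: "square_integrable g" "\<phi> = abs_L2 g" by (rule L2_cases)
    have "cinner \<phi> (abs_L2 u) = (LINT y|lborel. cnj (g y) * u y)"
      using g u by (simp add: cinner_abs_L2)
    also have "\<dots> = (LINT y|lborel. LINT X|lborel. cnj (g y) * (G X * weyl_fun eps X f y))"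
      by (simp add: u_def)
    also have "\<dots> = (LINT X|lborel. LINT y|lborel. cnj (g y) * (G X * weyl_fun eps X f y))"
      by (rule lborel_pair.Fubini_integral[OF integrable_cinner_weyl_pair[OF G f(1) g(1)]])
    also have "\<dots> = (LINT X|lborel. G X * cinner \<phi> (weyl eps X \<psi>))"
      using g f by (simp add: cinner_abs_L2 weyl_abs_L2 square_integrable_weyl_fun mult.left_commute)
    finally show ?thesis .
  qed
  then show ?thesis by blast
qed

lemma weyl_integral_blinfun_exists:
  fixes G :: "'d::finite phase_space \<Rightarrow> complex"
  assumes G: "integrable lborel G"
  shows "\<exists>A. \<forall>\<phi> \<psi>. cinner \<phi> (blinfun_apply A \<psi>) = (LINT X|lborel. G X * cinner \<phi> (weyl eps X \<psi>))"
proof -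
  obtain B where B: "\<And>\<phi> \<psi>. cinner \<phi> (B \<psi>) = (LINT X|lborel. G X * cinner \<phi> (weyl eps X \<psi>))"
    using weyl_integral_exists[OF G, of eps] by metis
  have "bounded_linear B"
  proof (rule bounded_linear_intro[where K = "LINT X|lborel. norm (G X)"])
    show "B (\<phi> + \<psi>) = B \<phi> + B \<psi>" for \<phi> \<psi>
      by (rule L2_eqI_cinner)
        (simp add: B cinner_add_right unitaryD(1)[OF unitary_weyl] distrib_left integrable_mult_cinner_weyl G)
    show "B (r *\<^sub>R \<psi>) = r *\<^sub>R B \<psi>" for r \<psi>
      by (rule L2_eqI_cinner)
        (simp only: B scaleR_L2_def cinner_scaleC_right unitaryD(2)[OF unitary_weyl]
          mult.left_commute[of _ "complex_of_real r"] integral_mult_right_zero)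
    \<comment> \<open>Testing the weak identity against \<open>B \<psi>\<close> itself bounds the
      square of its norm, and one factor \<open>norm (B \<psi>)\<close> cancels.\<close>
    show "norm (B \<psi>) \<le> norm \<psi> * (LINT X|lborel. norm (G X))" for \<psi>
    proof (cases "norm (B \<psi>) = 0")
      case False
      have "(norm (B \<psi>))\<^sup>2 = norm (cinner (B \<psi>) (B \<psi>))"
        by (simp add: cinner_same norm_power)
      also have "\<dots> \<le> (LINT X|lborel. norm (G X * cinner (B \<psi>) (weyl eps X \<psi>)))"
        unfolding B by (rule integral_norm_bound)
      also have "\<dots> \<le> (LINT X|lborel. norm (G X) * (norm (B \<psi>) * norm \<psi>))"
        using G by (intro integral_mono integrable_norm integrable_mult_cinner_weyl)
          (simp_all add: norm_mult mult_left_mono norm_cinner_weyl_le)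
      also have "\<dots> = norm (B \<psi>) * (norm \<psi> * (LINT X|lborel. norm (G X)))"
        by simp
      finally show ?thesis
        using False by (simp add: power2_eq_square)
    qed (auto intro!: mult_nonneg_nonneg)
  qed
  then show ?thesis
    using B by (intro exI[of _ "Blinfun B"]) (simp add: bounded_linear_Blinfun_apply)
qed

text \<open>Unfolds the definite description \<open>weyl_op\<close>: integrability of the transform
  gives existence, and prescribing all matrix elements determines the operator.\<close>

lemma cinner_weyl_op:
  fixes f :: "'d::finite phase_space \<Rightarrow> complex"
  assumes f: "schwartz f"
  shows "cinner \<phi> (blinfun_apply (weyl_op eps f) \<psi>) = complex_of_real (1 / (2 * pi) ^ CARD('d)) *
    (LINT X|lborel. symp_fourier f X * cinner \<phi> (weyl eps X \<psi>))"
proof -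
  let ?c = "complex_of_real (1 / (2 * pi) ^ CARD('d))"
  let ?P = "\<lambda>A. \<forall>\<phi> \<psi>. cinner \<phi> (blinfun_apply A \<psi>) = ?c * (LINT X|lborel. symp_fourier f X * cinner \<phi> (weyl eps X \<psi>))"
  have "integrable lborel (\<lambda>X. ?c * symp_fourier f X)"
    by (intro integrable_mult_right schwartz_integrable schwartz_symp_fourier f)
  from weyl_integral_blinfun_exists[OF this, of eps] obtain A where A: "?P A"
    by (auto simp: mult.assoc simp del: times_divide_eq_left)
  have "A' = A" if "?P A'" for A'
    by (rule blinfun_eqI, rule L2_eqI_cinner) (simp only: that A)
  with A have "(THE A. ?P A) = A" by (rule the_equality)
  then have "weyl_op eps f = A" unfolding weyl_op_def weyl_system_eq .
  then show ?thesis using A by blast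
qed

lemma weyl_op_eqI:
  fixes A :: "(real^'d::finite) L2 \<Rightarrow>\<^sub>L (real^'d) L2"
  assumes f: "schwartz f"
    and A: "\<And>\<phi> \<psi>. cinner \<phi> (blinfun_apply A \<psi>) = complex_of_real (1 / (2 * pi) ^ CARD('d)) *
    (LINT X|lborel. symp_fourier f X * cinner \<phi> (weyl eps X \<psi>))"
  shows "weyl_op eps f = A"
  by (rule blinfun_eqI, rule L2_eqI_cinner) (simp only: cinner_weyl_op[OF f] A)

subsection \<open>Twisted convolution\<close>

text \<open>Here \<open>X\<close> is the sum of the two Weyl arguments and \<open>Y\<close> the
  first of them; the phase uses \<sigma>(Y, X - Y) = \<sigma>(Y, X).\<close>

definition twisted_kernel ::
    "real \<Rightarrow> ('d::finite phase_space \<Rightarrow> complex) \<Rightarrow> ('d phase_space \<Rightarrow> complex) \<Rightarrow> 'd phase_space \<times> 'd phase_space \<Rightarrow> complex" where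
  "twisted_kernel eps F G = (\<lambda>(X, Y). iexp (eps / 2 * symp_form Y X) * (G (X - Y) * F Y))"

definition twisted_convolution ::
    "real \<Rightarrow> ('d::finite phase_space \<Rightarrow> complex) \<Rightarrow> ('d phase_space \<Rightarrow> complex) \<Rightarrow> 'd phase_space \<Rightarrow> complex" where
  "twisted_convolution eps F G X = complex_of_real (1 / (2 * pi) ^ CARD('d)) * (LINT Y|lborel. twisted_kernel eps F G (X, Y))"

text \<open>A Schwartz tensor product composed with (X, Y) |-> (X - Y, Y), times a phase that is a
  multiplier. The factor \<open>c = 3\<close> comes from |X| + |Y| <= |X - Y| + 2 |Y|.\<close>

lemma schwartz_twisted_kernel:
  assumes F: "schwartz F" and G: "schwartz G"
  shows "schwartz (twisted_kernel eps F G)"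
proof -
  have "schwartz (\<lambda>p. (\<lambda>q. G (fst q) * F (snd q)) ((fst p - snd p, snd p) + 0))"
  proof (rule schwartz_affine[where c = 3 and L = "\<lambda>p. (fst p - snd p, snd p)"])
    show "schwartz (\<lambda>q. G (fst q) * F (snd q))" by (rule schwartz_tensor[OF G F])
    show "bounded_linear (\<lambda>p. (fst p - snd p, snd p))"
      by (intro bounded_linear_Pair bounded_linear_sub bounded_linear_fst bounded_linear_snd)
    fix p :: "'a phase_space \<times> 'a phase_space"
    have "norm p \<le> norm (fst p) + norm (snd p)" using norm_Pair_le[of "fst p" "snd p"] by simp
    moreover have "norm (fst p) \<le> norm (fst p - snd p) + norm (snd p)" using norm_triangle_ineq[of "fst p - snd p" "snd p"] by simp
    ultimately show "norm p \<le> 3 * norm (fst p - snd p, snd p)"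
      using norm_fst_le[of "fst p - snd p" "snd p"] norm_snd_le[of "snd p" "fst p - snd p"] by argo
  qed
  then have S: "schwartz (\<lambda>p. G (fst p - snd p) * F (snd p))" by simp
  have "slow (\<lambda>p. complex_of_real (eps / 2) * complex_of_real (symp_form (snd p) (fst p)))"
    by (intro slow_mult slow_const slow_symp_form bounded_linear_fst bounded_linear_snd)
  then have "slow (\<lambda>p. iexp (eps / 2 * symp_form (snd p) (fst p)))"
    by (intro slow_iexp) simp
  from schwartz_slow_mult[OF this S] show ?thesis by (simp add: twisted_kernel_def case_prod_unfold)
qed

lemma schwartz_integrable_pair:
  fixes K :: "'a::euclidean_space \<times> 'b::euclidean_space \<Rightarrow> complex"
  assumes "schwartz K"
  shows "integrable (lborel \<Otimes>\<^sub>M lborel) K"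
  unfolding lborel_prod by (rule schwartz_integrable[OF assms])

lemma schwartz_twisted_convolution:
  assumes "schwartz F" "schwartz G"
  shows "schwartz (twisted_convolution eps F G)"
  unfolding twisted_convolution_def[abs_def]
  by (intro schwartz_cmult schwartz_partial_integral schwartz_twisted_kernel assms)

text \<open>In the weak formula for \<open>f\<close> the operator W(Y) is moved to the left vector
  as W(-Y), so that the weak formula for \<open>g\<close> applies; the Weyl relation and the shift X
  = Z + Y then collect everything in front of W(X). One of the two factors (2 pi)^(-d) goes into
  \<open>twisted_convolution\<close>.\<close>

lemma weyl_op_comp_cinner:
  fixes f g :: "'d::finite phase_space \<Rightarrow> complex"
  assumes f: "schwartz f" and g: "schwartz g"
  shows "cinner \<phi> (blinfun_apply (weyl_op eps f o\<^sub>L weyl_op eps g) \<psi>) = complex_of_real (1 / (2 * pi) ^ CARD('d)) *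
    (LINT X|lborel. twisted_convolution eps (symp_fourier f) (symp_fourier g) X * cinner \<phi> (weyl eps X \<psi>))"
proof -
  let ?c = "complex_of_real (1 / (2 * pi) ^ CARD('d))"
  define F where "F = symp_fourier f"
  define G where "G = symp_fourier g"
  define k where "k X = cinner \<phi> (weyl eps X \<psi>)" for X
  let ?K = "twisted_kernel eps F G"
  have FG: "schwartz F" "schwartz G"
    unfolding F_def G_def by (intro schwartz_symp_fourier f g)+
  have [measurable]: "F \<in> borel_measurable borel" "G \<in> borel_measurable borel" "k \<in> borel_measurable borel"
    using schwartz_measurable[OF FG(1)] schwartz_measurable[OF FG(2)] unfolding k_def[abs_def] by measurable
  have K: "schwartz ?K" by (rule schwartz_twisted_kernel[OF FG])
  have [measurable]: "?K \<in> borel_measurable (lborel \<Otimes>\<^sub>M lborel)"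
    unfolding lborel_prod using schwartz_measurable[OF K] by simp
  have 1: "cinner \<phi> (weyl eps Y (blinfun_apply (weyl_op eps g) \<psi>)) = ?c * (LINT X|lborel. G (X - Y) * iexp (eps / 2 * symp_form Y X) * k X)" for Y
  proof -
    have adj: "cinner \<phi> (weyl eps Y \<theta>) = cinner (weyl eps (- Y) \<phi>) \<theta>" for \<theta>
      using cinner_weyl_weyl[of eps "- Y" \<phi> "weyl eps Y \<theta>"]
      by (simp add: weyl_mult symp_form_simps weyl_zero scaleC_one)
    have "cinner \<phi> (weyl eps Y (blinfun_apply (weyl_op eps g) \<psi>)) =
        ?c * (LINT Z|lborel. G Z * cinner \<phi> (weyl eps Y (weyl eps Z \<psi>)))"
      unfolding adj cinner_weyl_op[OF g] G_def ..
    also have "(LINT Z|lborel. G Z * cinner \<phi> (weyl eps Y (weyl eps Z \<psi>))) =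
        (LINT Z|lborel. G ((Z + Y) - Y) * iexp (eps / 2 * symp_form Y (Z + Y)) * k (Z + Y))"
      by (simp add: weyl_mult cinner_scaleC_right k_def symp_form_simps add.commute mult.assoc)
    also have "\<dots> = (LINT X|lborel. G (X - Y) * iexp (eps / 2 * symp_form Y X) * k X)"
      by (rule lborel_integral_shift[where f = "\<lambda>X. G (X - Y) * iexp (eps / 2 * symp_form Y X) * k X"]) measurable
    finally show ?thesis .
  qed
  have int: "integrable (lborel \<Otimes>\<^sub>M lborel) (\<lambda>(X, Y). ?K (X, Y) * k X)"
  proof (rule Bochner_Integration.integrable_bound)
    show "integrable (lborel \<Otimes>\<^sub>M lborel) (\<lambda>p. norm (?K p) * (norm \<phi> * norm \<psi>))"
      by (intro integrable_mult_left integrable_norm schwartz_integrable_pair K)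
    show "AE p in lborel \<Otimes>\<^sub>M lborel. norm ((\<lambda>(X, Y). ?K (X, Y) * k X) p) \<le> norm (norm (?K p) * (norm \<phi> * norm \<psi>))"
      by (intro AE_I2) (auto simp: norm_mult k_def abs_mult intro!: mult_left_mono norm_cinner_weyl_le)
    show "(\<lambda>(X, Y). ?K (X, Y) * k X) \<in> borel_measurable (lborel \<Otimes>\<^sub>M lborel)" by measurable
  qed
  have "cinner \<phi> (blinfun_apply (weyl_op eps f o\<^sub>L weyl_op eps g) \<psi>) =
      ?c * (LINT Y|lborel. F Y * (?c * (LINT X|lborel. G (X - Y) * iexp (eps / 2 * symp_form Y X) * k X)))"
    by (simp only: blinfun_apply_blinfun_compose cinner_weyl_op[OF f] 1 F_def)
  also have "(LINT Y|lborel. F Y * (?c * (LINT X|lborel. G (X - Y) * iexp (eps / 2 * symp_form Y X) * k X))) =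
      (LINT Y|lborel. ?c * (LINT X|lborel. ?K (X, Y) * k X))"
  proof (rule Bochner_Integration.integral_cong[OF refl])
    fix Y
    have "F Y * (LINT X|lborel. G (X - Y) * iexp (eps / 2 * symp_form Y X) * k X) =
        (LINT X|lborel. F Y * (G (X - Y) * iexp (eps / 2 * symp_form Y X) * k X))"
      by (rule integral_mult_right_zero[symmetric])
    also have "\<dots> = (LINT X|lborel. ?K (X, Y) * k X)"
      by (simp add: twisted_kernel_def mult_ac)
    finally have E: "F Y * (LINT X|lborel. G (X - Y) * iexp (eps / 2 * symp_form Y X) * k X) = (LINT X|lborel. ?K (X, Y) * k X)" .
    show "F Y * (?c * (LINT X|lborel. G (X - Y) * iexp (eps / 2 * symp_form Y X) * k X)) = ?c * (LINT X|lborel. ?K (X, Y) * k X)"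
      by (simp only: mult.left_commute[of "F Y" ?c] E)
  qed
  also have "\<dots> = ?c * (LINT Y|lborel. LINT X|lborel. ?K (X, Y) * k X)"
    by (rule integral_mult_right_zero)
  also have "(LINT Y|lborel. LINT X|lborel. ?K (X, Y) * k X) = (LINT X|lborel. LINT Y|lborel. ?K (X, Y) * k X)"
    by (rule lborel_pair.Fubini_integral[OF int])
  also have "?c * (LINT X|lborel. LINT Y|lborel. ?K (X, Y) * k X) = (LINT X|lborel. twisted_convolution eps F G X * k X)"
    unfolding twisted_convolution_def by (simp only: mult.assoc integral_mult_left_zero integral_mult_right_zero)
  finally show ?thesis unfolding F_def G_def k_def .
qed

subsection \<open>The Moyal product\<close>

definition moyal_product ::
    "real \<Rightarrow> ('d::finite phase_space \<Rightarrow> complex) \<Rightarrow> ('d phase_space \<Rightarrow> complex) \<Rightarrow> 'd phase_space \<Rightarrow> complex" where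
  "moyal_product eps f g = symp_fourier (twisted_convolution eps (symp_fourier f) (symp_fourier g))"

lemma schwartz_moyal_product: "schwartz f \<Longrightarrow> schwartz g \<Longrightarrow> schwartz (moyal_product eps f g)"
  unfolding moyal_product_def by (intro schwartz_symp_fourier schwartz_twisted_convolution)

lemma weyl_op_moyal_product:
  assumes f: "schwartz f" and g: "schwartz g"
  shows "weyl_op eps (moyal_product eps f g) = weyl_op eps f o\<^sub>L weyl_op eps g"
proof (rule weyl_op_eqI[OF schwartz_moyal_product[OF f g]])
  have "symp_fourier (moyal_product eps f g) = twisted_convolution eps (symp_fourier f) (symp_fourier g)"
    unfolding moyal_product_def
    by (intro symp_fourier_involution schwartz_twisted_convolution schwartz_symp_fourier f g)
  then show "cinner \<phi> (blinfun_apply (weyl_op eps f o\<^sub>L weyl_op eps g) \<psi>) = complex_of_real (1 / (2 * pi) ^ CARD('a)) *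
    (LINT X|lborel. symp_fourier (moyal_product eps f g) X * cinner \<phi> (weyl eps X \<psi>))" for \<phi> \<psi>
    by (simp only: weyl_op_comp_cinner[OF f g])
qed

text \<open>Exchanging the two integrals and shifting X' = Z + Y undoes the substitution built into
  \<open>twisted_kernel\<close>.\<close>

lemma moyal_product_fourier:
  fixes f g :: "'d::finite phase_space \<Rightarrow> complex"
  assumes f: "schwartz f" and g: "schwartz g"
  shows "moyal_product eps f g X = complex_of_real (1 / (2 * pi) ^ (2 * CARD('d))) *
    (LINT Y|lborel. LINT Z|lborel.
       exp (\<i> * complex_of_real (symp_form X (Y + Z))) *
       exp (\<i> * complex_of_real (eps / 2 * symp_form Y Z)) *
       symp_fourier f Y * symp_fourier g Z)"
proof -
  let ?c = "complex_of_real (1 / (2 * pi) ^ CARD('d))"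
  define F where "F = symp_fourier f"
  define G where "G = symp_fourier g"
  let ?K = "twisted_kernel eps F G"
  have FG: "schwartz F" "schwartz G"
    unfolding F_def G_def by (intro schwartz_symp_fourier f g)+
  have [measurable]: "F \<in> borel_measurable borel" "G \<in> borel_measurable borel"
    by (intro schwartz_measurable FG)+
  have K: "schwartz ?K" by (rule schwartz_twisted_kernel[OF FG])
  have cc: "?c * (?c * I) = complex_of_real (1 / (2 * pi) ^ (2 * CARD('d))) * I" for I
  proof -
    have "1 / (a * a) = (1 / a) * (1 / a)" for a :: real by simp
    then show ?thesis by (simp only: mult_2 power_add of_real_mult mult.assoc)
  qed
  have "integrable (lborel \<Otimes>\<^sub>M lborel) (\<lambda>p. iexp (symp_form X (fst p)) * ?K p)"
    by (intro integrable_iexp_mult schwartz_integrable_pair K) measurable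
  then have int: "integrable (lborel \<Otimes>\<^sub>M lborel) (\<lambda>(X', Y). iexp (symp_form X X') * ?K (X', Y))"
    by (simp add: case_prod_unfold)
  have "moyal_product eps f g X = ?c * (LINT X'|lborel. iexp (symp_form X X') * (?c * (LINT Y|lborel. ?K (X', Y))))"
    unfolding moyal_product_def symp_fourier_eq[of "twisted_convolution _ _ _"] symp_integral_def twisted_convolution_def F_def G_def ..
  also have "\<dots> = ?c * (?c * (LINT X'|lborel. LINT Y|lborel. iexp (symp_form X X') * ?K (X', Y)))"
  proof -
    have "iexp (symp_form X X') * (?c * (LINT Y|lborel. ?K (X', Y))) = ?c * (LINT Y|lborel. iexp (symp_form X X') * ?K (X', Y))" for X'
      by (simp only: mult.left_commute[of "iexp (symp_form X X')" ?c] integral_mult_right_zero)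
    then show ?thesis by (simp only: integral_mult_right_zero)
  qed
  also have "(LINT X'|lborel. LINT Y|lborel. iexp (symp_form X X') * ?K (X', Y)) =
      (LINT Y|lborel. LINT X'|lborel. iexp (symp_form X X') * ?K (X', Y))"
    by (rule lborel_pair.Fubini_integral[OF int, symmetric])
  also have "\<dots> = (LINT Y|lborel. LINT Z|lborel. iexp (symp_form X (Y + Z)) * iexp (eps / 2 * symp_form Y Z) * F Y * G Z)"
  proof (rule Bochner_Integration.integral_cong[OF refl])
    fix Y
    have "(LINT X'|lborel. iexp (symp_form X X') * ?K (X', Y)) = (LINT Z|lborel. iexp (symp_form X (Z + Y)) * ?K (Z + Y, Y))"
      by (rule lborel_integral_shift[where f = "\<lambda>X'. iexp (symp_form X X') * ?K (X', Y)", symmetric])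
        (unfold twisted_kernel_def prod.case, measurable)
    then show "(LINT X'|lborel. iexp (symp_form X X') * ?K (X', Y)) =
        (LINT Z|lborel. iexp (symp_form X (Y + Z)) * iexp (eps / 2 * symp_form Y Z) * F Y * G Z)"
      by (simp add: twisted_kernel_def symp_form_simps add.commute mult_ac)
  qed
  also have "?c * (?c * (LINT Y|lborel. LINT Z|lborel. iexp (symp_form X (Y + Z)) * iexp (eps / 2 * symp_form Y Z) * F Y * G Z)) =
      complex_of_real (1 / (2 * pi) ^ (2 * CARD('d))) *
      (LINT Y|lborel. LINT Z|lborel. iexp (symp_form X (Y + Z)) * iexp (eps / 2 * symp_form Y Z) * F Y * G Z)"
    by (rule cc)
  finally show ?thesis unfolding F_def G_def .
qed

text \<open>In the first formula the integral over \<open>Z\<close> is the inverse transform of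
  \<open>symp_fourier g\<close> at X + (eps/2) Y. Taking that point as the new outer variable frees
  the argument of \<open>g\<close>; writing out the transform of \<open>f\<close> restores a second
  integral, and Fubini its position.\<close>

lemma moyal_product_integral:
  fixes f g :: "'d::finite phase_space \<Rightarrow> complex"
  assumes eps: "eps > 0" and f: "schwartz f" and g: "schwartz g"
  shows "moyal_product eps f g X = complex_of_real (1 / (pi * eps) ^ (2 * CARD('d))) *
    (LINT Y|lborel. LINT Z|lborel.
       exp (- \<i> * complex_of_real (2 / eps * symp_form (X - Y) (X - Z))) * f Y * g Z)"
proof -
  let ?c = "complex_of_real (1 / (2 * pi) ^ CARD('d))"
  define F where "F = symp_fourier f"
  define G where "G = symp_fourier g"
  have FG: "schwartz F" "schwartz G"
    unfolding F_def G_def by (intro schwartz_symp_fourier f g)+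
  have [measurable]: "F \<in> borel_measurable borel" "G \<in> borel_measurable borel"
    "f \<in> borel_measurable borel" "g \<in> borel_measurable borel"
    by (intro schwartz_measurable FG f g)+
  define q where "q Y = iexp (symp_form X Y) * F Y * g (X + (eps / 2) *\<^sub>R Y)" for Y
  have qm: "q \<in> borel_measurable borel" unfolding q_def by measurable
  have inner: "(LINT Z|lborel. iexp (symp_form X (Y + Z)) * iexp (eps / 2 * symp_form Y Z) * F Y * G Z) =
      of_real ((2 * pi) ^ CARD('d)) * q Y" for Y
  proof -
    have "iexp (symp_form X (Y + Z)) * iexp (eps / 2 * symp_form Y Z) * F Y * G Z =
        iexp (symp_form X Y) * F Y * (iexp (symp_form (X + (eps / 2) *\<^sub>R Y) Z) * G Z)" for Z
      by (simp add: symp_form_simps algebra_simps exp_add)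
    then have "(LINT Z|lborel. iexp (symp_form X (Y + Z)) * iexp (eps / 2 * symp_form Y Z) * F Y * G Z) =
        iexp (symp_form X Y) * F Y * symp_integral G (X + (eps / 2) *\<^sub>R Y)"
      unfolding symp_integral_def by (simp only: integral_mult_right_zero)
    also have "symp_integral G (X + (eps / 2) *\<^sub>R Y) = of_real ((2 * pi) ^ CARD('d)) * symp_fourier G (X + (eps / 2) *\<^sub>R Y)"
      unfolding symp_fourier_eq by simp
    also have "symp_fourier G = g" unfolding G_def by (rule symp_fourier_involution[OF g])
    finally show ?thesis by (simp only: q_def mult.assoc mult.left_commute)
  qed
  let ?s = "2 / eps"
  have s: "?s > 0" using eps by simp
  have "moyal_product eps f g X = complex_of_real (1 / (2 * pi) ^ (2 * CARD('d))) * (LINT Y|lborel. of_real ((2 * pi) ^ CARD('d)) * q Y)"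
    unfolding moyal_product_fourier[OF f g] F_def[symmetric] G_def[symmetric] inner ..
  also have "\<dots> = complex_of_real (1 / (2 * pi) ^ (2 * CARD('d))) * (of_real ((2 * pi) ^ CARD('d)) * (LINT Y|lborel. q Y))"
    by (simp only: integral_mult_right_zero)
  \<comment> \<open>The substitution Y = (2/eps)(Z - X), with Jacobian (2/eps)^(2d).\<close>
  also have "(LINT Y|lborel. q Y) = of_real (?s ^ DIM('d phase_space)) * (LINT Z|lborel. q (- ?s *\<^sub>R X + ?s *\<^sub>R Z))"
    using s by (subst lborel_integral_affine[OF _ qm]) auto
  also have "(LINT Z|lborel. q (- ?s *\<^sub>R X + ?s *\<^sub>R Z)) =
      (LINT Z|lborel. ?c * (LINT Y|lborel. exp (- \<i> * complex_of_real (?s * symp_form (X - Y) (X - Z))) * f Y * g Z))"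
  proof (rule Bochner_Integration.integral_cong[OF refl])
    fix Z
    have "X + (eps / 2) *\<^sub>R (- ?s *\<^sub>R X + ?s *\<^sub>R Z) = Z"
      using eps by (simp add: scaleR_diff_right)
    then have "q (- ?s *\<^sub>R X + ?s *\<^sub>R Z) = iexp (?s * symp_form X Z) * F (?s *\<^sub>R (Z - X)) * g Z"
      by (simp add: q_def symp_form_simps scaleR_diff_right add.commute)
    also have "\<dots> = ?c * (iexp (?s * symp_form X Z) * g Z * (LINT Y|lborel. iexp (symp_form (?s *\<^sub>R (Z - X)) Y) * f Y))"
      unfolding F_def symp_fourier_eq symp_integral_def by (simp only: mult_ac)
    also have "iexp (?s * symp_form X Z) * g Z * (LINT Y|lborel. iexp (symp_form (?s *\<^sub>R (Z - X)) Y) * f Y) =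
        (LINT Y|lborel. iexp (?s * symp_form X Z) * g Z * (iexp (symp_form (?s *\<^sub>R (Z - X)) Y) * f Y))"
      by (rule integral_mult_right_zero[symmetric])
    also have "\<dots> = (LINT Y|lborel. exp (- \<i> * complex_of_real (?s * symp_form (X - Y) (X - Z))) * f Y * g Z)"
    proof (rule Bochner_Integration.integral_cong[OF refl])
      fix Y
      have "- (?s * symp_form (X - Y) (X - Z)) = ?s * symp_form X Z + symp_form (?s *\<^sub>R (Z - X)) Y"
        using symp_form_swap[of Y X] symp_form_swap[of Y Z] by (simp add: symp_form_simps algebra_simps)
      then have "iexp (- (?s * symp_form (X - Y) (X - Z))) = iexp (?s * symp_form X Z) * iexp (symp_form (?s *\<^sub>R (Z - X)) Y)"
        by (simp only: of_real_add distrib_left exp_add)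
      then have "exp (- \<i> * complex_of_real (?s * symp_form (X - Y) (X - Z))) =
          iexp (?s * symp_form X Z) * iexp (symp_form (?s *\<^sub>R (Z - X)) Y)"
        by (simp only: of_real_minus mult_minus_left mult_minus_right)
      then show "iexp (?s * symp_form X Z) * g Z * (iexp (symp_form (?s *\<^sub>R (Z - X)) Y) * f Y) =
          exp (- \<i> * complex_of_real (?s * symp_form (X - Y) (X - Z))) * f Y * g Z"
        by (simp only: mult_ac)
    qed
    finally show "q (- ?s *\<^sub>R X + ?s *\<^sub>R Z) = ?c * (LINT Y|lborel. exp (- \<i> * complex_of_real (?s * symp_form (X - Y) (X - Z))) * f Y * g Z)" .
  qed
  also have "\<dots> = ?c * (LINT Z|lborel. LINT Y|lborel. exp (- \<i> * complex_of_real (?s * symp_form (X - Y) (X - Z))) * f Y * g Z)"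
    by (rule integral_mult_right_zero)
  also have "(LINT Z|lborel. LINT Y|lborel. exp (- \<i> * complex_of_real (?s * symp_form (X - Y) (X - Z))) * f Y * g Z) =
      (LINT Y|lborel. LINT Z|lborel. exp (- \<i> * complex_of_real (?s * symp_form (X - Y) (X - Z))) * f Y * g Z)"
  proof (rule lborel_pair.Fubini_integral)
    have "integrable (lborel \<Otimes>\<^sub>M lborel) (\<lambda>p. iexp (- (?s * symp_form (X - fst p) (X - snd p))) * (f (fst p) * g (snd p)))"
      by (intro integrable_iexp_mult integrable_tensor schwartz_integrable f g) measurable
    then show "integrable (lborel \<Otimes>\<^sub>M lborel) (\<lambda>(Y, Z). exp (- \<i> * complex_of_real (?s * symp_form (X - Y) (X - Z))) * f Y * g Z)"
      by (simp add: case_prod_unfold mult.assoc)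
  qed
  \<comment> \<open>The exponents of 2 pi add up to - 2 d, and (2/eps) / (2 pi) = 1 / (pi
    eps).\<close>
  also have "complex_of_real (1 / (2 * pi) ^ (2 * CARD('d))) * (of_real ((2 * pi) ^ CARD('d)) * (of_real (?s ^ DIM('d phase_space)) *
      (?c * (LINT Y|lborel. LINT Z|lborel. exp (- \<i> * complex_of_real (?s * symp_form (X - Y) (X - Z))) * f Y * g Z)))) =
      complex_of_real (1 / (2 * pi) ^ (2 * CARD('d)) * (2 * pi) ^ CARD('d) * ?s ^ DIM('d phase_space) * (1 / (2 * pi) ^ CARD('d))) *
      (LINT Y|lborel. LINT Z|lborel. exp (- \<i> * complex_of_real (?s * symp_form (X - Y) (X - Z))) * f Y * g Z)"
    by (simp only: of_real_mult mult.assoc)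
  also have "1 / (2 * pi) ^ (2 * CARD('d)) * (2 * pi) ^ CARD('d) * ?s ^ DIM('d phase_space) * (1 / (2 * pi) ^ CARD('d)) =
      (?s / (2 * pi)) ^ (2 * CARD('d))"
  proof -
    have key: "1 / a ^ (2 * n) * a ^ n * t ^ (2 * n) * (1 / a ^ n) = (t / a) ^ (2 * n)" if "a \<noteq> 0" for a t :: real and n
      using that by (simp add: power_divide)
    have dim: "DIM('d phase_space) = 2 * CARD('d)" by simp
    show ?thesis unfolding dim by (rule key) simp
  qed
  also have "?s / (2 * pi) = 1 / (pi * eps)" by simp
  finally show ?thesis by (simp only: power_one_over)
qed

subsection \<open>Matrix elements of the Weyl operators\<close>

lemma schwartz_cnj:
  assumes "schwartz f"
  shows "schwartz (\<lambda>x. cnj (f x))"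
proof (rule schwartz_coinduct[where C = "\<lambda>h. \<exists>f. schwartz f \<and> h = (\<lambda>x. cnj (f x))"])
  show "\<exists>f'. schwartz f' \<and> (\<lambda>x. cnj (f x)) = (\<lambda>x. cnj (f' x))" using assms by blast
  fix h :: "'a \<Rightarrow> complex" assume "\<exists>f. schwartz f \<and> h = (\<lambda>x. cnj (f x))"
  then obtain f where f: "schwartz f" and h: "h = (\<lambda>x. cnj (f x))" by blast
  have D: "(h has_derivative (\<lambda>v. cnj (frechet_derivative f (at x) v))) (at x)" for x
    unfolding h by (rule bounded_linear.has_derivative[OF bounded_linear_cnj schwartz_has_derivative[OF f]])
  show "h differentiable (at x)" for x using D differentiable_def by blast
  show "rapid h"
    using f unfolding h schwartz_iff rapid_def by (auto dest!: smooth_class_growth simp: rapid_def)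
  fix b :: 'a assume "b \<in> Basis"
  then show "\<exists>f. schwartz f \<and> (\<lambda>x. frechet_derivative h (at x) b) = (\<lambda>x. cnj (f x))"
    unfolding frechet_derivative_eqI[OF D] using schwartz_partial[OF f] by blast
qed

lemma schwartz_slow:
  assumes "schwartz f"
  shows "slow f"
proof -
  have "poly_bounded f" if "rapid f" for f :: "'a \<Rightarrow> complex"
  proof -
    from that[unfolded rapid_def, THEN spec, of 0] obtain C where "\<And>x. (1 + norm x) ^ 0 * norm (f x) \<le> C"
      by blast
    then show ?thesis unfolding poly_bounded_def by (intro exI[of _ 0] exI[of _ C]) simp
  qed
  then show ?thesis using assms unfolding schwartz_iff smooth_class_def by blast
qed

lemma cinner_weyl_schwartz:
  assumes "schwartz \<phi>" "schwartz \<psi>"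
  shows "cinner (abs_L2 \<phi>) (weyl eps X (abs_L2 \<psi>)) = (LINT y|lborel. cnj (\<phi> y) * weyl_fun eps X \<psi> y)"
  using assms by (simp add: weyl_abs_L2 cinner_abs_L2 schwartz_square_integrable square_integrable_weyl_fun)

lemma integrable_cnj_mult_schwartz:
  "schwartz \<phi> \<Longrightarrow> schwartz \<psi> \<Longrightarrow> integrable lborel (\<lambda>y. cnj (\<phi> y) * \<psi> y)"
  by (intro square_integrable_cnj_mult schwartz_square_integrable)

lemma schwartz_coordinate: "schwartz \<psi> \<Longrightarrow> schwartz (\<lambda>y. of_real (y \<bullet> u) * \<psi> y)"
  by (intro schwartz_slow_mult slow_inner bounded_linear_ident)

text \<open>Matrix element of the commutator of W(X) with multiplication by
  \<open>y \<bullet> u\<close>: the translation in W(X) moves the multiplier by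
  \<open>eps * (fst X \<bullet> u)\<close>.\<close>

lemma cinner_weyl_position:
  assumes \<phi>: "schwartz \<phi>" and \<psi>: "schwartz \<psi>"
  shows "of_real (eps * (fst X \<bullet> u)) * cinner (abs_L2 \<phi>) (weyl eps X (abs_L2 \<psi>)) =
    cinner (abs_L2 \<phi>) (weyl eps X (abs_L2 (\<lambda>y. of_real (y \<bullet> u) * \<psi> y))) -
    cinner (abs_L2 (\<lambda>y. of_real (y \<bullet> u) * \<phi> y)) (weyl eps X (abs_L2 \<psi>))"
proof -
  let ?\<phi> = "\<lambda>y. of_real (y \<bullet> u) * \<phi> y" and ?\<psi> = "\<lambda>y. of_real (y \<bullet> u) * \<psi> y"
  have eq: "of_real (eps * (fst X \<bullet> u)) * (cnj (\<phi> y) * weyl_fun eps X \<psi> y) =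
      cnj (\<phi> y) * weyl_fun eps X ?\<psi> y - cnj (?\<phi> y) * weyl_fun eps X \<psi> y" for y
    by (simp add: weyl_fun_def inner_add_left algebra_simps)
  show ?thesis
    unfolding cinner_weyl_schwartz[OF \<phi> \<psi>] cinner_weyl_schwartz[OF \<phi> schwartz_coordinate[OF \<psi>]]
      cinner_weyl_schwartz[OF schwartz_coordinate[OF \<phi>] \<psi>] integral_mult_right_zero[symmetric] eq
    by (intro Bochner_Integration.integral_diff integrable_cnj_mult_schwartz schwartz_weyl_fun
        schwartz_coordinate \<phi> \<psi>)
qed

lemma weyl_fun_has_derivative:
  fixes \<psi> :: "real^'d::finite \<Rightarrow> complex"
  assumes \<psi>: "schwartz \<psi>"
  shows "(weyl_fun eps X \<psi> has_derivative
    (\<lambda>u. weyl_fun eps X (\<lambda>y. frechet_derivative \<psi> (at y) u) y - \<i> * of_real (snd X \<bullet> u) * weyl_fun eps X \<psi> y)) (at y)"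
proof -
  define q where "q y = - (snd X \<bullet> y + eps / 2 * (snd X \<bullet> fst X))" for y
  have q: "(q has_derivative (\<lambda>u. - (snd X \<bullet> u))) (at y)"
    unfolding q_def by (auto intro!: derivative_eq_intros)
  have "((\<lambda>y. \<i> * complex_of_real (q y)) has_derivative (\<lambda>u. \<i> * complex_of_real (- (snd X \<bullet> u)))) (at y)"
    by (intro has_derivative_mult_right has_derivative_of_real q)
  from has_derivative_compose[OF this DERIV_exp[unfolded has_field_derivative_def]]
  have 1: "((\<lambda>y. iexp (q y)) has_derivative (\<lambda>u. iexp (q y) * (\<i> * complex_of_real (- (snd X \<bullet> u))))) (at y)" .
  have D: "((\<lambda>y. y + eps *\<^sub>R fst X) has_derivative (\<lambda>u. u)) (at y)"
    by (auto intro!: derivative_eq_intros)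
  show ?thesis
    using has_derivative_mult[OF 1 has_derivative_compose[OF D schwartz_has_derivative[OF \<psi>]]]
    unfolding weyl_fun_def q_def by (simp add: algebra_simps)
qed

text \<open>The derivative of \<open>cnj (\<phi> y) * weyl_fun eps X \<psi> y\<close> integrates to
  zero; besides the two states it differentiates the phase, which contributes - i \<xi> . u.\<close>

lemma cinner_weyl_momentum:
  assumes \<phi>: "schwartz \<phi>" and \<psi>: "schwartz \<psi>"
  shows "\<i> * of_real (snd X \<bullet> u) * cinner (abs_L2 \<phi>) (weyl eps X (abs_L2 \<psi>)) =
    cinner (abs_L2 (\<lambda>y. frechet_derivative \<phi> (at y) u)) (weyl eps X (abs_L2 \<psi>)) +
    cinner (abs_L2 \<phi>) (weyl eps X (abs_L2 (\<lambda>y. frechet_derivative \<psi> (at y) u)))"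
proof -
  let ?\<phi> = "\<lambda>y. frechet_derivative \<phi> (at y) u" and ?\<psi> = "\<lambda>y. frechet_derivative \<psi> (at y) u"
  have S: "schwartz (\<lambda>y. cnj (\<phi> y) * weyl_fun eps X \<psi> y)"
    by (intro schwartz_slow_mult schwartz_slow schwartz_cnj schwartz_weyl_fun \<phi> \<psi>)
  have D: "((\<lambda>y. cnj (\<phi> y) * weyl_fun eps X \<psi> y) has_derivative (\<lambda>u. cnj (\<phi> y) *
      (weyl_fun eps X (\<lambda>y. frechet_derivative \<psi> (at y) u) y - \<i> * of_real (snd X \<bullet> u) * weyl_fun eps X \<psi> y) +
      cnj (frechet_derivative \<phi> (at y) u) * weyl_fun eps X \<psi> y)) (at y)" for y
    by (intro has_derivative_mult weyl_fun_has_derivative \<psi>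
        bounded_linear.has_derivative[OF bounded_linear_cnj] schwartz_has_derivative \<phi>)
  have "frechet_derivative (\<lambda>y. cnj (\<phi> y) * weyl_fun eps X \<psi> y) (at y) u =
      (cnj (?\<phi> y) * weyl_fun eps X \<psi> y + cnj (\<phi> y) * weyl_fun eps X ?\<psi> y) -
      \<i> * of_real (snd X \<bullet> u) * (cnj (\<phi> y) * weyl_fun eps X \<psi> y)" for y
    unfolding frechet_derivative_eqI[OF D] by (simp add: algebra_simps)
  then have "0 = (LINT y|lborel. (cnj (?\<phi> y) * weyl_fun eps X \<psi> y + cnj (\<phi> y) * weyl_fun eps X ?\<psi> y) -
      \<i> * of_real (snd X \<bullet> u) * (cnj (\<phi> y) * weyl_fun eps X \<psi> y))"
    using integral_partial_schwartz[OF S, of u] by simp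
  also have "\<dots> = (cinner (abs_L2 ?\<phi>) (weyl eps X (abs_L2 \<psi>)) + cinner (abs_L2 \<phi>) (weyl eps X (abs_L2 ?\<psi>))) -
      \<i> * of_real (snd X \<bullet> u) * cinner (abs_L2 \<phi>) (weyl eps X (abs_L2 \<psi>))"
  proof -
    have int: "integrable lborel (\<lambda>y. cnj (?\<phi> y) * weyl_fun eps X \<psi> y)"
      "integrable lborel (\<lambda>y. cnj (\<phi> y) * weyl_fun eps X ?\<psi> y)"
      "integrable lborel (\<lambda>y. cnj (\<phi> y) * weyl_fun eps X \<psi> y)"
      by (intro integrable_cnj_mult_schwartz schwartz_weyl_fun schwartz_directional \<phi> \<psi>)+
    show ?thesis
      unfolding cinner_weyl_schwartz[OF \<phi> \<psi>] cinner_weyl_schwartz[OF \<phi> schwartz_directional[OF \<psi>]]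
        cinner_weyl_schwartz[OF schwartz_directional[OF \<phi>] \<psi>] integral_mult_right_zero[symmetric]
      using int by (subst Bochner_Integration.integral_diff, simp_all)
  qed
  finally show ?thesis by simp
qed

text \<open>A position coordinate of X is traded for a coordinate on one of the states by
  \<open>cinner_weyl_position\<close>, a momentum coordinate for a derivative by
  \<open>cinner_weyl_momentum\<close>; each time two matrix elements of the same kind result. The
  scalar \<open>c\<close> in the family absorbs the division by \<open>eps\<close>.\<close>

lemma rapid_cinner_weyl:
  fixes \<phi> \<psi> :: "real^'d::finite \<Rightarrow> complex"
  assumes eps: "eps > 0" and "schwartz \<phi>" "schwartz \<psi>"
  shows "rapid (\<lambda>X. cinner (abs_L2 \<phi>) (weyl eps X (abs_L2 \<psi>)))"
proof (rule rapid_by_coordinates)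
  let ?P = "\<lambda>h. \<exists>c \<phi> \<psi>. schwartz \<phi> \<and> schwartz \<psi> \<and> h = (\<lambda>X. c * cinner (abs_L2 \<phi>) (weyl eps X (abs_L2 \<psi>)))"
  show "?P (\<lambda>X. cinner (abs_L2 \<phi>) (weyl eps X (abs_L2 \<psi>)))"
    using assms by (intro exI[of _ 1] exI[of _ \<phi>] exI[of _ \<psi>]) simp
  fix h :: "'d phase_space \<Rightarrow> complex"
  assume "?P h"
  then obtain c \<phi> \<psi> where \<phi>: "schwartz \<phi>" and \<psi>: "schwartz \<psi>"
    and h: "h = (\<lambda>X. c * cinner (abs_L2 \<phi>) (weyl eps X (abs_L2 \<psi>)))" by blast
  have "norm (h X) \<le> norm c * (norm (abs_L2 \<phi>) * norm (abs_L2 \<psi>))" for X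
    unfolding h norm_mult by (intro mult_left_mono norm_cinner_weyl_le) simp
  then show "\<exists>C. \<forall>X. norm (h X) \<le> C" by blast
  fix b :: "'d phase_space" assume "b \<in> Basis"
  then consider u where "b = (u, 0)" | u where "b = (0, u)" by (auto simp: Basis_prod_def)
  then show "\<exists>h1 h2. ?P h1 \<and> ?P h2 \<and> (\<forall>X. \<bar>X \<bullet> b\<bar> * norm (h X) \<le> norm (h1 X) + norm (h2 X))"
  proof cases
    case 1
    let ?h1 = "\<lambda>X. (c / of_real eps) * cinner (abs_L2 \<phi>) (weyl eps X (abs_L2 (\<lambda>y. of_real (y \<bullet> u) * \<psi> y)))"
    let ?h2 = "\<lambda>X. (c / of_real eps) * cinner (abs_L2 (\<lambda>y. of_real (y \<bullet> u) * \<phi> y)) (weyl eps X (abs_L2 \<psi>))"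
    have "\<bar>X \<bullet> b\<bar> * norm (h X) \<le> norm (?h1 X) + norm (?h2 X)" for X
    proof -
      have "of_real (X \<bullet> b) * h X = (c / of_real eps) * (of_real (eps * (fst X \<bullet> u)) * cinner (abs_L2 \<phi>) (weyl eps X (abs_L2 \<psi>)))"
        using eps by (simp add: h 1 inner_prod_def)
      also have "\<dots> = ?h1 X - ?h2 X"
        unfolding cinner_weyl_position[OF \<phi> \<psi>] by (rule right_diff_distrib)
      finally have "norm (of_real (X \<bullet> b) * h X) \<le> norm (?h1 X) + norm (?h2 X)"
        by (simp only: norm_triangle_ineq4)
      then show ?thesis by (simp add: norm_mult)
    qed
    moreover have "?P ?h1"
      by (intro exI[of _ "c / of_real eps"] exI[of _ \<phi>] exI[of _ "\<lambda>y. of_real (y \<bullet> u) * \<psi> y"] conjI \<phi> schwartz_coordinate[OF \<psi>] refl)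
    moreover have "?P ?h2"
      by (intro exI[of _ "c / of_real eps"] exI[of _ "\<lambda>y. of_real (y \<bullet> u) * \<phi> y"] exI[of _ \<psi>] conjI \<psi> schwartz_coordinate[OF \<phi>] refl)
    ultimately show ?thesis by (intro exI[of _ ?h1] exI[of _ ?h2] conjI allI)
  next
    case 2
    let ?h1 = "\<lambda>X. c * cinner (abs_L2 (\<lambda>y. frechet_derivative \<phi> (at y) u)) (weyl eps X (abs_L2 \<psi>))"
    let ?h2 = "\<lambda>X. c * cinner (abs_L2 \<phi>) (weyl eps X (abs_L2 (\<lambda>y. frechet_derivative \<psi> (at y) u)))"
    have "\<bar>X \<bullet> b\<bar> * norm (h X) \<le> norm (?h1 X) + norm (?h2 X)" for X
    proof -
      have "\<i> * of_real (X \<bullet> b) * h X = c * (\<i> * of_real (snd X \<bullet> u) * cinner (abs_L2 \<phi>) (weyl eps X (abs_L2 \<psi>)))"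
        by (simp add: h 2 inner_prod_def)
      also have "\<dots> = ?h1 X + ?h2 X"
        unfolding cinner_weyl_momentum[OF \<phi> \<psi>] by (rule distrib_left)
      finally have "norm (\<i> * of_real (X \<bullet> b) * h X) \<le> norm (?h1 X) + norm (?h2 X)"
        by (simp only: norm_triangle_ineq)
      then show ?thesis by (simp add: norm_mult)
    qed
    moreover have "?P ?h1"
      by (intro exI[of _ c] exI[of _ "\<lambda>y. frechet_derivative \<phi> (at y) u"] exI[of _ \<psi>] conjI \<psi> schwartz_directional[OF \<phi>] refl)
    moreover have "?P ?h2"
      by (intro exI[of _ c] exI[of _ \<phi>] exI[of _ "\<lambda>y. frechet_derivative \<psi> (at y) u"] conjI \<phi> schwartz_directional[OF \<psi>] refl)
    ultimately show ?thesis by (intro exI[of _ ?h1] exI[of _ ?h2] conjI allI)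
  qed
qed

text \<open>Meant for matrix elements of the Weyl system, for which rapid decay and measurability,
  but not smoothness, have been established.\<close>

lemma rapid_integrable:
  fixes f :: "'a::euclidean_space \<Rightarrow> complex"
  assumes "rapid f" and f: "f \<in> borel_measurable borel"
  shows "integrable lborel f"
proof -
  obtain C where C: "\<And>x. (1 + norm x) ^ (2 * DIM('a)) * norm (f x) \<le> C"
    using assms(1) unfolding rapid_def by blast
  show ?thesis
  proof (rule Bochner_Integration.integrable_bound)
    show "integrable lborel (\<lambda>x::'a. C * (1 / (1 + norm x) ^ (2 * DIM('a))))"
      by (rule integrable_mult_right) (rule integrable_decay)
    have "norm (f x) \<le> C / (1 + norm x) ^ (2 * DIM('a))" for x
      using C[of x] by (subst pos_le_divide_eq) (auto simp: mult.commute add_pos_nonneg)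
    moreover have "0 \<le> C" using order_trans[OF _ C[of 0]] by simp
    ultimately show "AE x in lborel. norm (f x) \<le> norm (C * (1 / (1 + norm x) ^ (2 * DIM('a))))"
      by (intro AE_I2) simp
  qed (use f in simp)
qed

subsection \<open>Schwartz seminorms and tempered distributions\<close>

lemma finite_multi_indices: "finite {bs. set bs \<subseteq> (Basis :: 'a::euclidean_space set) \<and> length bs \<le> N}"
  by (rule finite_lists_length_le) simp

lemma bdd_above_schwartz:
  assumes "schwartz f" "set bs \<subseteq> Basis"
  shows "bdd_above (range (\<lambda>x. (1 + norm x) ^ N * norm (iter_partial bs f x)))"
  using assms unfolding schwartz_def bdd_above_def by blast

lemma schwartz_sup_nonneg:
  assumes "schwartz f" "set bs \<subseteq> Basis"
  shows "0 \<le> (SUP x. (1 + norm x) ^ N * norm (iter_partial bs f x))"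
  by (rule cSUP_upper2[OF bdd_above_schwartz[OF assms], of 0]) auto

lemma schwartz_norm_nonneg: "schwartz f \<Longrightarrow> 0 \<le> schwartz_norm N f"
  unfolding schwartz_norm_def by (intro sum_nonneg schwartz_sup_nonneg) auto

lemma norm_le_schwartz_norm:
  fixes f :: "'a::euclidean_space \<Rightarrow> complex"
  assumes f: "schwartz f"
  shows "norm (f x) \<le> schwartz_norm N f"
proof -
  have "norm (f x) \<le> (1 + norm x) ^ N * norm (iter_partial [] f x)"
    using mult_right_mono[of 1 "(1 + norm x) ^ N" "norm (f x)"] by (simp add: one_le_power)
  also have "\<dots> \<le> (SUP x. (1 + norm x) ^ N * norm (iter_partial [] f x))"
    by (rule cSUP_upper) (use bdd_above_schwartz[OF f, of "[]"] in simp_all)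
  also have "\<dots> \<le> schwartz_norm N f"
    unfolding schwartz_norm_def
    by (rule member_le_sum[of "[]" _ "\<lambda>bs. SUP x. (1 + norm x) ^ N * norm (iter_partial bs f x)"])
      (use schwartz_sup_nonneg[OF f] finite_multi_indices in auto)
  finally show ?thesis .
qed

lemma schwartz_norm_le:
  fixes f :: "'a::euclidean_space \<Rightarrow> complex"
  assumes "\<And>bs x. set bs \<subseteq> Basis \<Longrightarrow> length bs \<le> N \<Longrightarrow> (1 + norm x) ^ N * norm (iter_partial bs f x) \<le> e"
  shows "schwartz_norm N f \<le> real (card {bs. set bs \<subseteq> (Basis :: 'a set) \<and> length bs \<le> N}) * e"
  unfolding schwartz_norm_def using assms by (intro sum_bounded_above cSUP_least) auto

text \<open>Valid for every order \<open>N\<close>, so that it can be added to the bound of an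
  arbitrary tempered distribution, whose order is given.\<close>

lemma dist_of_fun_bound:
  assumes h: "schwartz h" and \<phi>: "schwartz \<phi>"
  shows "norm (dist_of_fun h \<phi>) \<le> (LINT x|lborel. norm (h x)) * schwartz_norm N \<phi>"
proof -
  have "norm (dist_of_fun h \<phi>) \<le> (LINT x|lborel. norm (h x * \<phi> x))"
    unfolding dist_of_fun_def by (rule integral_norm_bound)
  also have "\<dots> \<le> (LINT x|lborel. norm (h x) * schwartz_norm N \<phi>)"
  proof (rule integral_mono)
    show "integrable lborel (\<lambda>x. norm (h x * \<phi> x))"
      by (intro integrable_norm schwartz_integrable schwartz_slow_mult schwartz_slow h \<phi>)
    show "integrable lborel (\<lambda>x. norm (h x) * schwartz_norm N \<phi>)"
      by (intro integrable_mult_left integrable_norm schwartz_integrable h)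
    show "norm (h x * \<phi> x) \<le> norm (h x) * schwartz_norm N \<phi>" for x
      unfolding norm_mult by (intro mult_left_mono norm_le_schwartz_norm \<phi>) simp
  qed
  finally show ?thesis by simp
qed

lemma dist_of_fun_add:
  assumes "schwartz h" "schwartz \<phi>" "schwartz \<psi>"
  shows "dist_of_fun h (\<lambda>x. \<phi> x + \<psi> x) = dist_of_fun h \<phi> + dist_of_fun h \<psi>"
  unfolding dist_of_fun_def distrib_left using assms
  by (intro Bochner_Integration.integral_add schwartz_integrable schwartz_slow_mult schwartz_slow)

lemma dist_of_fun_cmult: "dist_of_fun h (\<lambda>x. c * \<phi> x) = c * dist_of_fun h \<phi>"
  unfolding dist_of_fun_def by (simp add: mult.left_commute)

lemma tempered_distribution_dist_of_fun: "schwartz h \<Longrightarrow> tempered_distribution (dist_of_fun h)"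
  unfolding tempered_distribution_def
  using dist_of_fun_bound dist_of_fun_add dist_of_fun_cmult by blast

lemma tempered_distribution_diff_fun:
  assumes T: "tempered_distribution T" and h: "schwartz h"
  shows "tempered_distribution (\<lambda>\<phi>. T \<phi> - dist_of_fun h \<phi>)"
proof -
  obtain N C where C: "\<And>\<phi>. schwartz \<phi> \<Longrightarrow> norm (T \<phi>) \<le> C * schwartz_norm N \<phi>"
    using T unfolding tempered_distribution_def by blast
  have "norm (T \<phi> - dist_of_fun h \<phi>) \<le> (C + (LINT x|lborel. norm (h x))) * schwartz_norm N \<phi>"
    if "schwartz \<phi>" for \<phi>
    using norm_triangle_ineq4[of "T \<phi>" "dist_of_fun h \<phi>"] C[OF that] dist_of_fun_bound[OF h that, of N]
    by (simp add: distrib_right)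
  then show ?thesis
    using T unfolding tempered_distribution_def
    by (auto simp: dist_of_fun_add[OF h] dist_of_fun_cmult right_diff_distrib)
qed

lemma tempered_distribution_sum:
  assumes D: "tempered_distribution D" and g: "\<And>i. i \<in> A \<Longrightarrow> schwartz (g i)"
    and zero: "\<And>i. i \<in> A \<Longrightarrow> D (g i) = 0"
  shows "D (\<lambda>x. \<Sum>i\<in>A. c i * g i x) = 0"
proof -
  have add: "D (\<lambda>x. \<phi> x + \<psi> x) = D \<phi> + D \<psi>" if "schwartz \<phi>" "schwartz \<psi>" for \<phi> \<psi>
    using D that unfolding tempered_distribution_def by blast
  have mult: "D (\<lambda>x. c * \<phi> x) = c * D \<phi>" if "schwartz \<phi>" for c \<phi>
    using D that unfolding tempered_distribution_def by blast
  have z: "D (\<lambda>_. 0) = 0" using mult[OF schwartz_zero, of 0] by simp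
  show ?thesis
    using g zero
  proof (induction A rule: infinite_finite_induct)
    case (insert i A)
    have "D (\<lambda>x. c i * g i x + (\<Sum>i\<in>A. c i * g i x)) = D (\<lambda>x. c i * g i x) + D (\<lambda>x. \<Sum>i\<in>A. c i * g i x)"
      by (rule add) (use insert in \<open>auto intro!: schwartz_cmult schwartz_sum\<close>)
    also have "\<dots> = 0" using insert mult by simp
    finally show ?case using insert by simp
  qed (simp_all add: z)
qed

section \<open>Approximation of parameter integrals in Schwartz seminorms\<close>

lemma iter_partial_diff:
  assumes "schwartz f" "schwartz g" "set bs \<subseteq> Basis"
  shows "iter_partial bs (\<lambda>x. f x - g x) = (\<lambda>x. iter_partial bs f x - iter_partial bs g x)"
  using assms(3)
proof (induction bs)
  case (Cons b bs)
  then have S: "schwartz (iter_partial bs f)" "schwartz (iter_partial bs g)"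
    by (auto intro: schwartz_iter_partial assms)
  from frechet_derivative_eqI[OF has_derivative_diff[OF schwartz_has_derivative[OF S(1)] schwartz_has_derivative[OF S(2)]]]
  show ?case using Cons by simp
qed simp

lemma iter_partial_sum:
  assumes "\<And>i. i \<in> A \<Longrightarrow> schwartz (g i)" "set bs \<subseteq> Basis"
  shows "iter_partial bs (\<lambda>x. \<Sum>i\<in>A. c i * g i x) = (\<lambda>x. \<Sum>i\<in>A. c i * iter_partial bs (g i) x)"
  using assms(2)
proof (induction bs)
  case (Cons b bs)
  then have S: "schwartz (iter_partial bs (g i))" if "i \<in> A" for i
    using that by (auto intro: schwartz_iter_partial assms)
  have D: "((\<lambda>x. \<Sum>i\<in>A. c i * iter_partial bs (g i) x) has_derivative
      (\<lambda>v. \<Sum>i\<in>A. c i * frechet_derivative (iter_partial bs (g i)) (at x) v)) (at x)" for x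
    by (intro has_derivative_sum has_derivative_mult_right schwartz_has_derivative S)
  show ?case using Cons frechet_derivative_eqI[OF D] by simp
qed simp

text \<open>Recasts a finite sum weighted by measures of level sets as an integral, so that its
  distance from the true integral can be estimated under one integral sign.\<close>

lemma simple_function_sum_integral:
  fixes G :: "'b::euclidean_space \<Rightarrow> complex"
  assumes s: "simple_function borel s" and B: "B \<in> sets borel" "emeasure lborel B < \<infinity>"
  shows "integrable lborel (\<lambda>w. indicator B w * G (s w))"
    and "(LINT w|lborel. indicator B w * G (s w)) =
      (\<Sum>u\<in>range s. complex_of_real (measure lborel ((s -` {u}) \<inter> B)) * G u)"
proof -
  have fin: "finite (range s)" using simple_functionD(1)[OF s] by simp
  have m: "s -` {u} \<inter> B \<in> sets borel" for u
    using simple_functionD(2)[OF s, of "{u}"] B by auto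
  have fm: "emeasure lborel (s -` {u} \<inter> B) < \<infinity>" for u
    using emeasure_mono[of "s -` {u} \<inter> B" B lborel] B by (auto intro: le_less_trans)
  have eq: "indicator B w * G (s w) = (\<Sum>u\<in>range s. indicator (s -` {u} \<inter> B) w *\<^sub>R G u)" for w
  proof -
    have "(\<Sum>u\<in>range s. indicator (s -` {u} \<inter> B) w *\<^sub>R G u) = (\<Sum>u\<in>range s. if u = s w then indicator B w * G (s w) else 0)"
      by (intro sum.cong refl) (auto simp: indicator_def)
    then show ?thesis using fin by simp
  qed
  have int: "integrable lborel (\<lambda>w. indicator (s -` {u} \<inter> B) w *\<^sub>R G u)" for u
    using m fm by (intro integrable_scaleR_left integrable_real_indicator) auto
  show "integrable lborel (\<lambda>w. indicator B w * G (s w))"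
    unfolding eq by (intro Bochner_Integration.integrable_sum int)
  have "(LINT w|lborel. indicator B w * G (s w)) = (\<Sum>u\<in>range s. (LINT w|lborel. indicator (s -` {u} \<inter> B) w *\<^sub>R G u))"
    unfolding eq by (rule Bochner_Integration.integral_sum) (rule int)
  also have "\<dots> = (\<Sum>u\<in>range s. complex_of_real (measure lborel ((s -` {u}) \<inter> B)) * G u)"
    using m fm by (intro sum.cong refl) (simp add: scaleR_conv_of_real)
  finally show "(LINT w|lborel. indicator B w * G (s w)) =
      (\<Sum>u\<in>range s. complex_of_real (measure lborel ((s -` {u}) \<inter> B)) * G u)" .
qed

text \<open>The first bound controls the tail in \<open>w\<close>, the second the error of replacing
  \<open>w\<close> by a nearby point, both uniformly in \<open>x\<close> with its weight. For points
  at distance more than 1 the Lipschitz bound follows from boundedness, which adds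
  \<open>2 * A\<close>.\<close>

lemma schwartz_kernel_bounds:
  fixes K :: "'a::euclidean_space \<times> 'b::euclidean_space \<Rightarrow> complex"
  assumes K: "schwartz K"
  shows "\<exists>C\<ge>0. (\<forall>x w. (1 + norm x) ^ N * norm (K (x, w)) \<le> C * (1 / (1 + norm w) ^ (2 * DIM('b)))) \<and>
    (\<forall>x w w'. (1 + norm x) ^ N * norm (K (x, w') - K (x, w)) \<le> C * norm (w' - w))"
proof -
  let ?k = "2 * DIM('b)"
  obtain A where A: "A \<ge> 0" "\<And>p. norm (K p) \<le> A / (1 + norm p) ^ (N + ?k)"
    using schwartz_bound[OF K] by blast
  obtain L where L: "L \<ge> 0" "\<And>p v. norm v \<le> 1 \<Longrightarrow> norm (K (p + v) - K p) \<le> L * norm v / (1 + norm p) ^ N"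
    using schwartz_local_lipschitz[OF K, of N] by blast
  have fst_le: "(1 + norm x) ^ N \<le> (1 + norm (x, w)) ^ N" for x :: 'a and w :: 'b
    by (intro power_mono) (auto simp: norm_fst_le)
  have 1: "(1 + norm x) ^ N * norm (K (x, w)) \<le> A * (1 / (1 + norm w) ^ ?k)" for x w
  proof -
    have "(1 + norm x) ^ N * norm (K (x, w)) \<le> (1 + norm (x, w)) ^ N * (A / (1 + norm (x, w)) ^ (N + ?k))"
      by (intro mult_mono fst_le A) auto
    also have "\<dots> = A / (1 + norm (x, w)) ^ ?k"
      by (simp add: power_add add_nonneg_eq_0_iff)
    also have "\<dots> \<le> A / (1 + norm w) ^ ?k"
      by (rule norm_snd_power_le[OF A(1)])
    finally show ?thesis by simp
  qed
  have d: "1 / (1 + norm w) ^ ?k \<le> 1" for w :: 'b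
    by (auto simp: divide_le_eq_1 one_le_power add_pos_nonneg)
  have 2: "(1 + norm x) ^ N * norm (K (x, w') - K (x, w)) \<le> (L + 2 * A) * norm (w' - w)" for x w w'
  proof (cases "norm (w' - w) \<le> 1")
    case True
    have "(1 + norm x) ^ N * norm (K (x, w') - K (x, w)) \<le> (1 + norm (x, w)) ^ N * (L * norm (w' - w) / (1 + norm (x, w)) ^ N)"
      using L(2)[of "(0, w' - w)" "(x, w)"] True by (intro mult_mono fst_le) (auto simp: norm_Pair)
    also have "\<dots> = L * norm (w' - w)"
      by (simp add: add_nonneg_eq_0_iff)
    also have "\<dots> \<le> (L + 2 * A) * norm (w' - w)"
      using A(1) by (intro mult_right_mono) auto
    finally show ?thesis .
  next
    case False
    have "(1 + norm x) ^ N * norm (K (x, w') - K (x, w)) \<le> (1 + norm x) ^ N * (norm (K (x, w')) + norm (K (x, w)))"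
      by (intro mult_left_mono norm_triangle_ineq4) auto
    also have "\<dots> \<le> A * 1 + A * 1"
      unfolding distrib_left using A(1) d
      by (intro add_mono order_trans[OF 1] mult_left_mono)
    also have "\<dots> \<le> (L + 2 * A) * 1" using L(1) by simp
    also have "\<dots> \<le> (L + 2 * A) * norm (w' - w)"
      using False L(1) A(1) by (intro mult_left_mono) auto
    finally show ?thesis .
  qed
  have "A * (1 / (1 + norm w) ^ ?k) \<le> (L + 2 * A) * (1 / (1 + norm w) ^ ?k)" for w :: 'b
    using A(1) L(1) by (intro mult_right_mono) auto
  then show ?thesis
    using A(1) L(1) 2 order_trans[OF 1] by (intro exI[of _ "L + 2 * A"]) auto
qed

text \<open>The integral is approximated in every Schwartz seminorm by the finite sums obtained from a
  simple function \<open>s\<close> close to the identity on a large ball.\<close>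

lemma tempered_distribution_integral:
  fixes K :: "'a::euclidean_space \<times> 'b::euclidean_space \<Rightarrow> complex"
  assumes D: "tempered_distribution D" and K: "schwartz K" and zero: "\<And>w. D (\<lambda>x. K (x, w)) = 0"
  shows "D (\<lambda>x. LINT w|lborel. K (x, w)) = 0"
proof -
  obtain N C where C: "\<And>\<phi>. schwartz \<phi> \<Longrightarrow> norm (D \<phi>) \<le> C * schwartz_norm N \<phi>"
    using D unfolding tempered_distribution_def by blast
  have add: "D (\<lambda>x. \<phi> x + \<psi> x) = D \<phi> + D \<psi>" if "schwartz \<phi>" "schwartz \<psi>" for \<phi> \<psi>
    using D that unfolding tempered_distribution_def by blast
  let ?I = "{bs. set bs \<subseteq> (Basis :: 'a set) \<and> length bs \<le> N}"
  let ?k = "2 * DIM('b)"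
  define \<Phi> where "\<Phi> x = (LINT w|lborel. K (x, w))" for x
  have \<Phi>: "schwartz \<Phi>" unfolding \<Phi>_def[abs_def] by (rule schwartz_partial_integral[OF K])
  define L where "L bs = iter_partial (map (\<lambda>b. (b, 0)) bs) K" for bs
  have L: "schwartz (L bs)" if "set bs \<subseteq> Basis" for bs
    unfolding L_def using that by (intro schwartz_iter_partial K) (auto simp: Basis_prod_def)
  define Q where "Q bs C \<longleftrightarrow> C \<ge> 0 \<and> (\<forall>x w. (1 + norm x) ^ N * norm (L bs (x, w)) \<le> C * (1 / (1 + norm w) ^ ?k)) \<and>
      (\<forall>x w w'. (1 + norm x) ^ N * norm (L bs (x, w') - L bs (x, w)) \<le> C * norm (w' - w))" for bs C
  have "\<exists>C. Q bs C" if "bs \<in> ?I" for bs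
    unfolding Q_def by (rule schwartz_kernel_bounds[OF L]) (use that in simp)
  then obtain A where "\<And>bs. bs \<in> ?I \<Longrightarrow> Q bs (A bs)" by metis
  then have A: "\<And>bs. bs \<in> ?I \<Longrightarrow> A bs \<ge> 0"
    "\<And>bs x w. bs \<in> ?I \<Longrightarrow> (1 + norm x) ^ N * norm (L bs (x, w)) \<le> A bs * (1 / (1 + norm w) ^ ?k)"
    "\<And>bs x w w'. bs \<in> ?I \<Longrightarrow> (1 + norm x) ^ N * norm (L bs (x, w') - L bs (x, w)) \<le> A bs * norm (w' - w)"
    by (simp_all add: Q_def)
  \<comment> \<open>One constant for all derivatives of order at most \<open>N\<close>, hence for
    the whole seminorm.\<close>
  define M where "M = (\<Sum>bs\<in>?I. A bs)"
  have AM: "A bs \<le> M" if "bs \<in> ?I" for bs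
    unfolding M_def using that A(1) finite_multi_indices by (intro member_le_sum) auto
  have M0: "M \<ge> 0" unfolding M_def using A(1) by (intro sum_nonneg) auto
  have M1: "(1 + norm x) ^ N * norm (L bs (x, w)) \<le> M * (1 / (1 + norm w) ^ ?k)" if "bs \<in> ?I" for bs x w
    by (rule order_trans[OF A(2)[OF that]]) (intro mult_right_mono AM that, simp)
  have M2: "(1 + norm x) ^ N * norm (L bs (x, w') - L bs (x, w)) \<le> M * norm (w' - w)" if "bs \<in> ?I" for bs x w w'
    by (rule order_trans[OF A(3)[OF that]]) (intro mult_right_mono AM that, simp)
  have key: "norm (D \<Phi>) \<le> \<bar>C\<bar> * (real (card ?I) * e)" if e: "e > 0" for e
  proof -
    let ?d = "\<lambda>w::'b. M * (1 / (1 + norm w) ^ ?k)"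
    have d: "integrable lborel ?d" by (rule integrable_mult_right) (rule integrable_decay)
    have "(\<lambda>n. LINT w|lborel. indicator (- cball 0 (real n)) w * ?d w) \<longlonglongrightarrow> (LINT w|(lborel :: 'b measure). 0)"
    proof (rule integral_dominated_convergence[OF _ _ d])
      show "AE w in lborel. (\<lambda>n. indicator (- cball 0 (real n)) w * ?d w) \<longlonglongrightarrow> 0"
      proof (rule AE_I2)
        fix w :: 'b
        obtain n0 where n0: "norm w < real n0" using reals_Archimedean2 by blast
        have "\<forall>\<^sub>F n in sequentially. indicator (- cball 0 (real n)) w * ?d w = 0"
          unfolding eventually_sequentially using n0 by (intro exI[of _ n0]) (auto simp: indicator_def)
        then show "(\<lambda>n. indicator (- cball 0 (real n)) w * ?d w) \<longlonglongrightarrow> 0"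
          by (rule tendsto_eventually)
      qed
      show "AE w in lborel. norm (indicator (- cball 0 (real n)) w * ?d w) \<le> ?d w" for n
        using M0 by (intro AE_I2) (auto simp: indicator_def)
    qed simp_all
    then have "\<forall>\<^sub>F n in sequentially. (LINT w|lborel. indicator (- cball 0 (real n)) w * ?d w) < e / 2"
      using e by (intro order_tendstoD) auto
    \<comment> \<open>Outside the ball of radius \<open>R\<close> the integrand will be dropped, at
      a cost below e/2.\<close>
    then obtain R :: nat where R: "(LINT w|lborel. indicator (- cball 0 (real R)) w * ?d w) < e / 2"
      by (auto simp: eventually_sequentially)
    define B where "B = (cball 0 (real R) :: 'b set)"
    have B: "B \<in> sets borel" "emeasure lborel B < \<infinity>"
      unfolding B_def using emeasure_bounded_finite[OF bounded_cball] by auto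
    obtain s where s: "\<And>i. simple_function borel (s i)" "\<And>w. (\<lambda>i. s i w) \<longlonglongrightarrow> (w :: 'b)"
      "\<And>i w. norm (s i w) \<le> 2 * norm w"
      using borel_measurable_implies_sequence_metric[of "\<lambda>w::'b. w" borel 0] by (auto simp: dist_norm)
    have [measurable]: "s i \<in> borel_measurable borel" for i
      using borel_measurable_simple_function[OF s(1)] .
    note [measurable] = B(1)
    have iB3: "integrable lborel (\<lambda>w. indicator B w * (M * (3 * real R)))"
      using B by (intro integrable_mult_left integrable_real_indicator) auto
    \<comment> \<open>On \<open>B\<close> the simple function stays within 3 R of the identity,
      since \<open>norm (s i w) \<le> 2 * norm w\<close>; this gives the dominating
      function.\<close>
    have s_dom: "norm (indicator B w * (M * norm (s i w - w))) \<le> indicator B w * (M * (3 * real R))" for i w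
    proof -
      have "norm (s i w - w) \<le> 3 * real R" if "w \<in> B"
      proof -
        have "norm w \<le> real R" using that by (simp add: B_def)
        then show ?thesis using norm_triangle_ineq4[of "s i w" w] s(3)[of i w] by argo
      qed
      then show ?thesis
        using M0 by (auto simp: indicator_def abs_mult intro: mult_left_mono)
    qed
    have "(\<lambda>i. LINT w|lborel. indicator B w * (M * norm (s i w - w))) \<longlonglongrightarrow> (LINT w|(lborel :: 'b measure). 0)"
    proof (rule integral_dominated_convergence[OF _ _ iB3])
      show "AE w in lborel. (\<lambda>i. indicator B w * (M * norm (s i w - w))) \<longlonglongrightarrow> 0"
      proof (rule AE_I2)
        fix w
        have "(\<lambda>i. indicator B w * (M * norm (s i w - w))) \<longlonglongrightarrow> indicator B w * (M * norm (w - w))"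
          by (intro tendsto_intros s)
        then show "(\<lambda>i. indicator B w * (M * norm (s i w - w))) \<longlonglongrightarrow> 0" by simp
      qed
      show "AE w in lborel. norm (indicator B w * (M * norm (s i w - w))) \<le> indicator B w * (M * (3 * real R))" for i
        by (intro AE_I2 s_dom)
    qed measurable
    then have "\<forall>\<^sub>F i in sequentially. (LINT w|lborel. indicator B w * (M * norm (s i w - w))) < e / 2"
      using e by (intro order_tendstoD) auto
    then obtain i where i: "(LINT w|lborel. indicator B w * (M * norm (s i w - w))) < e / 2"
      by (auto simp: eventually_sequentially)
    define c where "c u = complex_of_real (measure lborel ((s i -` {u}) \<inter> B))" for u
    \<comment> \<open>A finite linear combination of slices of the kernel, hence annihilated by
      \<open>D\<close>.\<close>
    define S where "S x = (\<Sum>u\<in>range (s i). c u * K (x, u))" for x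
    have slice: "schwartz (\<lambda>x. K (x, u))" for u by (rule schwartz_slice[OF K])
    have S: "schwartz S" unfolding S_def[abs_def] by (intro schwartz_sum schwartz_cmult slice)
    have DS: "D S = 0" unfolding S_def[abs_def] by (rule tempered_distribution_sum[OF D slice zero])
    have "(1 + norm x) ^ N * norm (iter_partial bs (\<lambda>x. \<Phi> x - S x) x) \<le> e"
      if bs: "set bs \<subseteq> Basis" "length bs \<le> N" for bs x
    proof -
      have bsI: "bs \<in> ?I" using bs by simp
      have iL: "integrable lborel (\<lambda>w. L bs (x, w))"
        by (intro schwartz_integrable schwartz_slice_snd L bs)
      have iB: "integrable lborel (\<lambda>w. indicator B w * L bs (x, s i w))"
        by (rule simple_function_sum_integral(1)[OF s(1) B, where G = "\<lambda>u. L bs (x, u)"])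
      have "iter_partial bs (\<lambda>x. \<Phi> x - S x) x = iter_partial bs \<Phi> x - iter_partial bs S x"
        by (simp add: iter_partial_diff[OF \<Phi> S bs(1)])
      also have "iter_partial bs \<Phi> x = (LINT w|lborel. L bs (x, w))"
        unfolding \<Phi>_def[abs_def] iter_partial_integral[OF K bs(1)] L_def ..
      also have "iter_partial bs S x = (\<Sum>u\<in>range (s i). c u * L bs (x, u))"
        unfolding S_def[abs_def] iter_partial_sum[OF slice bs(1)] iter_partial_slice[OF K bs(1)] L_def ..
      also have "\<dots> = (LINT w|lborel. indicator B w * L bs (x, s i w))"
        unfolding c_def by (rule simple_function_sum_integral(2)[OF s(1) B, where G = "\<lambda>u. L bs (x, u)", symmetric])
      also have "(LINT w|lborel. L bs (x, w)) - \<dots> = (LINT w|lborel. L bs (x, w) - indicator B w * L bs (x, s i w))"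
        using iL iB by simp
      finally have eq: "(1 + norm x) ^ N * norm (iter_partial bs (\<lambda>x. \<Phi> x - S x) x) =
          norm (LINT w|lborel. (1 + norm x) ^ N *\<^sub>R (L bs (x, w) - indicator B w * L bs (x, s i w)))"
        by simp
      have i1: "integrable lborel (\<lambda>w. indicator B w * (M * norm (s i w - w)))"
        by (rule Bochner_Integration.integrable_bound[OF iB3])
          (measurable, intro AE_I2 order_trans[OF s_dom abs_ge_self[THEN order_trans]], simp)
      have i2: "integrable lborel (\<lambda>w. indicator (- B) w * ?d w)"
        by (rule Bochner_Integration.integrable_bound[OF d]) (use M0 in \<open>auto simp: indicator_def\<close>)
      have "norm (LINT w|lborel. (1 + norm x) ^ N *\<^sub>R (L bs (x, w) - indicator B w * L bs (x, s i w))) \<le>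
          (LINT w|lborel. norm ((1 + norm x) ^ N *\<^sub>R (L bs (x, w) - indicator B w * L bs (x, s i w))))"
        by (rule integral_norm_bound)
      also have "\<dots> \<le> (LINT w|lborel. indicator B w * (M * norm (s i w - w)) + indicator (- B) w * ?d w)"
      proof (rule integral_mono)
        show "integrable lborel (\<lambda>w. norm ((1 + norm x) ^ N *\<^sub>R (L bs (x, w) - indicator B w * L bs (x, s i w))))"
          using iL iB by (intro integrable_norm integrable_scaleR_right Bochner_Integration.integrable_diff)
        show "integrable lborel (\<lambda>w. indicator B w * (M * norm (s i w - w)) + indicator (- B) w * ?d w)"
          using i1 i2 by (rule Bochner_Integration.integrable_add)
        \<comment> \<open>On \<open>B\<close> the Lipschitz bound compares \<open>w\<close> with
          \<open>s i w\<close>; off \<open>B\<close> only the kernel itself is left, and the tail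
          bound applies.\<close>
        show "norm ((1 + norm x) ^ N *\<^sub>R (L bs (x, w) - indicator B w * L bs (x, s i w))) \<le>
            indicator B w * (M * norm (s i w - w)) + indicator (- B) w * ?d w" for w
          using M1[OF bsI, of x w] M2[OF bsI, of x w "s i w"]
          by (cases "w \<in> B") (simp_all add: norm_minus_commute)
      qed
      also have "\<dots> = (LINT w|lborel. indicator B w * (M * norm (s i w - w))) + (LINT w|lborel. indicator (- B) w * ?d w)"
        using i1 i2 by (rule Bochner_Integration.integral_add)
      also have "\<dots> < e" using i R unfolding B_def by argo
      finally show ?thesis unfolding eq by simp
    qed
    then have "schwartz_norm N (\<lambda>x. \<Phi> x - S x) \<le> real (card ?I) * e"
      by (rule schwartz_norm_le)
    moreover have "norm (D \<Phi>) \<le> \<bar>C\<bar> * schwartz_norm N (\<lambda>x. \<Phi> x - S x)"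
    proof -
      have "D \<Phi> = D (\<lambda>x. \<Phi> x - S x)"
        using add[OF schwartz_diff[OF \<Phi> S] S] DS by simp
      also have "norm \<dots> \<le> C * schwartz_norm N (\<lambda>x. \<Phi> x - S x)"
        by (rule C[OF schwartz_diff[OF \<Phi> S]])
      also have "\<dots> \<le> \<bar>C\<bar> * schwartz_norm N (\<lambda>x. \<Phi> x - S x)"
        by (intro mult_right_mono schwartz_norm_nonneg schwartz_diff \<Phi> S) simp
      finally show ?thesis .
    qed
    ultimately show ?thesis by (meson abs_ge_zero mult_left_mono order_trans)
  qed
  have "norm (D \<Phi>) \<le> 0 + e" if e: "e > 0" for e
  proof -
    let ?n = "\<bar>C\<bar> * real (card ?I) + 1"
    have n: "?n > 0" by (simp add: add_nonneg_pos)
    have "norm (D \<Phi>) \<le> \<bar>C\<bar> * real (card ?I) * (e / ?n)"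
      using key[of "e / ?n"] e n by (simp add: mult.assoc)
    also have "\<dots> \<le> ?n * (e / ?n)"
      using e n by (intro mult_right_mono) auto
    also have "\<dots> = e" using n by simp
    finally show ?thesis by simp
  qed
  then have "norm (D \<Phi>) \<le> 0" by (rule field_le_epsilon)
  then show ?thesis by (simp add: \<Phi>_def[abs_def])
qed

subsection \<open>The Moyal product as a distribution\<close>

text \<open>Parseval's identity for \<open>h\<close> and the transform of the matrix element;
  antisymmetry of \<open>symp_form\<close> compensates the reflection in
  \<open>symp_fourier_dist\<close>. Fubini uses integrability of the matrix element, the purpose of
  its rapid decay.\<close>

lemma weyl_form_dist_of_fun:
  fixes \<phi> \<psi> :: "real^'d::finite \<Rightarrow> complex"
  assumes eps: "eps > 0" and h: "schwartz h" and \<phi>: "schwartz \<phi>" and \<psi>: "schwartz \<psi>"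
  shows "weyl_form eps (dist_of_fun h) \<phi> \<psi> = cinner (abs_L2 \<phi>) (blinfun_apply (weyl_op eps h) (abs_L2 \<psi>))"
proof -
  let ?c = "complex_of_real (1 / (2 * pi) ^ CARD('d))"
  define k where "k X = cinner (abs_L2 \<phi>) (weyl eps X (abs_L2 \<psi>))" for X
  have km: "k \<in> borel_measurable borel" unfolding k_def[abs_def] by (rule measurable_cinner_weyl)
  have k: "integrable lborel k"
    by (rule rapid_integrable[OF _ km]) (use rapid_cinner_weyl[OF eps \<phi> \<psi>] in \<open>simp add: k_def[abs_def]\<close>)
  note [measurable] = km schwartz_measurable[OF h]
  have "integrable (lborel \<Otimes>\<^sub>M lborel) (\<lambda>p. iexp (symp_form (snd p) (fst p)) * (h (fst p) * k (snd p)))"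
    by (intro integrable_iexp_mult integrable_tensor schwartz_integrable h k) measurable
  then have int: "integrable (lborel \<Otimes>\<^sub>M lborel) (\<lambda>(Y, X). iexp (symp_form X Y) * (h Y * k X))"
    by (simp add: case_prod_unfold)
  have "(LINT Y|lborel. h Y * symp_integral k (- Y)) = (LINT Y|lborel. LINT X|lborel. iexp (symp_form X Y) * (h Y * k X))"
  proof (rule Bochner_Integration.integral_cong[OF refl])
    fix Y
    have "iexp (symp_form X Y) * (h Y * k X) = h Y * (iexp (symp_form (- Y) X) * k X)" for X
      using symp_form_swap[of X Y] by (simp add: symp_form_simps mult_ac)
    then show "h Y * symp_integral k (- Y) = (LINT X|lborel. iexp (symp_form X Y) * (h Y * k X))"
      unfolding symp_integral_def by (simp only: integral_mult_right_zero)
  qed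
  also have "\<dots> = (LINT X|lborel. LINT Y|lborel. iexp (symp_form X Y) * (h Y * k X))"
    by (rule lborel_pair.Fubini_integral[OF int, symmetric])
  also have "\<dots> = (LINT X|lborel. symp_integral h X * k X)"
    unfolding symp_integral_def by (simp only: mult.assoc[symmetric] integral_mult_left_zero)
  finally have P: "(LINT Y|lborel. h Y * symp_integral k (- Y)) = (LINT X|lborel. symp_integral h X * k X)" .
  have "weyl_form eps (dist_of_fun h) \<phi> \<psi> = ?c * (LINT Y|lborel. h Y * (?c * symp_integral k (- Y)))"
    unfolding weyl_form_def symp_fourier_dist_def dist_of_fun_def weyl_system_eq symp_fourier_eq k_def[abs_def] ..
  also have "(LINT Y|lborel. h Y * (?c * symp_integral k (- Y))) = (LINT Y|lborel. ?c * (h Y * symp_integral k (- Y)))"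
    by (simp only: mult.left_commute)
  also have "\<dots> = ?c * (LINT X|lborel. symp_integral h X * k X)"
    by (simp only: integral_mult_right_zero P)
  also have "\<dots> = (LINT X|lborel. symp_fourier h X * k X)"
    unfolding symp_fourier_eq by (simp only: mult.assoc integral_mult_right_zero)
  finally show ?thesis unfolding cinner_weyl_op[OF h] k_def .
qed

lemma is_moyal_product_moyal_product:
  assumes eps: "eps > 0" and f: "schwartz f" and g: "schwartz g"
  shows "is_moyal_product eps f g (dist_of_fun (moyal_product eps f g))"
  unfolding is_moyal_product_def
proof (intro conjI allI impI)
  note h = schwartz_moyal_product[OF f g, of eps]
  show "tempered_distribution (dist_of_fun (moyal_product eps f g))"
    by (rule tempered_distribution_dist_of_fun[OF h])
  show "weyl_form eps (dist_of_fun (moyal_product eps f g)) \<phi> \<psi> =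
      cinner (abs_L2 \<phi>) (blinfun_apply (weyl_op eps f o\<^sub>L weyl_op eps g) (abs_L2 \<psi>))"
    if "schwartz \<phi>" "schwartz \<psi>" for \<phi> \<psi>
    using weyl_form_dist_of_fun[OF eps h that] by (simp only: weyl_op_moyal_product[OF f g])
qed

subsection \<open>Uniqueness\<close>

text \<open>Up to a constant, the cross-Wigner function of two phase-space translates of
  \<open>ground_state\<close>; these are the test functions for symbols.\<close>

definition coherent :: "real \<Rightarrow> 'd::finite phase_space \<Rightarrow> 'd phase_space \<Rightarrow> 'd phase_space \<Rightarrow> complex" where
  "coherent eps a b Y = iexp (symp_form b Y) * of_real (exp (- (1 / eps) * (norm (Y - a))\<^sup>2))"

text \<open>Ground state of the harmonic oscillator with Planck constant \<open>eps\<close>; this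
  width gives both halves of X the same coefficient \<open>eps / 4\<close> in
  \<open>cinner_weyl_ground_state\<close>.\<close>

definition ground_state :: "real \<Rightarrow> real^'d::finite \<Rightarrow> complex" where
  "ground_state eps y = of_real (exp (- (1 / (2 * eps)) * (norm y)\<^sup>2))"

lemma schwartz_ground_state: "eps > 0 \<Longrightarrow> schwartz (ground_state eps)"
  unfolding ground_state_def[abs_def] by (rule schwartz_gaussian) simp

text \<open>Shifting \<open>y\<close> by - (eps/2) x places the two Gaussians symmetrically: the
  mixed terms cancel and the constant phase disappears, leaving a Gaussian Fourier integral in
  \<open>y\<close>.\<close>

lemma cinner_weyl_ground_state:
  fixes X :: "'d::finite phase_space"
  assumes eps: "eps > 0"
  shows "cinner (abs_L2 (ground_state eps)) (weyl eps X (abs_L2 (ground_state eps))) =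
    of_real (sqrt (pi * eps) ^ CARD('d) * exp (- (eps / 4) * (norm X)\<^sup>2))"
proof -
  let ?g = "ground_state eps :: real^'d \<Rightarrow> complex"
  let ?F = "\<lambda>y. cnj (?g y) * weyl_fun eps X ?g y"
  have g: "schwartz ?g" by (rule schwartz_ground_state[OF eps])
  have [measurable]: "?g \<in> borel_measurable borel" by (rule schwartz_measurable[OF g])
  have "?F \<in> borel_measurable borel"
    using schwartz_measurable[OF schwartz_weyl_fun[OF g, of eps X]] by measurable
  then have "(LINT y|lborel. ?F y) = (LINT y|lborel. ?F (y + - (eps / 2) *\<^sub>R fst X))"
    by (rule lborel_integral_shift[symmetric])
  also have "\<dots> = (LINT y|lborel. of_real (exp (- (eps / 4) * (norm (fst X))\<^sup>2)) *
      (iexp ((- snd X) \<bullet> y) * of_real (exp (- (1 / eps) * (norm y)\<^sup>2))))"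
  proof (rule Bochner_Integration.integral_cong[OF refl])
    fix y
    let ?y = "y + - (eps / 2) *\<^sub>R fst X"
    have y: "?y + eps *\<^sub>R fst X = y + (eps / 2) *\<^sub>R fst X"
      by (simp add: algebra_simps flip: scaleR_add_left)
    have ph: "- (snd X \<bullet> ?y + eps / 2 * (snd X \<bullet> fst X)) = (- snd X) \<bullet> y"
      by (simp add: inner_simps)
    have n: "(norm ?y)\<^sup>2 + (norm (y + (eps / 2) *\<^sub>R fst X))\<^sup>2 = 2 * (norm y)\<^sup>2 + eps\<^sup>2 / 2 * (norm (fst X))\<^sup>2"
      unfolding power2_norm_eq_inner by (simp add: inner_simps power2_eq_square algebra_simps inner_commute)
    have "- (1 / (2 * eps)) * (norm ?y)\<^sup>2 + - (1 / (2 * eps)) * (norm (y + (eps / 2) *\<^sub>R fst X))\<^sup>2 =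
        - (1 / (2 * eps)) * ((norm ?y)\<^sup>2 + (norm (y + (eps / 2) *\<^sub>R fst X))\<^sup>2)"
      by (simp only: distrib_left)
    also have "\<dots> = - (eps / 4) * (norm (fst X))\<^sup>2 + - (1 / eps) * (norm y)\<^sup>2"
      unfolding n using eps by (simp add: field_simps power2_eq_square)
    finally have e: "exp (- (1 / (2 * eps)) * (norm ?y)\<^sup>2) * exp (- (1 / (2 * eps)) * (norm (y + (eps / 2) *\<^sub>R fst X))\<^sup>2) =
        exp (- (eps / 4) * (norm (fst X))\<^sup>2) * exp (- (1 / eps) * (norm y)\<^sup>2)"
      by (simp only: exp_add[symmetric])
    have "?F ?y = iexp ((- snd X) \<bullet> y) * of_real (exp (- (1 / (2 * eps)) * (norm ?y)\<^sup>2) * exp (- (1 / (2 * eps)) * (norm (y + (eps / 2) *\<^sub>R fst X))\<^sup>2))"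
      unfolding weyl_fun_def y ph ground_state_def complex_cnj_complex_of_real of_real_mult by (simp only: mult_ac)
    then show "?F ?y = of_real (exp (- (eps / 4) * (norm (fst X))\<^sup>2)) *
      (iexp ((- snd X) \<bullet> y) * of_real (exp (- (1 / eps) * (norm y)\<^sup>2)))"
      unfolding e of_real_mult by (simp only: mult_ac)
  qed
  also have "\<dots> = of_real (exp (- (eps / 4) * (norm (fst X))\<^sup>2)) *
      of_real (sqrt (pi / (1 / eps)) ^ DIM(real^'d) * exp (- (norm (- snd X))\<^sup>2 / (4 * (1 / eps))))"
    unfolding integral_mult_right_zero using eps by (subst gaussian_fourier(2)) auto
  also have "\<dots> = of_real (sqrt (pi * eps) ^ CARD('d) * (exp (- (eps / 4) * (norm (fst X))\<^sup>2) * exp (- (eps / 4) * (norm (snd X))\<^sup>2)))"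
    by (simp add: mult_ac)
  also have "exp (- (eps / 4) * (norm (fst X))\<^sup>2) * exp (- (eps / 4) * (norm (snd X))\<^sup>2) = exp (- (eps / 4) * (norm X)\<^sup>2)"
    by (simp add: norm_prod_def distrib_left flip: exp_add)
  finally show ?thesis
    unfolding cinner_weyl_schwartz[OF g g] .
qed

text \<open>By covariance, the matrix elements between the translates of the Gaussian by \<open>A\<close> and \<open>B\<close>
  transform into the Gaussian centred at \<open>- eps (A + B) / 2\<close> and modulated by \<open>A - B\<close>.\<close>

lemma symp_fourier_cinner_weyl_coherent:
  fixes a b :: "'d::finite phase_space"
  assumes eps: "eps > 0"
  defines "A \<equiv> - (1 / eps) *\<^sub>R a + (1 / 2) *\<^sub>R b" and "B \<equiv> - (1 / eps) *\<^sub>R a - (1 / 2) *\<^sub>R b"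
  shows "\<exists>c. c \<noteq> 0 \<and> (\<forall>Y. symp_fourier (\<lambda>X. cinner (abs_L2 (weyl_fun eps A (ground_state eps)))
    (weyl eps X (abs_L2 (weyl_fun eps B (ground_state eps))))) (- Y) = c * coherent eps a b Y)"
proof -
  let ?g = "ground_state eps :: real^'d \<Rightarrow> complex"
  let ?\<theta> = "eps / 2 * symp_form A B"
  let ?G = "\<lambda>X. complex_of_real (exp (- (eps / 4) * (norm X)\<^sup>2))"
  define C where "C = complex_of_real (sqrt (pi * eps) ^ CARD('d))"
  define k where "k X = cinner (abs_L2 (weyl_fun eps A ?g)) (weyl eps X (abs_L2 (weyl_fun eps B ?g)))" for X
  have sq: "square_integrable ?g"
    by (rule schwartz_square_integrable[OF schwartz_ground_state[OF eps]])
  \<comment> \<open>\<open>A\<close> and \<open>B\<close> are the solution of these two equations: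
    the difference fixes the modulation, the sum the centre.\<close>
  have AB: "A - B = b" "eps *\<^sub>R (A + B) = - 2 *\<^sub>R a"
    using eps by (simp_all add: A_def B_def algebra_simps flip: scaleR_add_left)
  \<comment> \<open>Applying W(-A) to both sides of the inner product and multiplying out the Weyl
    operators leaves the ground-state matrix element at X - b with an explicit phase.\<close>
  have k: "k X = C * (iexp (symp_form a X - ?\<theta>) * ?G (X - b))" for X
  proof -
    have "k X = cinner (weyl eps (- A) (weyl eps A (abs_L2 ?g))) (weyl eps (- A) (weyl eps X (weyl eps B (abs_L2 ?g))))"
      unfolding k_def cinner_weyl_weyl by (simp add: weyl_abs_L2[OF sq])
    also have "\<dots> = iexp (eps / 2 * symp_form X B) * iexp (eps / 2 * symp_form (- A) (X + B)) *
        cinner (abs_L2 ?g) (weyl eps (- A + (X + B)) (abs_L2 ?g))"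
      by (simp add: weyl_mult unitaryD(2)[OF unitary_weyl] scaleC_scaleC cinner_scaleC_right symp_form_simps weyl_zero scaleC_one)
    also have "- A + (X + B) = X - b" unfolding AB(1)[symmetric] by simp
    also have "iexp (eps / 2 * symp_form X B) * iexp (eps / 2 * symp_form (- A) (X + B)) = iexp (symp_form a X - ?\<theta>)"
    proof -
      have "symp_form (eps *\<^sub>R (A + B)) X = - 2 * symp_form a X"
        unfolding AB(2) by (simp add: symp_form_simps)
      then have "eps / 2 * symp_form X B + eps / 2 * symp_form (- A) (X + B) = symp_form a X - ?\<theta>"
        using symp_form_swap[of X B] by (simp add: symp_form_simps algebra_simps)
      then show ?thesis by (simp only: exp_add[symmetric] distrib_left[symmetric] of_real_add[symmetric])
    qed
    finally show ?thesis
      unfolding cinner_weyl_ground_state[OF eps] of_real_mult C_def by (simp only: mult_ac)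
  qed
  define c where "c = C * iexp (symp_form a b - ?\<theta>) * complex_of_real (sqrt (pi / (eps / 4)) ^ DIM('d phase_space))"
  have "symp_integral k (- Y) = c * coherent eps a b Y" for Y
  proof -
    have "symp_integral k (- Y) = (LINT X|lborel. iexp (symp_form (- Y) X) * k X)"
      by (simp add: symp_integral_def)
    \<comment> \<open>The shift by \<open>b\<close> centres the Gaussian; the phases left behind are
      a constant and the modulation \<open>symp_form b Y\<close>.\<close>
    also have "\<dots> = (LINT X|lborel. iexp (symp_form (- Y) (X + b)) * k (X + b))"
    proof (rule lborel_integral_shift[where f = "\<lambda>X. iexp (symp_form (- Y) X) * k X", symmetric])
      show "(\<lambda>X. iexp (symp_form (- Y) X) * k X) \<in> borel_measurable borel"
        unfolding k by measurable
    qed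
    also have "\<dots> = (LINT X|lborel. (C * iexp (symp_form a b - ?\<theta>) * iexp (symp_form b Y)) * (iexp (symp_rot (a - Y) \<bullet> X) * ?G X))"
    proof (rule Bochner_Integration.integral_cong[OF refl])
      fix X
      have "symp_form (- Y) (X + b) + (symp_form a (X + b) - ?\<theta>) =
          (symp_form a b - ?\<theta>) + symp_form b Y + symp_rot (a - Y) \<bullet> X"
        unfolding symp_form_inner[symmetric] using symp_form_swap[of Y b] by (simp add: symp_form_simps)
      then have E: "iexp (symp_form (- Y) (X + b)) * iexp (symp_form a (X + b) - ?\<theta>) =
          iexp (symp_form a b - ?\<theta>) * iexp (symp_form b Y) * iexp (symp_rot (a - Y) \<bullet> X)"
        by (simp only: exp_add[symmetric] distrib_left[symmetric] of_real_add[symmetric])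
      have "iexp (symp_form (- Y) (X + b)) * k (X + b) =
          C * (iexp (symp_form (- Y) (X + b)) * iexp (symp_form a (X + b) - ?\<theta>)) * ?G X"
        unfolding k add_diff_cancel_right' by (simp only: mult_ac)
      then show "iexp (symp_form (- Y) (X + b)) * k (X + b) =
          (C * iexp (symp_form a b - ?\<theta>) * iexp (symp_form b Y)) * (iexp (symp_rot (a - Y) \<bullet> X) * ?G X)"
        unfolding E by (simp only: mult_ac)
    qed
    also have "\<dots> = (C * iexp (symp_form a b - ?\<theta>) * iexp (symp_form b Y)) *
        of_real (sqrt (pi / (eps / 4)) ^ DIM('d phase_space) * exp (- (norm (symp_rot (a - Y)))\<^sup>2 / (4 * (eps / 4))))"
      unfolding integral_mult_right_zero using eps by (subst gaussian_fourier(2)) auto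
    also have "exp (- (norm (symp_rot (a - Y)))\<^sup>2 / (4 * (eps / 4))) = exp (- (1 / eps) * (norm (Y - a))\<^sup>2)"
      by (simp add: norm_minus_commute)
    finally show ?thesis
      unfolding c_def coherent_def of_real_mult by (simp only: mult_ac)
  qed
  then have "symp_fourier k (- Y) = (complex_of_real (1 / (2 * pi) ^ CARD('d)) * c) * coherent eps a b Y" for Y
    unfolding symp_fourier_eq by simp
  moreover have "complex_of_real (1 / (2 * pi) ^ CARD('d)) * c \<noteq> 0"
    using eps by (simp add: c_def C_def)
  ultimately show ?thesis unfolding k_def[abs_def] by blast
qed

lemma schwartz_coherent:
  assumes "eps > 0"
  shows "schwartz (coherent eps a b)"
proof -
  have "schwartz (\<lambda>Y. complex_of_real (exp (- (1 / eps) * (norm (Y + - a))\<^sup>2)))"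
    using assms by (intro schwartz_shift[where f = "\<lambda>Y. complex_of_real (exp (- (1 / eps) * (norm Y)\<^sup>2))"] schwartz_gaussian) simp
  then show ?thesis
    unfolding coherent_def[abs_def] by (intro schwartz_slow_mult slow_iexp slow_symp_form_right) simp
qed

lemma tempered_distribution_cmult:
  "tempered_distribution D \<Longrightarrow> schwartz \<phi> \<Longrightarrow> D (\<lambda>x. c * \<phi> x) = c * D \<phi>"
  unfolding tempered_distribution_def by blast

text \<open>Superposing the modulated Gaussians over \<open>b\<close> gives all products of a Gaussian with a Schwartz
  function, by Fourier inversion; superposing these over the centre \<open>a\<close> removes the Gaussian.\<close>

lemma tempered_distribution_coherent_zero:
  fixes D :: "('d::finite phase_space \<Rightarrow> complex) \<Rightarrow> complex"
  assumes eps: "eps > 0" and D: "tempered_distribution D"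
    and zero: "\<And>a b. D (coherent eps a b) = 0" and \<Phi>: "schwartz \<Phi>"
  shows "D \<Phi> = 0"
proof -
  define G where "G Y = complex_of_real (exp (- (1 / eps) * (norm Y)\<^sup>2))" for Y :: "'d phase_space"
  have G: "schwartz G" unfolding G_def[abs_def] using eps by (intro schwartz_gaussian) simp
  have Ga: "schwartz (\<lambda>Y. G (Y - a))" for a
    using schwartz_shift[OF G, of "- a"] by simp
  have step1: "D (\<lambda>Y. G (Y - a) * \<Phi> Y) = 0" for a
  proof -
    \<comment> \<open>Reflected because \<sigma>(b, Y) = \<sigma>(- Y, b), so that the inversion
      below is evaluated at - Y.\<close>
    define \<Phi>' where "\<Phi>' Y = \<Phi> (- Y)" for Y
    have "schwartz (\<lambda>Y. \<Phi> (- Y + 0))"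
      by (rule schwartz_affine[where c = 1, OF \<Phi>]) (auto intro: bounded_linear_minus bounded_linear_ident)
    then have \<Phi>': "schwartz \<Phi>'" by (simp add: \<Phi>'_def[abs_def])
    define u where "u = symp_integral \<Phi>'"
    have u: "schwartz u" unfolding u_def by (rule schwartz_symp_integral[OF \<Phi>'])
    let ?K = "\<lambda>p. iexp (symp_form (snd p) (fst p)) * (G (fst p - a) * u (snd p))"
    have K: "schwartz ?K"
    proof (rule schwartz_slow_mult)
      show "slow (\<lambda>p. iexp (symp_form (snd p) (fst p)))"
        by (intro slow_iexp slow_symp_form bounded_linear_fst bounded_linear_snd)
      show "schwartz (\<lambda>p. G (fst p - a) * u (snd p))"
        by (rule schwartz_tensor[OF Ga u])
    qed
    have "D (\<lambda>Y. LINT b|lborel. ?K (Y, b)) = 0"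
    proof (rule tempered_distribution_integral[OF D K])
      fix b
      have "(\<lambda>Y. ?K (Y, b)) = (\<lambda>Y. u b * coherent eps a b Y)"
        by (simp add: coherent_def G_def fun_eq_iff mult_ac)
      then show "D (\<lambda>Y. ?K (Y, b)) = 0"
        using tempered_distribution_cmult[OF D schwartz_coherent[OF eps]] zero by simp
    qed
    moreover have "(LINT b|lborel. ?K (Y, b)) = of_real ((2 * pi) ^ (2 * CARD('d))) * (G (Y - a) * \<Phi> Y)" for Y
    proof -
      have "?K (Y, b) = G (Y - a) * (iexp (symp_form (- Y) b) * u b)" for b
        using symp_form_swap[of b Y] by (simp add: symp_form_simps mult_ac)
      then have "(LINT b|lborel. ?K (Y, b)) = G (Y - a) * symp_integral u (- Y)"
        unfolding symp_integral_def by (simp only: integral_mult_right_zero)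
      then show ?thesis
        unfolding u_def symp_integral_involution[OF \<Phi>'] by (simp add: \<Phi>'_def mult_ac)
    qed
    ultimately have "of_real ((2 * pi) ^ (2 * CARD('d))) * D (\<lambda>Y. G (Y - a) * \<Phi> Y) = 0"
      using tempered_distribution_cmult[OF D schwartz_slow_mult[OF schwartz_slow[OF Ga] \<Phi>]] by simp
    then show ?thesis by simp
  qed
  \<comment> \<open>For each fixed centre the slice is annihilated by \<open>step1\<close>;
    integrating over the centre replaces the Gaussian by its total mass, a nonzero constant.\<close>
  let ?K = "\<lambda>p. G (fst p - snd p) * \<Phi> (fst p)"
  have K: "schwartz ?K"
  proof -
    have "schwartz (\<lambda>p. (\<lambda>q. G (fst q) * \<Phi> (snd q)) ((fst p - snd p, fst p) + 0))"
    proof (rule schwartz_affine[where c = 3 and L = "\<lambda>p. (fst p - snd p, fst p)"])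
      show "schwartz (\<lambda>q. G (fst q) * \<Phi> (snd q))" by (rule schwartz_tensor[OF G \<Phi>])
      show "bounded_linear (\<lambda>p. (fst p - snd p, fst p))"
        by (intro bounded_linear_Pair bounded_linear_sub bounded_linear_fst bounded_linear_snd)
      fix p :: "'d phase_space \<times> 'd phase_space"
      have "norm p \<le> norm (fst p) + norm (snd p)" using norm_Pair_le[of "fst p" "snd p"] by simp
      moreover have "norm (snd p) \<le> norm (fst p - snd p) + norm (fst p)"
        using norm_triangle_ineq4[of "fst p" "fst p - snd p"] by simp
      ultimately show "norm p \<le> 3 * norm (fst p - snd p, fst p)"
        using norm_fst_le[of "fst p - snd p" "fst p"] norm_snd_le[of "fst p" "fst p - snd p"] by argo
    qed
    then show ?thesis by simp
  qed
  have "D (\<lambda>Y. LINT a|lborel. ?K (Y, a)) = 0"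
    by (rule tempered_distribution_integral[OF D K]) (simp add: step1)
  moreover have "(LINT a|lborel. ?K (Y, a)) = of_real (sqrt (pi / (1 / eps)) ^ DIM('d phase_space)) * \<Phi> Y" for Y
  proof -
    have "(LINT a|lborel. ?K (Y, a)) = (LINT a|lborel. G (Y + (- 1) *\<^sub>R a)) * \<Phi> Y"
      by (simp add: integral_mult_left_zero)
    also have "(LINT a|lborel. G (Y + (- 1) *\<^sub>R a)) = (LINT a|lborel. G a)"
      by (subst lborel_integral_affine) (auto intro: schwartz_measurable G)
    also have "\<dots> = of_real (sqrt (pi / (1 / eps)) ^ DIM('d phase_space))"
      unfolding G_def by (rule gaussian_integral) (use eps in simp)
    finally show ?thesis .
  qed
  ultimately have "of_real (sqrt (pi / (1 / eps)) ^ DIM('d phase_space)) * D \<Phi> = 0"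
    by (simp only: tempered_distribution_cmult[OF D \<Phi>])
  then show ?thesis using eps by simp
qed

text \<open>The two forms are compared on pairs of translated ground states. Each pair yields one
  function \<open>coherent eps a b\<close> with a nonzero factor, so the difference of the two
  distributions annihilates all of these.\<close>

lemma is_moyal_product_unique:
  fixes f g h :: "'d::finite phase_space \<Rightarrow> complex"
  assumes eps: "eps > 0" and h: "schwartz h"
    and Th: "is_moyal_product eps f g (dist_of_fun h)" and T: "is_moyal_product eps f g T"
    and \<Phi>: "schwartz \<Phi>"
  shows "T \<Phi> = dist_of_fun h \<Phi>"
proof -
  let ?D = "\<lambda>\<phi>. T \<phi> - dist_of_fun h \<phi>"
  have tT: "tempered_distribution T" and th: "tempered_distribution (dist_of_fun h)"
    using T Th by (auto simp: is_moyal_product_def)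
  have "?D \<Phi> = 0"
  proof (rule tempered_distribution_coherent_zero[OF eps tempered_distribution_diff_fun[OF tT h] _ \<Phi>])
    fix a b :: "'d phase_space"
    define A where "A = - (1 / eps) *\<^sub>R a + (1 / 2) *\<^sub>R b"
    define B where "B = - (1 / eps) *\<^sub>R a - (1 / 2) *\<^sub>R b"
    define \<phi> where "\<phi> = weyl_fun eps A (ground_state eps)"
    define \<psi> where "\<psi> = weyl_fun eps B (ground_state eps)"
    have \<phi>\<psi>: "schwartz \<phi>" "schwartz \<psi>"
      unfolding \<phi>_def \<psi>_def by (intro schwartz_weyl_fun schwartz_ground_state eps)+
    obtain c where c: "c \<noteq> 0" "\<And>Y. symp_fourier (\<lambda>X. cinner (abs_L2 \<phi>) (weyl eps X (abs_L2 \<psi>))) (- Y) = c * coherent eps a b Y"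
      using symp_fourier_cinner_weyl_coherent[OF eps, of a b] unfolding \<phi>_def \<psi>_def A_def B_def by blast
    \<comment> \<open>The transformed matrix element is a multiple of a Schwartz function, so
      homogeneity of \<open>S\<close> applies to it.\<close>
    have form: "weyl_form eps S \<phi> \<psi> = complex_of_real (1 / (2 * pi) ^ CARD('d)) * (c * S (coherent eps a b))"
      if "tempered_distribution S" for S
      unfolding weyl_form_def symp_fourier_dist_def weyl_system_eq c(2)
      using tempered_distribution_cmult[OF that schwartz_coherent[OF eps]] by simp
    have "weyl_form eps T \<phi> \<psi> = weyl_form eps (dist_of_fun h) \<phi> \<psi>"
      using T Th \<phi>\<psi> unfolding is_moyal_product_def by simp
    then show "?D (coherent eps a b) = 0"
      using c(1) by (simp add: form[OF tT] form[OF th])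
  qed
  then show ?thesis by simp
qed

theorem theorem6p20:
  fixes eps :: real
    and f g :: "'d::finite phase_space \<Rightarrow> complex"
  assumes "eps > 0" and "schwartz f" and "schwartz g"
  shows "\<exists>h. schwartz h \<and>
    is_moyal_product eps f g (dist_of_fun h) \<and>
    (\<forall>T. is_moyal_product eps f g T \<longrightarrow> (\<forall>\<phi>. schwartz \<phi> \<longrightarrow> T \<phi> = dist_of_fun h \<phi>)) \<and>
    weyl_op eps h = weyl_op eps f o\<^sub>L weyl_op eps g \<and>
    (\<forall>X. h X = complex_of_real (1 / (2 * pi) ^ (2 * CARD('d))) *
      (LINT Y|lborel. LINT Z|lborel.
         exp (\<i> * complex_of_real (symp_form X (Y + Z))) *
         exp (\<i> * complex_of_real (eps / 2 * symp_form Y Z)) *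
         symp_fourier f Y * symp_fourier g Z)) \<and>
    (\<forall>X. h X = complex_of_real (1 / (pi * eps) ^ (2 * CARD('d))) *
      (LINT Y|lborel. LINT Z|lborel.
         exp (- \<i> * complex_of_real (2 / eps * symp_form (X - Y) (X - Z))) * f Y * g Z))"
proof (intro exI[of _ "moyal_product eps f g"] conjI allI impI)
  show h: "schwartz (moyal_product eps f g)"
    by (rule schwartz_moyal_product[OF assms(2,3)])
  show M: "is_moyal_product eps f g (dist_of_fun (moyal_product eps f g))"
    by (rule is_moyal_product_moyal_product[OF assms])
  show "T \<phi> = dist_of_fun (moyal_product eps f g) \<phi>" if "is_moyal_product eps f g T" "schwartz \<phi>" for T \<phi>
    by (rule is_moyal_product_unique[OF assms(1) h M that])
  show "weyl_op eps (moyal_product eps f g) = weyl_op eps f o\<^sub>L weyl_op eps g"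
    by (rule weyl_op_moyal_product[OF assms(2,3)])
qed (rule moyal_product_fourier[OF assms(2,3)], rule moyal_product_integral[OF assms])

end
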